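(* Let $c\in\mathbb{R}$, $T>0$, and let $a\colon\mathbb{R}\to\mathbb{R}$ be a $T$-periodic continuous function with minimal period $T$ such that there exist two consecutive zeros $\alpha<\beta$ of $a$ with $a(t)>0$ for all $t\in(\alpha,\beta)$ and $a(t)<0$ for all $t\in(\beta,\alpha+T)$. Let $g\colon[0,+\infty)\to[0,+\infty)$ be a continuous function with $g(0)=0$, $g(s)>0$ for $s>0$, and $$g_{0}:=\limsup_{s\to0^{+}}\frac{g(s)}{s}=0,\qquad g_{\infty}:=\liminf_{s\to+\infty}\frac{g(s)}{s}=+\infty.$$ Then there exist $0<r<R$ and $\mu^{**}>0$ such that, for all $\mu>\mu^{**}$, given any two-sided sequence $\mathcal{L}=(s_{i})_{i\in\mathbb{Z}}\in\{0,1\}^{\mathbb{Z}}$ which is not identically zero, there exists at least one positive solution $u=u_{\mathcal{L}}\colon\mathbb{R}\to\mathbb{R}$ of $$u''+cu'+\bigl(a^{+}(t)-\mu a^{-}(t)\bigr)g(u)=0$$ such that $\|u\|_{\infty}<R$ and - $0<u(t)<r$ on $[\alpha+iT,\beta+iT]$, if $s_{i}=0$; - $r<u(\hat t_{i})<R$ for some $\hat t_{i}\in[\alpha+iT,\beta+iT]$, if $s_{i}=1$; - $0<u(t)<r$ on $[\beta+iT,\alpha+(i+1)T]$, for all $i\in\mathbb{Z}$.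
   Context: Here $a^{+}=(|a|+a)/2$ and $a^{-}=(|a|-a)/2$. A positive solution is a solution with $u(t)>0$ for all $t\in\mathbb{R}$; $\|u\|_{\infty}=\sup_{t\in\mathbb{R}}|u(t)|$. *)

theory Defs
  imports "HOL-Analysis.Analysis"
begin

definition plus_part :: "real \<Rightarrow> real" where
  "plus_part x = (\<bar>x\<bar> + x) / 2"

definition minus_part :: "real \<Rightarrow> real" where
  "minus_part x = (\<bar>x\<bar> - x) / 2"

definition periodic :: "(real \<Rightarrow> real) \<Rightarrow> real \<Rightarrow> bool" where
  "periodic f T \<longleftrightarrow> (\<forall>t. f (t + T) = f t)"

definition minimal_period :: "(real \<Rightarrow> real) \<Rightarrow> real \<Rightarrow> bool" where
  "minimal_period f T \<longleftrightarrow>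
     T > 0 \<and> periodic f T \<and> (\<forall>p. 0 < p \<and> p < T \<longrightarrow> \<not> periodic f p)"

text \<open>The supremum is taken in the extended reals, so that it equals \<open>\<infinity>\<close> for unbounded functions.\<close>

definition sup_norm :: "(real \<Rightarrow> real) \<Rightarrow> ereal" where
  "sup_norm u = (SUP t. ereal \<bar>u t\<bar>)"

text \<open>
  Classical positive solutions on the whole real line of
  \<open>u'' + c u' + (a\<^sup>+(t) - \<mu> a\<^sup>-(t)) g(u) = 0\<close>.  Since \<open>u > 0\<close>,
  only the values of \<open>g\<close> on \<open>[0,\<infinity>)\<close> matter.
\<close>

definition positive_solution ::
  "real \<Rightarrow> (real \<Rightarrow> real) \<Rightarrow> real \<Rightarrow> (real \<Rightarrow> real) \<Rightarrow> (real \<Rightarrow> real) \<Rightarrow> bool" where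
  "positive_solution c a \<mu> g u \<longleftrightarrow>
     (\<forall>t. u t > 0) \<and>
     (\<exists>u' u''.
        (\<forall>t. (u has_real_derivative u' t) (at t)) \<and>
        (\<forall>t. (u' has_real_derivative u'' t) (at t)) \<and>
        (\<forall>t. u'' t + c * u' t + (plus_part (a t) - \<mu> * minus_part (a t)) * g (u t) = 0))"

end

theory Submission
  imports Defs "HOL-Complex_Analysis.Great_Picard"
begin

text \<open>
  The proof is a one-parameter shooting argument. On \<open>[\<alpha>, \<beta>]\<close> a solution is concave up to the friction
  term: superlinearity bounds all solutions that stay nonnegative there, and forces death (a crossing of
  zero, which is final if \<open>g\<close> is extended by \<open>0\<close>) when the initial slope is large. On
  \<open>[\<beta>, \<alpha> + T]\<close> it is convex, and for large \<open>\<mu>\<close> a solution that enters at height at least \<open>r/2\<close> with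
  bounded slope is pushed above \<open>r\<close>, while a solution that stays below \<open>r\<close> and ends at height \<open>r\<close> has a
  large final slope. Consequently a curve of initial data at \<open>\<alpha>\<close> joining a dead solution to one
  at height \<open>r\<close> contains, for each of the two symbols, a subcurve that follows the symbol during the next
  period and again joins a dead solution to one at height \<open>r\<close>. Iterating gives every finite itinerary.

  Since \<open>g\<close> is only continuous, this is done for Lipschitz approximations of \<open>g\<close> from below; the solutions
  on growing intervals converge along a subsequence. The same estimates make the closed
  conditions on the limit strict, and \<open>g(s) = O(s)\<close> excludes zeros of a nontrivial limit.
\<close>

section \<open>Estimates on a single interval\<close>

text \<open>The invariant handed from one period to the next is a curve of data at the start of a
  period. One end has \<open>u = 0\<close> and slope at most 0; the other has height
  \<open>r\<close>; every datum of height \<open>r\<close> has slope at least \<open>K\<close>.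
  Since \<open>K\<close> exceeds the initial slope of any solution that starts at height
  \<open>r\<close> and survives the bump \<open>[\<alpha>, \<beta>]\<close>, the second end dies by
  time \<beta>. Convexity on \<open>[\<beta>, \<alpha> + T]\<close> restores the slope condition at
  the next start. The order in which the constants are fixed avoids a circle: \<epsilon>, \<Lambda>,
  \<kappa> come from \<open>c\<close>, \<open>a\<close> and the intervals; then \<open>r\<close>
  from the behaviour of \<open>g\<close> at 0 and \<rho> from that at infinity; then the bounds
  \<open>G\<close> and \<gamma> for the nonlinearity; then \<open>K\<close>; and last the threshold
  for \<mu>. None of them refers to the Lipschitz constant, the number of periods or the itinerary,
  so a single subsequence can refine the approximation and widen the window at once.\<close>

lemma mvt_within:
  fixes f :: "real \<Rightarrow> real"
  assumes "x < y" "{x..y} \<subseteq> S"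
    and "\<And>t. t \<in> {x..y} \<Longrightarrow> (f has_real_derivative f' t) (at t within S)"
  obtains \<xi> where "x < \<xi>" "\<xi> < y" "f y - f x = f' \<xi> * (y - x)"
proof -
  have "\<exists>\<xi>\<in>{x<..<y}. f y - f x = (\<lambda>h. f' \<xi> * h) (y - x)"
  proof (rule mvt_simple[OF assms(1)])
    fix t assume "x \<le> t" "t \<le> y"
    then have "(f has_real_derivative f' t) (at t within {x..y})"
      using assms(2,3) DERIV_subset by fastforce
    then show "(f has_derivative (\<lambda>h. f' t * h)) (at t within {x..y})"
      by (simp add: has_field_derivative_def)
  qed
  then show thesis using that by auto
qed

lemma increment_ge:
  fixes f :: "real \<Rightarrow> real"
  assumes "x \<le> y" "{x..y} \<subseteq> S"
    and "\<And>t. t \<in> {x..y} \<Longrightarrow> (f has_real_derivative f' t) (at t within S)"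
    and "\<And>t. t \<in> {x..y} \<Longrightarrow> f' t \<ge> m"
  shows "f y \<ge> f x + m * (y - x)"
proof (cases "x = y")
  case False
  then have "x < y" using assms(1) by simp
  then obtain \<xi> where "x < \<xi>" "\<xi> < y" "f y - f x = f' \<xi> * (y - x)"
    using mvt_within[OF _ assms(2,3)] by blast
  moreover have "f' \<xi> * (y - x) \<ge> m * (y - x)"
    using assms(1,4) calculation by (intro mult_right_mono) auto
  ultimately show ?thesis by linarith
qed simp

lemma increment_le:
  fixes f :: "real \<Rightarrow> real"
  assumes "x \<le> y" "{x..y} \<subseteq> S"
    and "\<And>t. t \<in> {x..y} \<Longrightarrow> (f has_real_derivative f' t) (at t within S)"
    and "\<And>t. t \<in> {x..y} \<Longrightarrow> f' t \<le> m"
  shows "f y \<le> f x + m * (y - x)"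
proof -
  have "(\<lambda>t. - f t) y \<ge> (\<lambda>t. - f t) x + (- m) * (y - x)"
    by (rule increment_ge[OF assms(1,2), where f' = "\<lambda>t. - f' t"])
       (auto intro!: derivative_intros assms(3) simp: assms(4))
  then show ?thesis by simp
qed

text \<open>Trades the integrating factor for a constant: passing between slopes and weighted slopes
  costs at most a factor \<open>E = exp (\<bar>c\<bar> * D)\<close>, whatever the sign of
  \<open>c\<close>.\<close>

lemma exp_scaled_bounds:
  fixes c x D :: real
  assumes "\<bar>x\<bar> \<le> D"
  shows "exp (c * x) \<le> exp (\<bar>c\<bar> * D)" "1 / exp (\<bar>c\<bar> * D) \<le> exp (c * x)"
    "exp (- (c * x)) \<le> exp (\<bar>c\<bar> * D)" "1 / exp (\<bar>c\<bar> * D) \<le> exp (- (c * x))"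
proof -
  have "\<bar>c * x\<bar> \<le> \<bar>c\<bar> * D" using assms by (simp add: abs_mult mult_left_mono)
  then have "c * x \<le> \<bar>c\<bar> * D" "- (\<bar>c\<bar> * D) \<le> c * x" by linarith+
  then show "exp (c * x) \<le> exp (\<bar>c\<bar> * D)" "1 / exp (\<bar>c\<bar> * D) \<le> exp (c * x)"
    "exp (- (c * x)) \<le> exp (\<bar>c\<bar> * D)" "1 / exp (\<bar>c\<bar> * D) \<le> exp (- (c * x))"
    by (simp_all add: exp_minus[symmetric] divide_inverse)
qed

text \<open>Derivatives within the closed interval are one-sided at its ends, which makes the notion
  stable under restriction, translation and reflection. Carrying the slope as a second function
  turns the equation into a first-order system.\<close>

definition sol ::
  "real \<Rightarrow> (real \<Rightarrow> real) \<Rightarrow> (real \<Rightarrow> real) \<Rightarrow> real \<Rightarrow> real \<Rightarrow> (real \<Rightarrow> real) \<Rightarrow> (real \<Rightarrow> real) \<Rightarrow> bool" where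
  "sol c q h x y u v \<longleftrightarrow> (\<forall>t\<in>{x..y}.
     (u has_real_derivative v t) (at t within {x..y}) \<and>
     (v has_real_derivative - c * v t - q t * h (u t)) (at t within {x..y}))"

lemma sol_subset:
  assumes "sol c q h x y u v" "{x'..y'} \<subseteq> {x..y}"
  shows "sol c q h x' y' u v"
  unfolding sol_def
proof
  fix t assume "t \<in> {x'..y'}"
  then have "t \<in> {x..y}" using assms(2) by blast
  then show "(u has_real_derivative v t) (at t within {x'..y'}) \<and>
     (v has_real_derivative - c * v t - q t * h (u t)) (at t within {x'..y'})"
    using assms unfolding sol_def by (meson DERIV_subset)
qed

lemma sol_cong:
  assumes "sol c q h x y u v" "\<And>t. t \<in> {x..y} \<Longrightarrow> q t = q' t"
  shows "sol c q' h x y u v"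
  using assms unfolding sol_def by simp

lemma sol_shift:
  assumes "sol c q h (x + d) (y + d) u v" "\<And>t. t \<in> {x..y} \<Longrightarrow> q (t + d) = q' t"
  shows "sol c q' h x y (\<lambda>t. u (t + d)) (\<lambda>t. v (t + d))"
proof -
  have im: "(\<lambda>t. t + d) ` {x..y} = {x + d..y + d}" by simp
  have *: "((\<lambda>t. f (t + d)) has_real_derivative D) (at t within {x..y})"
    if "(f has_real_derivative D) (at (t + d) within {x + d..y + d})" for f D t
  proof -
    have "(f \<circ> (\<lambda>t. t + d) has_real_derivative D * 1) (at t within {x..y})"
      by (rule DERIV_image_chain) (use that in \<open>auto simp: im intro!: derivative_eq_intros\<close>)
    then show ?thesis by (simp add: o_def)
  qed
  show ?thesis
    unfolding sol_def
  proof
    fix t assume t: "t \<in> {x..y}"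
    then have "t + d \<in> {x + d..y + d}" by simp
    with assms(1) show "((\<lambda>t. u (t + d)) has_real_derivative v (t + d)) (at t within {x..y}) \<and>
      ((\<lambda>t. v (t + d)) has_real_derivative - c * v (t + d) - q' t * h (u (t + d))) (at t within {x..y})"
      unfolding sol_def assms(2)[OF t, symmetric] by (blast intro: *)
  qed
qed

text \<open>Time reversal only flips the sign of the friction. Estimates at the right end of an
  interval are thus obtained from those at the left end.\<close>

lemma sol_reflect:
  assumes "sol c q h x y u v"
  shows "sol (- c) (\<lambda>t. q (- t)) h (- y) (- x) (\<lambda>t. u (- t)) (\<lambda>t. - v (- t))"
proof -
  have im: "uminus ` {- y..- x} = {x..y}" by simp
  have *: "((\<lambda>t. f (- t)) has_real_derivative - D) (at t within {- y..- x})"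
    if "(f has_real_derivative D) (at (- t) within {x..y})" for f D t
  proof -
    have "(f \<circ> uminus has_real_derivative D * (- 1)) (at t within {- y..- x})"
      by (rule DERIV_image_chain) (use that in \<open>auto simp: im intro!: derivative_eq_intros\<close>)
    then show ?thesis by (simp add: o_def)
  qed
  show ?thesis
    unfolding sol_def
  proof
    fix t assume "t \<in> {- y..- x}"
    then have "- t \<in> {x..y}" by auto
    with assms have 1: "(u has_real_derivative v (- t)) (at (- t) within {x..y})"
      and 2: "(v has_real_derivative - c * v (- t) - q (- t) * h (u (- t))) (at (- t) within {x..y})"
      unfolding sol_def by blast+
    have "((\<lambda>t. - v (- t)) has_real_derivative - (- (- c * v (- t) - q (- t) * h (u (- t))))) (at t within {- y..- x})"
      by (rule DERIV_minus) (rule *[OF 2])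
    then show "((\<lambda>t. u (- t)) has_real_derivative - v (- t)) (at t within {- y..- x}) \<and>
      ((\<lambda>t. - v (- t)) has_real_derivative - (- c) * (- v (- t)) - q (- t) * h (u (- t)))
        (at t within {- y..- x})"
      using *[OF 1] by (simp add: algebra_simps)
  qed
qed

lemma sol_continuous:
  assumes "sol c q h x y u v"
  shows "continuous_on {x..y} u" "continuous_on {x..y} v"
  using assms unfolding sol_def by (auto intro!: DERIV_continuous_on)

text \<open>The integrating factor turns the friction term into a monotone quantity.\<close>

lemma sol_weighted:
  assumes "sol c q h x y u v" "t \<in> {x..y}"
  shows "((\<lambda>t. exp (c * (t - \<tau>)) * v t) has_real_derivative
          - (exp (c * (t - \<tau>)) * (q t * h (u t)))) (at t within {x..y})"
proof -
  have *: "(v has_real_derivative - c * v t - q t * h (u t)) (at t within {x..y})"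
    using assms unfolding sol_def by blast
  show ?thesis
    by (rule derivative_eq_intros refl * | simp add: algebra_simps)+
qed

lemma sol_increment_ge:
  assumes "sol c q h x y u v" "x \<le> s" "s \<le> t" "t \<le> y" "\<And>z. z \<in> {s..t} \<Longrightarrow> v z \<ge> m"
  shows "u t \<ge> u s + m * (t - s)"
  by (rule increment_ge[where S = "{x..y}" and f' = v])
     (use assms in \<open>auto simp: sol_def\<close>)

lemma sol_increment_le:
  assumes "sol c q h x y u v" "x \<le> s" "s \<le> t" "t \<le> y" "\<And>z. z \<in> {s..t} \<Longrightarrow> v z \<le> m"
  shows "u t \<le> u s + m * (t - s)"
  by (rule increment_le[where S = "{x..y}" and f' = v])
     (use assms in \<open>auto simp: sol_def\<close>)

lemma sol_weighted_ge:
  assumes "sol c q h x y u v" "x \<le> s" "s \<le> t" "t \<le> y"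
    "\<And>z. z \<in> {s..t} \<Longrightarrow> exp (c * (z - \<tau>)) * (q z * h (u z)) \<le> - m"
  shows "exp (c * (t - \<tau>)) * v t \<ge> exp (c * (s - \<tau>)) * v s + m * (t - s)"
  by (rule increment_ge[where S = "{x..y}", OF _ _ sol_weighted[OF assms(1)]])
     (use assms in force)+

lemma sol_weighted_le:
  assumes "sol c q h x y u v" "x \<le> s" "s \<le> t" "t \<le> y"
    "\<And>z. z \<in> {s..t} \<Longrightarrow> exp (c * (z - \<tau>)) * (q z * h (u z)) \<ge> - m"
  shows "exp (c * (t - \<tau>)) * v t \<le> exp (c * (s - \<tau>)) * v s + m * (t - s)"
  by (rule increment_le[where S = "{x..y}", OF _ _ sol_weighted[OF assms(1)]])
     (use assms in force)+

text \<open>If the solution does not die before the end of an interval of positive weight, it is bent down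
  there by an amount proportional to \<open>\<Lambda> u\<close>, whereas concavity bounds its slope by a multiple of \<open>u\<close>.\<close>

lemma superlinear_bound_decreasing:
  fixes c p q :: real
  assumes pq: "p < q" and b: "continuous_on {p..q} b" "\<And>t. t \<in> {p<..<q} \<Longrightarrow> b t > 0"
  shows "\<exists>\<Lambda>>0. \<exists>\<kappa>>0. \<forall>h u v \<rho> s. sol c b h p q u v \<and> (\<forall>x. h x \<ge> 0) \<and> (\<forall>x\<ge>\<rho>. h x \<ge> \<Lambda> * x) \<and>
    (\<forall>t\<in>{p..q}. u t \<ge> 0) \<and> p \<le> s \<and> s \<le> (p + q) / 2 \<and> v s \<le> 0 \<and> 0 < \<rho> \<longrightarrow> \<kappa> * u s < \<rho>"
proof -
  define E where "E = exp (\<bar>c\<bar> * (q - p))"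
  \<comment> \<open>A quarter of the length: the bending is measured on
    \<open>[mid, mid + \<delta>]\<close>, inside the open interval where \<open>b\<close> has a
    positive minimum, and a time \<delta> remains afterwards in which the solution must still
    survive.\<close>
  define \<delta> where "\<delta> = (q - p) / 4"
  define mid where "mid = (p + q) / 2"
  have E: "E \<ge> 1" unfolding E_def using pq by simp
  have \<delta>: "\<delta> > 0" using pq by (simp add: \<delta>_def)
  have md: "p < mid" "mid + \<delta> < q" "q - (mid + \<delta>) = \<delta>"
    using pq by (auto simp: mid_def \<delta>_def field_simps)
  obtain z where z: "z \<in> {mid..mid + \<delta>}" "\<forall>t\<in>{mid..mid + \<delta>}. b z \<le> b t"
    using continuous_attains_inf[of "{mid..mid + \<delta>}" b] continuous_on_subset[OF b(1)] md \<delta> by auto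
  define m where "m = b z"
  have m: "m > 0" "\<And>t. t \<in> {mid..mid + \<delta>} \<Longrightarrow> b t \<ge> m"
    unfolding m_def using z b(2)[of z] md by auto
  \<comment> \<open>Lower bound for \<open>u t / u s\<close> up to time
    \<open>mid + \<delta>\<close>, as derived in \<open>key\<close>; the 4 is
    \<open>(q - p) / \<delta>\<close>.\<close>
  define \<kappa> where "\<kappa> = 1 / (1 + 4 * E\<^sup>2)"
  have "1 + 4 * E\<^sup>2 > 0" by (simp add: add_pos_nonneg)
  then have \<kappa>: "\<kappa> > 0" by (simp add: \<kappa>_def)
  \<comment> \<open>The quotient is the largest value compatible with the final comparison of
    slopes; adding 1 contradicts it.\<close>
  define \<Lambda> where "\<Lambda> = E\<^sup>2 / (\<delta>\<^sup>2 * m * \<kappa>) + 1"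
  have \<Lambda>: "\<Lambda> > 0" using m \<kappa> \<delta> by (auto simp: \<Lambda>_def intro!: add_nonneg_pos)
  have bnn: "b t \<ge> 0" if "t \<in> {p..q}" for t
    using continuous_ge_on_closure[of "{p<..<q}" b t 0] b that pq
    by (auto simp: closure_greaterThanLessThan less_imp_le)
  show ?thesis
  proof (intro exI conjI allI impI, rule \<Lambda>, rule \<kappa>, elim conjE)
    fix h u v :: "real \<Rightarrow> real" and \<rho> s
    assume so: "sol c b h p q u v" and h0: "\<forall>x. h x \<ge> 0" and h\<Lambda>: "\<forall>x\<ge>\<rho>. h x \<ge> \<Lambda> * x"
      and un: "\<forall>t\<in>{p..q}. u t \<ge> 0" and s: "p \<le> s" "s \<le> (p + q) / 2" and vs: "v s \<le> 0" and \<rho>: "0 < \<rho>"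
    show "\<kappa> * u s < \<rho>"
    proof (rule ccontr)
      assume "\<not> \<kappa> * u s < \<rho>"
      then have big: "\<rho> \<le> \<kappa> * u s" by simp
      define M where "M = u s"
      have M: "M > 0" using big \<rho> \<kappa> unfolding M_def by (smt (verit) mult_nonneg_nonpos)
      have smid: "s \<le> mid" using s by (simp add: mid_def)
      define w where "w = (\<lambda>t. exp (c * (t - p)) * v t)"
      have ex: "exp (c * (t - p)) \<le> E" "1 / E \<le> exp (c * (t - p))" if "t \<in> {p..q}" for t
        unfolding E_def by (rule exp_scaled_bounds; use that in auto)+
      have wdec: "w y \<le> w x" if "p \<le> x" "x \<le> y" "y \<le> q" for x y
        using sol_weighted_le[OF so that, where m = 0 and \<tau> = p] that bnn h0 by (auto simp: w_def)
      have w0: "w t \<le> 0" if "t \<in> {s..q}" for t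
        using wdec[of s t] that s vs by (auto simp: w_def mult_nonneg_nonpos intro: order_trans)
      have vw: "v t = w t * exp (- (c * (t - p)))" for t
        by (simp add: w_def exp_minus)
      have vle: "v t \<le> w t / E" if "t \<in> {s..q}" for t
      proof -
        have "exp (- (c * (t - p))) \<ge> 1 / E"
          using exp_scaled_bounds(4)[of "t - p" "q - p" c] that s by (simp add: E_def)
        then have "w t * exp (- (c * (t - p))) \<le> w t * (1 / E)"
          using w0[OF that] by (rule mult_left_mono_neg)
        then show ?thesis by (simp add: vw)
      qed
      have vge: "v t \<ge> w t * E" if "t \<in> {s..q}" for t
      proof -
        have "exp (- (c * (t - p))) \<le> E"
          using exp_scaled_bounds(3)[of "t - p" "q - p" c] that s by (simp add: E_def)
        then show ?thesis unfolding vw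
          using w0[OF that] by (rule mult_left_mono_neg)
      qed
      have uM: "u t \<le> M" if "t \<in> {s..q}" for t
      proof -
        have "u t \<le> u s + 0 * (t - s)"
        proof (rule sol_increment_le[OF so])
          fix z assume z: "z \<in> {s..t}"
          have "w z / E \<le> 0" using w0[of z] z that E by (simp add: divide_nonpos_pos)
          then show "v z \<le> 0" using vle[of z] z that by simp
        qed (use that s in auto)
        then show ?thesis by (simp add: M_def)
      qed
      \<comment> \<open>Weighted slopes decrease, so a slope at \<open>t\<close> that is too steep
        would carry \<open>u\<close> below 0 within the remaining time \<delta>. The resulting slope
        bound also holds backwards on \<open>[s, t]\<close>, where slopes are less steep up to the
        factor \<open>E\<close>, and compares \<open>u t\<close> with \<open>u s\<close>.\<close>
      have key: "- w t \<le> E * u t / \<delta> \<and> \<kappa> * M \<le> u t" if t: "t \<in> {s..mid + \<delta>}" for t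
      proof -
        have tq: "s \<le> t" "t \<le> q" "\<delta> \<le> q - t" "t - s \<le> 4 * \<delta>" 
        proof -
          have "4 * \<delta> = q - p" by (simp add: \<delta>_def)
          then show "s \<le> t" "t \<le> q" "\<delta> \<le> q - t" "t - s \<le> 4 * \<delta>"
            using t md s by auto
        qed
        have "u q \<le> u t + (w t / E) * (q - t)"
        proof (rule sol_increment_le[OF so])
          fix z assume z: "z \<in> {t..q}"
          have "v z \<le> w z / E" using vle z tq by auto
          also have "\<dots> \<le> w t / E" using wdec[of t z] z tq s E by (auto intro!: divide_right_mono)
          finally show "v z \<le> w t / E" .
        qed (use tq s in auto)
        moreover have "u q \<ge> 0" using un pq by simp
        moreover have "(w t / E) * (q - t) \<le> (w t / E) * \<delta>"
          using w0[of t] tq E by (intro mult_left_mono_neg) (auto simp: divide_nonpos_pos)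
        ultimately have "- w t / E * \<delta> \<le> u t" by simp
        then have 1: "- w t \<le> E * u t / \<delta>" using E \<delta> by (simp add: field_simps)
        have "u t \<ge> u s + (w t * E) * (t - s)"
        proof (rule sol_increment_ge[OF so])
          fix z assume z: "z \<in> {s..t}"
          have "w t * E \<le> w z * E" using wdec[of z t] z tq s E by (auto intro!: mult_right_mono)
          also have "\<dots> \<le> v z" using vge z tq by auto
          finally show "w t * E \<le> v z" .
        qed (use tq s in auto)
        moreover have "(w t * E) * (t - s) \<ge> (w t * E) * (4 * \<delta>)"
          using w0[of t] tq E by (intro mult_left_mono_neg) (auto simp: mult_nonpos_nonneg)
        moreover have "(w t * E) * (4 * \<delta>) \<ge> - (4 * E\<^sup>2 * u t)"
        proof -
          have "(- w t) * (4 * E * \<delta>) \<le> (E * u t / \<delta>) * (4 * E * \<delta>)"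
            using 1 E \<delta> by (intro mult_right_mono) auto
          also have "\<dots> = 4 * E\<^sup>2 * u t" using \<delta> by (simp add: power2_eq_square)
          finally have "(- w t) * (4 * E * \<delta>) \<le> 4 * E\<^sup>2 * u t" .
          moreover have "(w t * E) * (4 * \<delta>) = - ((- w t) * (4 * E * \<delta>))" by simp
          ultimately show ?thesis by linarith
        qed
        ultimately have "M \<le> u t + 4 * E\<^sup>2 * u t" unfolding M_def by linarith
        then have "M \<le> (1 + 4 * E\<^sup>2) * u t" by (simp add: distrib_right)
        then have "\<kappa> * M \<le> u t"
          using \<open>1 + 4 * E\<^sup>2 > 0\<close> by (simp add: \<kappa>_def divide_le_eq mult.commute)
        with 1 show ?thesis by blast
      qed
      \<comment> \<open>Above height \<rho> the superlinearity forces a drop of the weighted slope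
        proportional to \<open>\<Lambda> * M\<close>, which \<open>key\<close> at
        \<open>mid + \<delta>\<close> cannot accommodate.\<close>
      have "w (mid + \<delta>) \<le> w mid + - (m * \<Lambda> * \<kappa> * M / E) * (mid + \<delta> - mid)"
        unfolding w_def
      proof (rule sol_weighted_le[OF so])
        fix z assume z: "z \<in> {mid..mid + \<delta>}"
        have uz: "\<kappa> * M \<le> u z" using key z smid by auto
        then have "u z \<ge> \<rho>" using big by (simp add: M_def)
        then have "h (u z) \<ge> \<Lambda> * u z" using h\<Lambda> by blast
        moreover have "\<Lambda> * u z \<ge> \<Lambda> * (\<kappa> * M)" using uz \<Lambda> by simp
        ultimately have hz: "h (u z) \<ge> \<Lambda> * (\<kappa> * M)" by linarith
        have "b z * h (u z) \<ge> m * (\<Lambda> * (\<kappa> * M))"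
          using m(2)[OF z] hz m \<Lambda> \<kappa> M by (intro mult_mono[of m]) auto
        then have "exp (c * (z - p)) * (b z * h (u z)) \<ge> (1 / E) * (m * (\<Lambda> * (\<kappa> * M)))"
          using ex(2)[of z] z md E m \<Lambda> \<kappa> M by (intro mult_mono[of "1 / E"]) auto
        then show "- (- (m * \<Lambda> * \<kappa> * M / E)) \<le> exp (c * (z - p)) * (b z * h (u z))"
          by (simp add: mult.assoc)
      qed (use md \<delta> in auto)
      moreover have "w mid \<le> 0" using w0[of mid] smid md \<delta> by auto
      ultimately have "m * \<Lambda> * \<kappa> * M / E * \<delta> \<le> - w (mid + \<delta>)" by simp
      also have "\<dots> \<le> E * u (mid + \<delta>) / \<delta>" using key[of "mid + \<delta>"] smid \<delta> by auto
      also have "\<dots> \<le> E * M / \<delta>" using uM[of "mid + \<delta>"] smid \<delta> md E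
        by (auto intro!: divide_right_mono mult_left_mono)
      finally have "\<Lambda> * (\<delta>\<^sup>2 * m * \<kappa>) * M \<le> E\<^sup>2 * M"
        using E \<delta> by (simp add: field_simps power2_eq_square)
      then have "\<Lambda> * (\<delta>\<^sup>2 * m * \<kappa>) \<le> E\<^sup>2" using M by simp
      then have "\<Lambda> \<le> E\<^sup>2 / (\<delta>\<^sup>2 * m * \<kappa>)" using \<delta> m \<kappa> by (simp add: le_divide_eq)
      then show False by (simp add: \<Lambda>_def)
    qed
  qed
qed

lemma max_slope_nonpos:
  fixes f :: "real \<Rightarrow> real"
  assumes "(f has_real_derivative D) (at s within {x..y})" "x \<le> s" "s < y"
    "\<And>t. t \<in> {s..y} \<Longrightarrow> f t \<le> f s"
  shows "D \<le> 0"
proof (rule ccontr)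
  assume "\<not> D \<le> 0"
  then obtain d where d: "d > 0" "\<And>k. k > 0 \<Longrightarrow> s + k \<in> {x..y} \<Longrightarrow> k < d \<Longrightarrow> f s < f (s + k)"
    using has_real_derivative_pos_inc_right[OF assms(1)] by auto
  define k where "k = min (d / 2) (y - s)"
  have "k > 0" "k < d" "s + k \<le> y" using d assms by (auto simp: k_def min_def)
  then have "f s < f (s + k)" using d(2) assms by auto
  then show False using assms(4)[of "s + k"] \<open>k > 0\<close> \<open>s + k \<le> y\<close> by auto
qed

lemma sol_max_slope_nonpos:
  assumes "sol c q h x y u v" "x \<le> s" "s < y" "\<And>t. t \<in> {s..y} \<Longrightarrow> u t \<le> u s"
  shows "v s \<le> 0"
  by (rule max_slope_nonpos[of u _ s x y]) (use assms in \<open>auto simp: sol_def\<close>)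

lemma sol_min_slope_nonneg:
  assumes "sol c q h x y u v" "x \<le> s" "s < y" "\<And>t. t \<in> {s..y} \<Longrightarrow> u s \<le> u t"
  shows "v s \<ge> 0"
proof -
  have "- v s \<le> 0"
    by (rule max_slope_nonpos[of "\<lambda>t. - u t" _ s x y])
       (use assms in \<open>auto simp: sol_def intro!: derivative_intros\<close>)
  then show ?thesis by simp
qed

lemma sol_min_slope_nonpos:
  assumes "sol c q h x y u v" "x < s" "s \<le> y" "\<And>t. t \<in> {x..s} \<Longrightarrow> u s \<le> u t"
  shows "v s \<le> 0"
  using sol_min_slope_nonneg[OF sol_reflect[OF assms(1)], of "- s"] assms by auto

lemma sol_max_slope_nonneg:
  assumes "sol c q h x y u v" "x < s" "s \<le> y" "\<And>t. t \<in> {x..s} \<Longrightarrow> u t \<le> u s"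
  shows "v s \<ge> 0"
  using sol_max_slope_nonpos[OF sol_reflect[OF assms(1)], of "- s"] assms by auto

text \<open>At a maximum of \<open>u\<close> in the left half the slope is at most 0, so the
  decreasing case applies; a maximum in the right half is carried there by time reversal. The
  constants combine the two directions.\<close>

lemma superlinear_bound:
  fixes c p q :: real
  assumes pq: "p < q" and b: "continuous_on {p..q} b" "\<And>t. t \<in> {p<..<q} \<Longrightarrow> b t > 0"
  shows "\<exists>\<Lambda>>0. \<exists>\<kappa>>0. \<forall>h u v \<rho>. sol c b h p q u v \<and> (\<forall>x. h x \<ge> 0) \<and> (\<forall>x\<ge>\<rho>. h x \<ge> \<Lambda> * x) \<and>
    (\<forall>t\<in>{p..q}. u t \<ge> 0) \<and> 0 < \<rho> \<longrightarrow> (\<forall>t\<in>{p..q}. \<kappa> * u t < \<rho>)"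
proof -
  obtain \<Lambda>1 \<kappa>1 where 1: "\<Lambda>1 > 0" "\<kappa>1 > 0"
    and half1: "\<And>h u v \<rho> s. sol c b h p q u v \<and> (\<forall>x. h x \<ge> 0) \<and> (\<forall>x\<ge>\<rho>. h x \<ge> \<Lambda>1 * x) \<and>
      (\<forall>t\<in>{p..q}. u t \<ge> 0) \<and> p \<le> s \<and> s \<le> (p + q) / 2 \<and> v s \<le> 0 \<and> 0 < \<rho> \<Longrightarrow> \<kappa>1 * u s < \<rho>"
    using superlinear_bound_decreasing[OF pq b, of c] by blast
  have "continuous_on {- q..- p} (\<lambda>t. b (- t))"
    by (rule continuous_on_compose2[OF b(1)]) (auto intro!: continuous_intros)
  then obtain \<Lambda>2 \<kappa>2 where 2: "\<Lambda>2 > 0" "\<kappa>2 > 0"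
    and half2: "\<And>h u v \<rho> s. sol (- c) (\<lambda>t. b (- t)) h (- q) (- p) u v \<and> (\<forall>x. h x \<ge> 0) \<and>
      (\<forall>x\<ge>\<rho>. h x \<ge> \<Lambda>2 * x) \<and> (\<forall>t\<in>{- q..- p}. u t \<ge> 0) \<and> - q \<le> s \<and> s \<le> (- q + - p) / 2 \<and>
      v s \<le> 0 \<and> 0 < \<rho> \<Longrightarrow> \<kappa>2 * u s < \<rho>"
    using superlinear_bound_decreasing[of "- q" "- p" "\<lambda>t. b (- t)" "- c"] pq b(2) by auto
  show ?thesis
  proof (intro exI conjI allI impI)
    show "max \<Lambda>1 \<Lambda>2 > 0" "min \<kappa>1 \<kappa>2 > 0" using 1 2 by auto
    fix h u v :: "real \<Rightarrow> real" and \<rho>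
    assume A: "sol c b h p q u v \<and> (\<forall>x. h x \<ge> 0) \<and> (\<forall>x\<ge>\<rho>. h x \<ge> max \<Lambda>1 \<Lambda>2 * x) \<and>
      (\<forall>t\<in>{p..q}. u t \<ge> 0) \<and> 0 < \<rho>"
    then have so: "sol c b h p q u v" and un: "\<forall>t\<in>{p..q}. u t \<ge> 0" by auto
    have h1: "\<forall>x\<ge>\<rho>. h x \<ge> \<Lambda>1 * x" and h2: "\<forall>x\<ge>\<rho>. h x \<ge> \<Lambda>2 * x"
      using A mult_right_mono[of \<Lambda>1 "max \<Lambda>1 \<Lambda>2"] mult_right_mono[of \<Lambda>2 "max \<Lambda>1 \<Lambda>2"]
      by (meson max.cobounded1 max.cobounded2 order_trans less_imp_le)+
    obtain s where s: "s \<in> {p..q}" "\<forall>t\<in>{p..q}. u t \<le> u s"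
      using continuous_attains_sup[OF _ _ sol_continuous(1)[OF so]] pq by auto
    have main: "min \<kappa>1 \<kappa>2 * u s < \<rho>"
    proof (cases "s \<le> (p + q) / 2")
      case True
      then have "s < q" using pq by auto
      then have "v s \<le> 0" using sol_max_slope_nonpos[OF so] s by auto
      then have "\<kappa>1 * u s < \<rho>" using half1[of h u v \<rho> s] A h1 s True by auto
      moreover have "min \<kappa>1 \<kappa>2 * u s \<le> \<kappa>1 * u s" using un s by (intro mult_right_mono) auto
      ultimately show ?thesis by linarith
    next
      case False
      then have "p < s" using pq by auto
      then have "v s \<ge> 0" using sol_max_slope_nonneg[OF so] s by auto
      then have "\<kappa>2 * u (- (- s)) < \<rho>"
        using half2[of h "\<lambda>t. u (- t)" "\<lambda>t. - v (- t)" \<rho> "- s"] sol_reflect[OF so] A h2 s False by auto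
      moreover have "min \<kappa>1 \<kappa>2 * u s \<le> \<kappa>2 * u s" using un s by (intro mult_right_mono) auto
      ultimately show ?thesis by simp
    qed
    show "\<forall>t\<in>{p..q}. min \<kappa>1 \<kappa>2 * u t < \<rho>"
    proof
      fix t assume "t \<in> {p..q}"
      then have "min \<kappa>1 \<kappa>2 * u t \<le> min \<kappa>1 \<kappa>2 * u s" using s 1 2 by (intro mult_left_mono) auto
      with main show "min \<kappa>1 \<kappa>2 * u t < \<rho>" by linarith
    qed
  qed
qed

text \<open>A slope of at least \<open>- C\<close> at \<open>p\<close> would keep \<open>u\<close>
  above \<open>r / 4\<close> for a time \<delta> independent of \<mu>. Meanwhile the weighted slope
  gains an amount proportional to \<mu>, and the solution then climbs past \<open>r\<close> before
  \<open>q\<close>.\<close>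

lemma convex_push:
  fixes c p q r C \<gamma> :: real
  assumes pq: "p < q" and b: "continuous_on {p..q} b" "\<And>t. t \<in> {p<..<q} \<Longrightarrow> b t > 0"
    and r: "r > 0" and C: "C > 0" and \<gamma>: "\<gamma> > 0"
  shows "\<exists>\<mu>\<^sub>1>0. \<forall>\<mu>>\<mu>\<^sub>1. \<forall>h u v. sol c (\<lambda>t. - \<mu> * b t) h p q u v \<and> (\<forall>x. h x \<ge> 0) \<and>
    (\<forall>x\<in>{r/4..r}. h x \<ge> \<gamma>) \<and> u p \<ge> r / 2 \<and> (\<forall>t\<in>{p..q}. u t \<le> r) \<longrightarrow> v p < - C"
proof -
  define l where "l = q - p"
  define E where "E = exp (\<bar>c\<bar> * (q - p))"
  \<comment> \<open>Slopes stay above \<open>- (C * E)\<close>, so the first term limits the loss of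
    height to \<open>r / 4\<close>; the second leaves half of the interval for the climb.\<close>
  define \<delta> where "\<delta> = min (r / (4 * C * E)) (l / 2)"
  have E: "E \<ge> 1" unfolding E_def using pq by simp
  have l: "l > 0" using pq by (simp add: l_def)
  have \<delta>: "\<delta> > 0" "\<delta> \<le> l / 2" "C * E * \<delta> \<le> r / 4"
  proof -
    show "\<delta> > 0" "\<delta> \<le> l / 2" using r C E l by (auto simp: \<delta>_def)
    have "C * E * \<delta> \<le> C * E * (r / (4 * C * E))"
      using C E by (intro mult_left_mono) (auto simp: \<delta>_def)
    also have "\<dots> = r / 4" using C E by simp
    finally show "C * E * \<delta> \<le> r / 4" .
  qed
  \<comment> \<open>The gain is measured on the second half of \<open>[p, p + \<delta>]\<close>
    because \<open>b\<close> may vanish at \<open>p\<close>.\<close>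
  have sub: "{p + \<delta> / 2..p + \<delta>} \<subseteq> {p<..<q}" using \<delta> l by (auto simp: l_def)
  obtain z where z: "z \<in> {p + \<delta> / 2..p + \<delta>}" "\<forall>t\<in>{p + \<delta> / 2..p + \<delta>}. b z \<le> b t"
  proof -
    have "continuous_on {p + \<delta> / 2..p + \<delta>} b"
      by (rule continuous_on_subset[OF b(1)]) (use \<delta> l in \<open>auto simp: l_def\<close>)
    then show thesis
      using continuous_attains_inf[of "{p + \<delta> / 2..p + \<delta>}" b] \<delta> that by auto
  qed
  define m where "m = b z"
  have m: "m > 0" "\<And>t. t \<in> {p + \<delta> / 2..p + \<delta>} \<Longrightarrow> b t \<ge> m"
    unfolding m_def using z b(2)[of z] sub by auto
  have bnn: "b t \<ge> 0" if "t \<in> {p..q}" for t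
    using continuous_ge_on_closure[of "{p<..<q}" b t 0] b that pq
    by (auto simp: closure_greaterThanLessThan less_imp_le)
  define N where "N = m * \<gamma> * \<delta> / (2 * E)"
  have N: "N > 0" using m \<gamma> \<delta> E by (simp add: N_def)
  \<comment> \<open>\<open>\<mu> * N\<close> is the gain of weighted slope. It has to cancel the
    initial \<open>- C\<close> and leave \<open>2 * E * r / l\<close>, that is a true slope of
    \<open>2 * r / l\<close>, enough to climb by \<open>r\<close> in time
    \<open>l / 2\<close>.\<close>
  define \<mu>1 where "\<mu>1 = (C + 2 * E * r / l) / N"
  have \<mu>1: "\<mu>1 > 0" using N C E r l by (auto simp: \<mu>1_def intro!: divide_pos_pos add_pos_pos)
  show ?thesis
  proof (intro exI conjI allI impI, rule \<mu>1, elim conjE)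
    fix \<mu> and h u v :: "real \<Rightarrow> real"
    assume \<mu>: "\<mu>1 < \<mu>" and so: "sol c (\<lambda>t. - \<mu> * b t) h p q u v" and h0: "\<forall>x. h x \<ge> 0"
      and h\<gamma>: "\<forall>x\<in>{r/4..r}. h x \<ge> \<gamma>" and up: "u p \<ge> r / 2" and ur: "\<forall>t\<in>{p..q}. u t \<le> r"
    have \<mu>0: "\<mu> > 0" using \<mu> \<mu>1 by simp
    show "v p < - C"
    proof (rule ccontr)
      assume "\<not> v p < - C"
      then have vp: "v p \<ge> - C" by simp
      define w where "w = (\<lambda>t. exp (c * (t - p)) * v t)"
      have ex: "exp (c * (t - p)) \<le> E" "1 / E \<le> exp (c * (t - p))" if "t \<in> {p..q}" for t
        unfolding E_def by (rule exp_scaled_bounds; use that in auto)+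
      have ex': "exp (- (c * (t - p))) \<le> E" "1 / E \<le> exp (- (c * (t - p)))" if "t \<in> {p..q}" for t
        using exp_scaled_bounds(3,4)[of "t - p" "q - p" c] that unfolding E_def by auto
      have vw: "v t = w t * exp (- (c * (t - p)))" for t
        by (simp add: w_def exp_minus)
      have winc: "w x \<le> w y" if "p \<le> x" "x \<le> y" "y \<le> q" for x y
        using sol_weighted_ge[OF so that, where m = 0 and \<tau> = p] that bnn h0 \<mu>0 by (auto simp: w_def)
      have wC: "w t \<ge> - C" if "t \<in> {p..q}" for t
        using winc[of p t] that vp by (auto simp: w_def)
      have vC: "v t \<ge> - (C * E)" if "t \<in> {p..q}" for t
      proof -
        have "- C * exp (- (c * (t - p))) \<le> w t * exp (- (c * (t - p)))"
          using wC[OF that] by (intro mult_right_mono) auto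
        moreover have "C * exp (- (c * (t - p))) \<le> C * E"
          using ex'(1)[OF that] C by (intro mult_left_mono) auto
        ultimately show ?thesis by (simp add: vw)
      qed
      have u4: "u t \<ge> r / 4" if t: "t \<in> {p..p + \<delta>}" for t
      proof -
        have tq: "t \<le> q" using t \<delta> l by (auto simp: l_def)
        have "u t \<ge> u p + - (C * E) * (t - p)"
          by (rule sol_increment_ge[OF so]) (use t tq vC in auto)
        moreover have "(C * E) * (t - p) \<le> (C * E) * \<delta>"
          using t C E by (intro mult_left_mono) auto
        ultimately show ?thesis using \<delta>(3) up by simp
      qed
      have "w (p + \<delta>) \<ge> w (p + \<delta> / 2) + (\<mu> * m * \<gamma> / E) * (p + \<delta> - (p + \<delta> / 2))"
        unfolding w_def
      proof (rule sol_weighted_ge[OF so])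
        fix t assume t: "t \<in> {p + \<delta> / 2..p + \<delta>}"
        then have tpq: "t \<in> {p..q}" using sub by force
        have "h (u t) \<ge> \<gamma>" using h\<gamma> u4[of t] ur tpq t \<delta> by auto
        then have "b t * h (u t) \<ge> m * \<gamma>" using m(2)[OF t] m(1) \<gamma> by (intro mult_mono) auto
        then have "exp (c * (t - p)) * (b t * h (u t)) \<ge> (1 / E) * (m * \<gamma>)"
          using ex(2)[OF tpq] m \<gamma> E by (intro mult_mono[of "1 / E"]) auto
        then have "\<mu> * (exp (c * (t - p)) * (b t * h (u t))) \<ge> \<mu> * ((1 / E) * (m * \<gamma>))"
          using \<mu>0 by (intro mult_left_mono) auto
        then show "exp (c * (t - p)) * (- \<mu> * b t * h (u t)) \<le> - (\<mu> * m * \<gamma> / E)"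
          by (simp add: algebra_simps)
      qed (use \<delta> l in \<open>auto simp: l_def\<close>)
      moreover have "(\<mu> * m * \<gamma> / E) * (p + \<delta> - (p + \<delta> / 2)) = \<mu> * N"
        using E by (simp add: N_def field_simps)
      moreover have "w (p + \<delta> / 2) \<ge> - C" using wC sub \<delta> l by (auto simp: l_def)
      moreover have "\<mu> * N > C + 2 * E * r / l"
        using \<mu> N by (simp add: \<mu>1_def pos_divide_less_eq)
      ultimately have wbig: "w (p + \<delta>) > 2 * E * r / l" by linarith
      have pos: "2 * E * r / l > 0" using E r l by simp
      have "u q \<ge> u (p + \<delta>) + (2 * r / l) * (q - (p + \<delta>))"
      proof (rule sol_increment_ge[OF so])
        fix t assume t: "t \<in> {p + \<delta>..q}"
        then have tpq: "t \<in> {p..q}" using \<delta> by auto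
        have "w t \<ge> 2 * E * r / l" using winc[of "p + \<delta>" t] t \<delta> wbig by auto
        then have "w t * exp (- (c * (t - p))) \<ge> (2 * E * r / l) * (1 / E)"
          using ex'(2)[OF tpq] pos E by (intro mult_mono) auto
        then show "2 * r / l \<le> v t" using E by (simp add: vw)
      qed (use \<delta> l in \<open>auto simp: l_def\<close>)
      moreover have "(2 * r / l) * (q - (p + \<delta>)) \<ge> (2 * r / l) * (l / 2)"
        using \<delta> l r by (intro mult_left_mono) (auto simp: l_def)
      moreover have "(2 * r / l) * (l / 2) = r" using l by simp
      moreover have "u (p + \<delta>) \<ge> r / 4" using u4[of "p + \<delta>"] \<delta> by simp
      moreover have "u q \<le> r" using ur pq by simp
      ultimately show False using r by linarith
    qed
  qed
qed

text \<open>The mean value theorem supplies one point of slope at most \<open>R / (y - x)\<close> in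
  absolute value; from there the weighted slope changes at a rate of at most
  \<open>E * B\<close>.\<close>

lemma slope_bound:
  assumes so: "sol c q h x y u v" and xy: "x < y"
    and uR: "\<And>t. t \<in> {x..y} \<Longrightarrow> 0 \<le> u t \<and> u t \<le> R"
    and B: "\<And>t. t \<in> {x..y} \<Longrightarrow> \<bar>q t * h (u t)\<bar> \<le> B"
    and t: "t \<in> {x..y}"
  shows "\<bar>v t\<bar> \<le> exp (\<bar>c\<bar> * (y - x)) * (R / (y - x) + B * (y - x))"
proof -
  define E where "E = exp (\<bar>c\<bar> * (y - x))"
  have E: "E \<ge> 1" unfolding E_def using xy by simp
  have B0: "B \<ge> 0" using B[OF t] by linarith
  obtain \<xi> where \<xi>: "x < \<xi>" "\<xi> < y" "u y - u x = v \<xi> * (y - x)"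
    by (rule mvt_within[OF xy subset_refl, of u v]) (use so in \<open>auto simp: sol_def\<close>)
  have "\<bar>v \<xi> * (y - x)\<bar> \<le> R" using uR[of x] uR[of y] xy unfolding \<xi>(3)[symmetric] by auto
  then have v\<xi>: "\<bar>v \<xi>\<bar> \<le> R / (y - x)" using xy by (simp add: abs_mult le_divide_eq)
  define w where "w = (\<lambda>z. exp (c * (z - t)) * v z)"
  have ex: "exp (c * (z - t)) \<le> E" if "z \<in> {x..y}" for z
    unfolding E_def by (rule exp_scaled_bounds(1)) (use that t in auto)
  have q: "exp (c * (z - t)) * (q z * h (u z)) \<le> E * B"
    "exp (c * (z - t)) * (q z * h (u z)) \<ge> - (E * B)" if "z \<in> {x..y}" for z
  proof -
    have "\<bar>exp (c * (z - t)) * (q z * h (u z))\<bar> \<le> E * B"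
      unfolding abs_mult[of "exp _"] using ex[OF that] B[OF that] E by (intro mult_mono) auto
    then show "exp (c * (z - t)) * (q z * h (u z)) \<le> E * B"
      "exp (c * (z - t)) * (q z * h (u z)) \<ge> - (E * B)" by auto
  qed
  have "\<bar>w t - w \<xi>\<bar> \<le> E * B * \<bar>t - \<xi>\<bar>"
  proof (cases "\<xi> \<le> t")
    case True
    have "w t \<ge> w \<xi> + - (E * B) * (t - \<xi>)" unfolding w_def
      by (rule sol_weighted_ge[OF so]) (use t \<xi> True q in auto)
    moreover have "w t \<le> w \<xi> + (E * B) * (t - \<xi>)" unfolding w_def
      by (rule sol_weighted_le[OF so]) (use t \<xi> True q in auto)
    ultimately show ?thesis using True by (simp add: abs_le_iff)
  next
    case False
    have "w \<xi> \<ge> w t + - (E * B) * (\<xi> - t)" unfolding w_def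
      by (rule sol_weighted_ge[OF so]) (use t \<xi> False q in auto)
    moreover have "w \<xi> \<le> w t + (E * B) * (\<xi> - t)" unfolding w_def
      by (rule sol_weighted_le[OF so]) (use t \<xi> False q in auto)
    ultimately show ?thesis using False by (simp add: abs_le_iff)
  qed
  also have "\<dots> \<le> E * B * (y - x)" using t \<xi> E B0 by (intro mult_left_mono) auto
  finally have "\<bar>w t\<bar> \<le> \<bar>w \<xi>\<bar> + E * B * (y - x)" by linarith
  also have "\<bar>w \<xi>\<bar> \<le> E * (R / (y - x))"
    unfolding w_def abs_mult using v\<xi> ex[of \<xi>] \<xi> E by (intro mult_mono) auto
  finally show ?thesis by (simp add: w_def E_def algebra_simps)
qed

text \<open>Starting flat at height \<open>r\<close>, the slope can only reach order
  \<open>\<epsilon> * r\<close>, and \<open>small\<close> is the condition that the resulting loss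
  of height is at most \<open>r / 2\<close>. A solution that merely touches \<open>r\<close> on the
  bump therefore leaves the bump too high to stay below \<open>r\<close> afterwards.\<close>

lemma almost_linear_descent:
  assumes so: "sol c b h x y u v" and xy: "x < y" and t: "t \<in> {x..y}"
    and ut: "u t = r" and vt: "v t = 0" and ur: "\<And>z. z \<in> {t..y} \<Longrightarrow> u z \<le> r"
    and b: "\<And>z. z \<in> {x..y} \<Longrightarrow> 0 \<le> b z \<and> b z \<le> A"
    and h: "\<And>s. s \<le> r \<Longrightarrow> 0 \<le> h s \<and> h s \<le> \<epsilon> * r"
    and small: "(exp (\<bar>c\<bar> * (y - x)))\<^sup>2 * A * \<epsilon> * (y - x)\<^sup>2 \<le> 1 / 2" and r: "r > 0"
  shows "u y \<ge> r / 2"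
proof -
  define E where "E = exp (\<bar>c\<bar> * (y - x))"
  define w where "w = (\<lambda>z. exp (c * (z - t)) * v z)"
  define D where "D = E * (A * (\<epsilon> * r))"
  have E: "E \<ge> 1" unfolding E_def using xy by simp
  have A0: "A \<ge> 0" using b[OF t] by linarith
  have e0: "\<epsilon> * r \<ge> 0" using h[of r] by linarith
  have D0: "D \<ge> 0" using E A0 e0 by (simp add: D_def)
  have ex: "exp (c * (z - t)) \<le> E" if "z \<in> {x..y}" for z
    unfolding E_def by (rule exp_scaled_bounds(1)) (use that t in auto)
  have v: "v z \<ge> - (E * (D * (y - x)))" if z: "z \<in> {t..y}" for z
  proof -
    have "w z \<ge> w t + - D * (z - t)" unfolding w_def
    proof (rule sol_weighted_ge[OF so])
      fix s assume s: "s \<in> {t..z}"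
      then have sxy: "s \<in> {x..y}" using t z by auto
      have "b s * h (u s) \<le> A * (\<epsilon> * r)"
        using b[OF sxy] h[of "u s"] ur[of s] s z A0 by (intro mult_mono) auto
      moreover have "b s * h (u s) \<ge> 0" using b[OF sxy] h[of "u s"] ur[of s] s z by auto
      ultimately have "exp (c * (s - t)) * (b s * h (u s)) \<le> D"
        unfolding D_def using ex[OF sxy] E by (intro mult_mono[of "exp _"]) auto
      then show "exp (c * (s - t)) * (b s * h (u s)) \<le> - (- D)" by simp
    qed (use t z in auto)
    moreover have "D * (z - t) \<le> D * (y - x)" using D0 z t by (intro mult_left_mono) auto
    ultimately have wz: "w z \<ge> - (D * (y - x))" using vt by (simp add: w_def)
    have e: "exp (- (c * (z - t))) \<le> E"
      using exp_scaled_bounds(3)[of "z - t" "y - x" c] z t by (auto simp: E_def)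
    have "v z = w z * exp (- (c * (z - t)))" by (simp add: w_def exp_minus)
    moreover have "w z * exp (- (c * (z - t))) \<ge> - (D * (y - x)) * exp (- (c * (z - t)))"
      using wz by (intro mult_right_mono) auto
    moreover have "(D * (y - x)) * exp (- (c * (z - t))) \<le> (D * (y - x)) * E"
      using e D0 xy by (intro mult_left_mono) auto
    ultimately show ?thesis by (simp add: mult.commute)
  qed
  have "u y \<ge> u t - (E * (D * (y - x))) * (y - t)"
    using sol_increment_ge[OF so, where m = "- (E * (D * (y - x)))" and s = t and t = y] t v by auto
  moreover have "(E * (D * (y - x))) * (y - t) \<le> (E * (D * (y - x))) * (y - x)"
    using E D0 xy t by (intro mult_left_mono) auto
  moreover have "(E * (D * (y - x))) * (y - x) = (E\<^sup>2 * A * \<epsilon> * (y - x)\<^sup>2) * r"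
    by (simp add: D_def power2_eq_square)
  moreover have "(E\<^sup>2 * A * \<epsilon> * (y - x)\<^sup>2) * r \<le> (1 / 2) * r"
    using small r unfolding E_def by (intro mult_right_mono) auto
  ultimately show ?thesis using ut by linarith
qed

text \<open>Gronwall for the energy \<open>D\<close>: \<open>2 * f * f'\<close> contributes at most
  \<open>D\<close> to its derivative and \<open>2 * f' * g'\<close> at most
  \<open>3 * C * D\<close>. It yields both uniqueness at the zero solution and Lipschitz dependence
  on initial data.\<close>

lemma energy_growth:
  assumes f: "\<And>t. t \<in> {x..y} \<Longrightarrow> (f has_real_derivative f' t) (at t within {x..y})"
    and g: "\<And>t. t \<in> {x..y} \<Longrightarrow> (f' has_real_derivative g' t) (at t within {x..y})"
    and C: "\<And>t. t \<in> {x..y} \<Longrightarrow> \<bar>g' t\<bar> \<le> C * (\<bar>f t\<bar> + \<bar>f' t\<bar>)" "C \<ge> 0"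
    and t: "t \<in> {x..y}"
  shows "(f t)\<^sup>2 + (f' t)\<^sup>2 \<le> ((f x)\<^sup>2 + (f' x)\<^sup>2) * exp ((1 + 3 * C) * (t - x))"
proof -
  define B where "B = 1 + 3 * C"
  define D where "D = (\<lambda>t. (f t)\<^sup>2 + (f' t)\<^sup>2)"
  have D: "(D has_real_derivative 2 * f s * f' s + 2 * f' s * g' s) (at s within {x..y})"
    if "s \<in> {x..y}" for s
    unfolding D_def power2_eq_square
    by (rule derivative_eq_intros refl f[OF that] g[OF that] | simp)+
  have le: "2 * f s * f' s + 2 * f' s * g' s \<le> B * D s" if s: "s \<in> {x..y}" for s
  proof -
    have q: "2 * \<bar>f s\<bar> * \<bar>f' s\<bar> \<le> D s"
      using sum_squares_bound[of "\<bar>f s\<bar>" "\<bar>f' s\<bar>"] by (simp add: D_def)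
    have "f s * f' s \<le> \<bar>f s\<bar> * \<bar>f' s\<bar>" by (metis abs_ge_self abs_mult)
    with q have 1: "2 * f s * f' s \<le> D s" by simp
    have "f' s * g' s \<le> \<bar>f' s\<bar> * \<bar>g' s\<bar>" by (metis abs_ge_self abs_mult)
    also have "\<bar>f' s\<bar> * \<bar>g' s\<bar> \<le> \<bar>f' s\<bar> * (C * (\<bar>f s\<bar> + \<bar>f' s\<bar>))" using C(1)[OF s] by (intro mult_left_mono) auto
    finally have "2 * (f' s * g' s) \<le> 2 * (\<bar>f' s\<bar> * (C * (\<bar>f s\<bar> + \<bar>f' s\<bar>)))" by simp
    also have "2 * (\<bar>f' s\<bar> * (C * (\<bar>f s\<bar> + \<bar>f' s\<bar>))) =
        C * (2 * \<bar>f s\<bar> * \<bar>f' s\<bar>) + C * (2 * (f' s)\<^sup>2)"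
      by (simp add: algebra_simps power2_eq_square)
    also have "\<dots> \<le> C * D s + C * (2 * D s)"
      using q C(2) by (intro add_mono mult_left_mono) (auto simp: D_def)
    finally show ?thesis using 1 by (simp add: B_def algebra_simps)
  qed
  have "exp (- B * (t - x)) * D t \<le> exp (- B * (x - x)) * D x + 0 * (t - x)"
  proof (rule increment_le[where S = "{x..y}"])
    fix s assume "s \<in> {x..t}"
    then have s: "s \<in> {x..y}" using t by auto
    show "((\<lambda>t. exp (- B * (t - x)) * D t) has_real_derivative
       exp (- B * (s - x)) * (2 * f s * f' s + 2 * f' s * g' s - B * D s)) (at s within {x..y})"
      by (rule derivative_eq_intros refl D[OF s] | simp add: algebra_simps)+
    show "exp (- B * (s - x)) * (2 * f s * f' s + 2 * f' s * g' s - B * D s) \<le> 0"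
      using le[OF s] by (simp add: mult_nonneg_nonpos)
  qed (use t in auto)
  then have "exp (B * (t - x)) * (exp (- B * (t - x)) * D t) \<le> exp (B * (t - x)) * D x"
    by (intro mult_left_mono) auto
  moreover have "exp (B * (t - x)) * (exp (- B * (t - x)) * D t) = D t"
    by (simp add: exp_minus)
  ultimately have "D t \<le> D x * exp (B * (t - x))" by (simp only: mult.commute)
  then show ?thesis unfolding D_def B_def .
qed

text \<open>A linear bound on \<open>h\<close> along the solution replaces the Lipschitz condition,
  so the zero solution is unique even for a merely continuous \<open>h\<close>. The auxiliary claim
  treats times after the zero and is general in \<open>c\<close> and \<open>q\<close>, so that
  reflection yields the earlier times.\<close>

lemma sol_zero:
  assumes so: "sol c q h x y u v" and Q: "\<And>t. t \<in> {x..y} \<Longrightarrow> \<bar>q t\<bar> \<le> Q"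
    and L: "\<And>t. t \<in> {x..y} \<Longrightarrow> \<bar>h (u t)\<bar> \<le> L * \<bar>u t\<bar>" "L \<ge> 0"
    and z: "z \<in> {x..y}" "u z = 0" "v z = 0" and t: "t \<in> {x..y}"
  shows "u t = 0"
proof -
  have *: "u t = 0"
    if so: "sol c q h x y u v" and Q: "\<And>t. t \<in> {x..y} \<Longrightarrow> \<bar>q t\<bar> \<le> Q"
    and L: "\<And>t. t \<in> {x..y} \<Longrightarrow> \<bar>h (u t)\<bar> \<le> L * \<bar>u t\<bar>"
    and z: "u x = 0" "v x = 0" and t: "t \<in> {x..y}" for c q x y u v t
  proof -
    have Q0: "Q \<ge> 0" using Q[OF t] by linarith
    have "(u t)\<^sup>2 + (v t)\<^sup>2 \<le> ((u x)\<^sup>2 + (v x)\<^sup>2) * exp ((1 + 3 * (\<bar>c\<bar> + Q * L)) * (t - x))"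
    proof (rule energy_growth[OF _ _ _ _ t])
      fix s assume s: "s \<in> {x..y}"
      show "(u has_real_derivative v s) (at s within {x..y})"
        "(v has_real_derivative - c * v s - q s * h (u s)) (at s within {x..y})"
        using so s unfolding sol_def by auto
      have "\<bar>- c * v s - q s * h (u s)\<bar> \<le> \<bar>c\<bar> * \<bar>v s\<bar> + \<bar>q s\<bar> * \<bar>h (u s)\<bar>"
        by (metis abs_minus_cancel abs_mult abs_triangle_ineq4 mult_minus_left)
      also have "\<bar>q s\<bar> * \<bar>h (u s)\<bar> \<le> Q * (L * \<bar>u s\<bar>)"
        using Q[OF s] L[OF s] Q0 by (intro mult_mono) auto
      also have "\<bar>c\<bar> * \<bar>v s\<bar> + Q * (L * \<bar>u s\<bar>) \<le> (\<bar>c\<bar> + Q * L) * (\<bar>u s\<bar> + \<bar>v s\<bar>)"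
        using Q0 assms(4) by (simp add: algebra_simps)
      finally show "\<bar>- c * v s - q s * h (u s)\<bar> \<le> (\<bar>c\<bar> + Q * L) * (\<bar>u s\<bar> + \<bar>v s\<bar>)" by simp
    qed (use Q0 assms(4) in auto)
    then have "(u t)\<^sup>2 + (v t)\<^sup>2 \<le> 0" using z by simp
    then show ?thesis by (simp add: sum_power2_le_zero_iff)
  qed
  show ?thesis
  proof (cases "z \<le> t")
    case True
    show ?thesis
      by (rule *[of c q z y u v]) (use sol_subset[OF so, of z y] Q L z t True in auto)
  next
    case False
    have "(\<lambda>t. u (- t)) (- t) = 0"
      by (rule *[OF sol_reflect[OF sol_subset[OF so, of x z]]]) (use Q L z t False in auto)
    then show ?thesis by simp
  qed
qed

text \<open>Death is final: below 0 the nonlinearity vanishes, so up to a first return to 0 the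
  weighted slope is nonincreasing and stays nonpositive, which rules the return out.\<close>

lemma sol_stays_negative:
  assumes so: "sol c q h x y u v" and h0: "\<And>s. s \<le> 0 \<Longrightarrow> h s = 0"
    and st: "x \<le> s" "s \<le> t" "t \<le> y" and neg: "u s < 0" "v s \<le> 0"
  shows "u t < 0"
proof (rule ccontr)
  assume "\<not> u t < 0"
  define Z where "Z = {z \<in> {s..t}. u z \<ge> 0}"
  have cu: "continuous_on {s..t} u"
    by (rule continuous_on_subset[OF sol_continuous(1)[OF so]]) (use st in auto)
  have "closed Z" unfolding Z_def
    by (intro continuous_on_closed_Collect_le cu continuous_intros)
  moreover have "bounded Z" unfolding Z_def by (rule bounded_subset[of "{s..t}"]) auto
  ultimately have "compact Z" by (simp add: compact_eq_bounded_closed)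
  moreover have "t \<in> Z" using \<open>\<not> u t < 0\<close> st by (simp add: Z_def)
  ultimately obtain z where z: "z \<in> Z" "\<And>z'. z' \<in> Z \<Longrightarrow> z \<le> z'"
    using compact_attains_inf[of Z] by auto
  have "s \<le> z" "z \<le> t" "u z \<ge> 0" "z \<noteq> s" using z(1) neg by (auto simp: Z_def)
  then have zs: "s < z" "z \<le> t" "u z \<ge> 0" by auto
  have un: "u k < 0" if "s \<le> k" "k < z" for k
    using z(2)[of k] that zs by (force simp: Z_def)
  have v0: "v k \<le> 0" if k: "s \<le> k" "k < z" for k
  proof -
    have "exp (c * (k - k)) * v k \<le> exp (c * (s - k)) * v s + 0 * (k - s)"
      by (rule sol_weighted_le[OF so]) (use k st zs un h0 in \<open>auto simp: less_imp_le\<close>)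
    then show ?thesis using neg(2) by (simp add: mult_nonneg_nonpos order_trans)
  qed
  obtain \<xi> where "s < \<xi>" "\<xi> < z" "u z - u s = v \<xi> * (z - s)"
    by (rule mvt_within[OF zs(1), of "{x..y}" u v]) (use so st zs in \<open>auto simp: sol_def\<close>)
  moreover have "v \<xi> * (z - s) \<le> 0" using v0[of \<xi>] calculation by (simp add: mult_nonpos_nonneg)
  ultimately show False using neg zs by simp
qed

text \<open>Reduces survival on a whole interval to survival at a single later time. A negative
  value would be preceded, after the last nonnegative one, by a point of negative height and
  negative slope, beyond which there is no recovery.\<close>

lemma sol_nonneg_before:
  assumes so: "sol c q h x y u v" and h0: "\<And>s. s \<le> 0 \<Longrightarrow> h s = 0"
    and "u x \<ge> 0" "u t \<ge> 0" "x \<le> s" "s \<le> t" "t \<le> y"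
  shows "u s \<ge> 0"
proof (rule ccontr)
  assume us: "\<not> u s \<ge> 0"
  define Z where "Z = {z \<in> {x..s}. u z \<ge> 0}"
  have cu: "continuous_on {x..s} u"
    by (rule continuous_on_subset[OF sol_continuous(1)[OF so]]) (use assms in auto)
  have "closed Z" unfolding Z_def
    by (intro continuous_on_closed_Collect_le cu continuous_intros)
  moreover have "bounded Z" unfolding Z_def by (rule bounded_subset[of "{x..s}"]) auto
  ultimately have "compact Z" by (simp add: compact_eq_bounded_closed)
  moreover have "x \<in> Z" using assms by (simp add: Z_def)
  ultimately obtain z where z: "z \<in> Z" "\<And>z'. z' \<in> Z \<Longrightarrow> z' \<le> z"
    using compact_attains_sup[of Z] by auto
  have "x \<le> z" "z \<le> s" "u z \<ge> 0" "z \<noteq> s" using z(1) us by (auto simp: Z_def)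
  then have zs: "x \<le> z" "z < s" "u z \<ge> 0" by auto
  obtain \<xi> where \<xi>: "z < \<xi>" "\<xi> < s" "u s - u z = v \<xi> * (s - z)"
    by (rule mvt_within[OF zs(2), of "{x..y}" u v]) (use so assms zs in \<open>auto simp: sol_def\<close>)
  have "v \<xi> * (s - z) < 0" using \<xi>(3) us zs by simp
  then have "v \<xi> < 0" using zs by (simp add: mult_less_0_iff)
  moreover have "u \<xi> < 0" using z(2)[of \<xi>] \<xi> zs by (force simp: Z_def)
  ultimately have "u t < 0"
    using sol_stays_negative[OF so h0, of \<xi> t] \<xi> assms zs by auto
  then show False using assms by simp
qed

definition weight :: "(real \<Rightarrow> real) \<Rightarrow> real \<Rightarrow> real \<Rightarrow> real" where
  "weight a \<mu> t = plus_part (a t) - \<mu> * minus_part (a t)"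

section \<open>Stretching along curves of initial data\<close>

text \<open>One period of an itinerary, with \<open>b\<close> true for the symbol 1. All
  inequalities are non-strict so that they survive pointwise limits; \<open>strict_itinerary\<close>
  makes them strict afterwards.\<close>

definition stage :: "real \<Rightarrow> real \<Rightarrow> real \<Rightarrow> real \<Rightarrow> bool \<Rightarrow> (real \<Rightarrow> real) \<Rightarrow> bool" where
  "stage \<alpha> \<beta> T r b u \<longleftrightarrow> (\<forall>t\<in>{\<alpha>..\<alpha> + T}. 0 \<le> u t) \<and> (\<forall>t\<in>{\<beta>..\<alpha> + T}. u t \<le> r) \<and>
      (if b then \<exists>t\<in>{\<alpha>..\<beta>}. u t \<ge> r else \<forall>t\<in>{\<alpha>..\<beta>}. u t \<le> r)"

text \<open>The last five assumptions are the only estimates that the shooting argument needs; they hold with the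
  same constants for the nonlinearity and for its Lipschitz approximations.\<close>

locale shooting =
  fixes c T \<alpha> \<beta> \<mu> r R K :: real and a h :: "real \<Rightarrow> real"
  assumes ab: "\<alpha> < \<beta>" "\<beta> < \<alpha> + T"
    and a_cont: "continuous_on UNIV a" and a_per: "\<And>t. a (t + T) = a t"
    and a_pos: "\<And>t. t \<in> {\<alpha>..\<beta>} \<Longrightarrow> a t \<ge> 0" and a_neg: "\<And>t. t \<in> {\<beta>..\<alpha> + T} \<Longrightarrow> a t \<le> 0"
    and mu: "\<mu> > 0" and r: "r > 0" and K: "K > 0"
    and h_nonneg: "\<And>s. h s \<ge> 0" and h_zero: "\<And>s. s \<le> 0 \<Longrightarrow> h s = 0"
    and fast: "\<And>u v. sol c (weight a \<mu>) h \<alpha> \<beta> u v \<Longrightarrow> (\<And>t. t \<in> {\<alpha>..\<beta>} \<Longrightarrow> u t \<ge> 0) \<Longrightarrow> u \<alpha> = r \<Longrightarrow> v \<alpha> < K"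
    and bounded: "\<And>u v t. sol c (weight a \<mu>) h \<alpha> \<beta> u v \<Longrightarrow> (\<And>t. t \<in> {\<alpha>..\<beta>} \<Longrightarrow> u t \<ge> 0) \<Longrightarrow>
      t \<in> {\<alpha>..\<beta>} \<Longrightarrow> u t \<le> R"
    and exits: "\<And>u v. sol c (weight a \<mu>) h \<alpha> (\<alpha> + T) u v \<Longrightarrow> (\<And>t. t \<in> {\<alpha>..\<beta>} \<Longrightarrow> u t \<ge> 0) \<Longrightarrow>
      (\<And>t. t \<in> {\<beta>..\<alpha> + T} \<Longrightarrow> u t \<le> r) \<Longrightarrow> u \<beta> < r / 2"
    and flat: "\<And>u v t. sol c (weight a \<mu>) h \<alpha> \<beta> u v \<Longrightarrow> t \<in> {\<alpha>..\<beta>} \<Longrightarrow> u t = r \<Longrightarrow> v t = 0 \<Longrightarrow>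
      (\<And>z. z \<in> {t..\<beta>} \<Longrightarrow> u z \<le> r) \<Longrightarrow> u \<beta> \<ge> r / 2"
    and entry: "\<And>u v. sol c (weight a \<mu>) h \<beta> (\<alpha> + T) u v \<Longrightarrow> (\<And>t. t \<in> {\<beta>..\<alpha> + T} \<Longrightarrow> u t \<le> r) \<Longrightarrow>
      u (\<alpha> + T) = r \<Longrightarrow> v (\<alpha> + T) \<ge> K"
begin

abbreviation W where "W \<equiv> weight a \<mu>"

lemma T_pos: "T > 0" using ab by simp

lemma W_nonneg: "t \<in> {\<alpha>..\<beta>} \<Longrightarrow> W t \<ge> 0"
  using a_pos[of t] by (simp add: weight_def plus_part_def minus_part_def)

lemma W_nonpos: "t \<in> {\<beta>..\<alpha> + T} \<Longrightarrow> W t \<le> 0"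
  using a_neg[of t] mu by (auto simp: weight_def plus_part_def minus_part_def mult_nonneg_nonpos)

lemma W_periodic: "W (t + of_int i * T) = W t"
proof -
  have nat: "a (t + of_nat n * T) = a t" for t n
  proof (induction n)
    case (Suc n)
    have "a (t + of_nat (Suc n) * T) = a ((t + of_nat n * T) + T)" by (simp add: algebra_simps)
    then show ?case using Suc a_per by simp
  qed simp
  have "a (t + of_int i * T) = a t"
  proof (cases "i \<ge> 0")
    case True
    then show ?thesis using nat[of t "nat i"] by simp
  next
    case False
    then show ?thesis using nat[of "t + of_int i * T" "nat (- i)"] by simp
  qed
  then show ?thesis by (simp add: weight_def)
qed

lemma W_cont: "continuous_on UNIV W"
  unfolding weight_def plus_part_def minus_part_def
  by (intro continuous_intros a_cont) auto

lemma nonpos_on_bump: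
  assumes so: "sol c W h \<alpha> y u v" and y: "\<beta> \<le> y" and u: "u \<alpha> \<le> 0" "v \<alpha> \<le> 0" and t: "t \<in> {\<alpha>..\<beta>}"
  shows "u t \<le> 0"
proof -
  have "v z \<le> 0" if z: "z \<in> {\<alpha>..t}" for z
  proof -
    have "exp (c * (z - z)) * v z \<le> exp (c * (\<alpha> - z)) * v \<alpha> + 0 * (z - \<alpha>)"
      by (rule sol_weighted_le[OF so]) (use z t y W_nonneg h_nonneg in auto)
    then show ?thesis using u(2) by (simp add: mult_nonneg_nonpos order_trans)
  qed
  then have "u t \<le> u \<alpha> + 0 * (t - \<alpha>)"
    by (intro sol_increment_le[OF so]) (use t y in auto)
  then show ?thesis using u by simp
qed

text \<open>A touch at height \<open>r\<close> would be a maximum with zero slope,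
  \<open>start\<close> excluding the time \<alpha>. Then \<open>flat\<close> keeps \<open>u\<close>
  at or above \<open>r / 2\<close> at time \<beta>, against \<open>exits\<close>.\<close>

lemma below_r_on_bump:
  assumes so: "sol c W h \<alpha> (\<alpha> + T) u v" and u0: "u \<alpha> \<ge> 0"
    and ur: "\<And>t. t \<in> {\<alpha>..\<alpha> + T} \<Longrightarrow> u t \<le> r" and start: "u \<alpha> = r \<Longrightarrow> v \<alpha> > 0"
    and t: "t \<in> {\<alpha>..\<beta>}"
  shows "u t < r"
proof (rule ccontr)
  assume "\<not> u t < r"
  then have utr: "u t = r" using ur[of t] t ab by auto
  have sb: "sol c W h \<alpha> \<beta> u v" by (rule sol_subset[OF so]) (use ab in auto)
  have vle: "v t \<le> 0"
    by (rule sol_max_slope_nonpos[OF so]) (use t ab ur utr in auto)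
  have "t \<noteq> \<alpha>" using vle utr start by auto
  then have "v t \<ge> 0"
    by (intro sol_max_slope_nonneg[OF so]) (use t ab ur utr in auto)
  with vle have "u \<beta> \<ge> r / 2" using flat[OF sb t utr] ur t ab by auto
  moreover have "u s \<ge> 0" if "s \<in> {\<alpha>..\<beta>}" for s
    by (rule sol_nonneg_before[OF so h_zero u0, of \<beta>]) (use that ab calculation r in auto)
  then have "u \<beta> < r / 2" by (intro exits[OF so]) (use ur ab in auto)
  ultimately show False by simp
qed

text \<open>A touch at \<beta> contradicts \<open>exits\<close>. At any later touch the slope is
  nonnegative, and convexity keeps it so; hence \<open>u\<close> does not fall again before the end
  of the period.\<close>

lemma touch_at_end:
  assumes so: "sol c W h \<alpha> (\<alpha> + T) u v" and u0: "u \<alpha> \<ge> 0"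
    and ur: "\<And>t. t \<in> {\<beta>..\<alpha> + T} \<Longrightarrow> u t \<le> r" and t: "t \<in> {\<beta>..\<alpha> + T}" and utr: "u t \<ge> r"
  shows "u (\<alpha> + T) = r"
proof -
  have utr: "u t = r" using utr ur[OF t] by simp
  have sb: "sol c W h \<beta> (\<alpha> + T) u v" by (rule sol_subset[OF so]) (use ab in auto)
  have "t \<noteq> \<beta>"
  proof
    assume tb: "t = \<beta>"
    have "u s \<ge> 0" if "s \<in> {\<alpha>..\<beta>}" for s
      by (rule sol_nonneg_before[OF so h_zero u0, of \<beta>]) (use that ab tb utr r in auto)
    then have "u \<beta> < r / 2" by (intro exits[OF so]) (use ur ab in auto)
    then show False using tb utr r by simp
  qed
  then have vt: "v t \<ge> 0"
    by (intro sol_max_slope_nonneg[OF sb]) (use t ab ur utr in auto)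
  have "v z \<ge> 0" if z: "z \<in> {t..\<alpha> + T}" for z
  proof -
    have "exp (c * (z - t)) * v z \<ge> exp (c * (t - t)) * v t + 0 * (z - t)"
      by (rule sol_weighted_ge[OF sb]) (use z t W_nonpos h_nonneg in \<open>auto simp: mult_nonpos_nonneg mult_nonneg_nonpos\<close>)
    then show ?thesis using vt by (simp add: zero_le_mult_iff) (smt (verit) exp_gt_zero zero_le_mult_iff)
  qed
  then have "u (\<alpha> + T) \<ge> u t + 0 * (\<alpha> + T - t)"
    by (intro sol_increment_ge[OF sb]) (use t in auto)
  then show ?thesis using utr ur[of "\<alpha> + T"] ab by simp
qed

end

section \<open>Extremal parameters, subcurves and the stretching step\<close>

lemma compact_exists_ge:
  fixes U :: "real \<Rightarrow> real \<Rightarrow> real"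
  assumes "continuous_on ({x..y} \<times> {l..m}) (\<lambda>z. U (fst z) (snd z))"
  shows "compact {s \<in> {l..m}. \<exists>t\<in>{x..y}. U t s \<ge> k}"
proof -
  let ?S = "{x..y} \<times> {l..m}"
  have S: "compact ?S" by (intro compact_Times compact_Icc)
  have "closed {z \<in> ?S. k \<le> U (fst z) (snd z)}"
    by (intro continuous_on_closed_Collect_le assms continuous_intros compact_imp_closed S)
  then have "compact (?S \<inter> {z \<in> ?S. k \<le> U (fst z) (snd z)})" by (rule compact_Int_closed[OF S])
  then have "compact (snd ` (?S \<inter> {z \<in> ?S. k \<le> U (fst z) (snd z)}))"
    by (intro compact_continuous_image continuous_intros)
  also have "snd ` (?S \<inter> {z \<in> ?S. k \<le> U (fst z) (snd z)}) = {s \<in> {l..m}. \<exists>t\<in>{x..y}. U t s \<ge> k}"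
    by force
  finally show ?thesis .
qed

text \<open>Walk from \<open>x\<close> to \<open>y\<close>, keep what lies behind the last point
  with \<open>f \<le> 0\<close>, and reparametrise; by the intermediate value theorem
  \<open>f\<close> vanishes at the cut. The order of \<open>x\<close> and \<open>y\<close> is left
  free because the two symbols use opposite directions.\<close>

lemma crossing_path:
  fixes f :: "real \<Rightarrow> real"
  assumes f: "continuous_on {0..1} f" and xy: "x \<in> {0..1}" "y \<in> {0..1}" and fx: "f x \<le> 0" and fy: "f y > 0"
  shows "\<exists>\<phi>::real \<Rightarrow> real. continuous_on {0..1} \<phi> \<and> (\<forall>s\<in>{0..1}. \<phi> s \<in> closed_segment x y \<and> f (\<phi> s) \<ge> 0) \<and>
    f (\<phi> 0) = 0 \<and> \<phi> 1 = y"
proof -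
  define p where "p = (\<lambda>\<tau>. (1 - \<tau>) * x + \<tau> * y)"
  have pseg: "p \<tau> \<in> closed_segment x y" if "\<tau> \<in> {0..1}" for \<tau>
    unfolding closed_segment_def p_def using that by auto
  have seg: "closed_segment x y \<subseteq> {0..1}" using xy by (simp add: closed_segment_subset)
  have pc: "continuous_on S p" for S unfolding p_def by (intro continuous_intros)
  have F: "continuous_on {0..1} (\<lambda>\<tau>. f (p \<tau>))"
    by (rule continuous_on_compose2[OF f pc]) (use pseg seg in blast)
  define Z where "Z = {\<tau> \<in> {0..1}. f (p \<tau>) \<le> 0}"
  have "closed Z" unfolding Z_def by (intro continuous_on_closed_Collect_le F continuous_intros)
  moreover have "bounded Z" unfolding Z_def by (rule bounded_subset[of "{0..1}"]) auto
  ultimately have "compact Z" by (simp add: compact_eq_bounded_closed)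
  moreover have "0 \<in> Z" using fx by (simp add: Z_def p_def)
  ultimately obtain \<tau>0 where \<tau>0: "\<tau>0 \<in> Z" "\<And>\<tau>. \<tau> \<in> Z \<Longrightarrow> \<tau> \<le> \<tau>0"
    using compact_attains_sup[of Z] by auto
  have t01: "0 \<le> \<tau>0" "\<tau>0 \<le> 1" "f (p \<tau>0) \<le> 0" using \<tau>0(1) by (auto simp: Z_def)
  have "\<exists>\<tau>\<ge>\<tau>0. \<tau> \<le> 1 \<and> f (p \<tau>) = 0"
    by (rule IVT') (use t01 fy continuous_on_subset[OF F] in \<open>auto simp: p_def\<close>)
  then obtain \<tau> where "\<tau> \<ge> \<tau>0" "\<tau> \<le> 1" "f (p \<tau>) = 0" by blast
  moreover have "\<tau> \<le> \<tau>0" using \<tau>0(2)[of \<tau>] calculation t01 by (simp add: Z_def)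
  ultimately have f0: "f (p \<tau>0) = 0" by simp
  define \<phi> where "\<phi> = (\<lambda>\<sigma>. p (\<tau>0 + \<sigma> * (1 - \<tau>0)))"
  have rng: "\<tau>0 + \<sigma> * (1 - \<tau>0) \<in> {\<tau>0..1}" if "\<sigma> \<in> {0..1}" for \<sigma>
  proof -
    have "\<sigma> * (1 - \<tau>0) \<le> 1 * (1 - \<tau>0)" using that t01 by (intro mult_right_mono) auto
    then show ?thesis using that t01 by auto
  qed
  show ?thesis
  proof (intro exI[of _ \<phi>] conjI ballI)
    show "continuous_on {0..1} \<phi>" unfolding \<phi>_def p_def by (intro continuous_intros)
    show "f (\<phi> 0) = 0" using f0 by (simp add: \<phi>_def)
    show "\<phi> 1 = y" by (simp add: \<phi>_def p_def)
    fix s :: real assume s: "s \<in> {0..1}"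
    show "\<phi> s \<in> closed_segment x y" unfolding \<phi>_def using rng[OF s] t01 by (intro pseg) auto
    show "f (\<phi> s) \<ge> 0"
    proof (rule ccontr)
      assume n: "\<not> f (\<phi> s) \<ge> 0"
      then have "\<tau>0 + s * (1 - \<tau>0) \<in> Z" using rng[OF s] t01 by (simp add: Z_def \<phi>_def)
      then have "\<tau>0 + s * (1 - \<tau>0) \<le> \<tau>0" by (rule \<tau>0(2))
      then have "\<tau>0 + s * (1 - \<tau>0) = \<tau>0" using rng[OF s] by (intro antisym) auto
      then show False using n f0 by (simp only: \<phi>_def)
    qed
  qed
qed

text \<open>\<open>L\<close> provides existence, uniqueness and continuous dependence on data; the
  estimates collected in \<open>shooting\<close> do not involve it.\<close>

locale lipschitz_shooting = shooting +
  fixes L :: real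
  assumes L: "L \<ge> 0" "\<And>x y. \<bar>h x - h y\<bar> \<le> L * \<bar>x - y\<bar>"
begin

lemma W_bounded: "\<exists>Q\<ge>0. \<forall>t\<in>{x..y}. \<bar>W t\<bar> \<le> Q"
proof -
  have "bounded (W ` {x..y})"
    by (intro compact_imp_bounded compact_continuous_image continuous_on_subset[OF W_cont]) auto
  then obtain Q where "\<forall>t\<in>{x..y}. \<bar>W t\<bar> \<le> Q" unfolding bounded_iff by auto
  then show ?thesis by (intro exI[of _ "max Q 0"]) (auto simp: max_def)
qed

text \<open>A positive value later would make \<open>u\<close> nonnegative from \<alpha> on and
  hence the initial slope nonnegative, so zero; uniqueness of the zero solution then gives a
  contradiction.\<close>

lemma stays_nonpos:
  assumes so: "sol c W h \<alpha> y u v" and u: "u \<alpha> = 0" "v \<alpha> \<le> 0" and t: "t \<in> {\<alpha>..y}"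
  shows "u t \<le> 0"
proof (rule ccontr)
  assume ut: "\<not> u t \<le> 0"
  then have "t \<noteq> \<alpha>" using u by auto
  have "u s \<ge> 0" if "s \<in> {\<alpha>..t}" for s
    by (rule sol_nonneg_before[OF so h_zero, of t]) (use that t ut u in auto)
  then have "v \<alpha> \<ge> 0"
    by (intro sol_min_slope_nonneg[OF sol_subset[OF so, of \<alpha> t]]) (use t u \<open>t \<noteq> \<alpha>\<close> in auto)
  then have v: "v \<alpha> = 0" using u by simp
  obtain Q where Q: "\<forall>t\<in>{\<alpha>..y}. \<bar>W t\<bar> \<le> Q" using W_bounded by blast
  have "u t = 0"
    by (rule sol_zero[OF so, where Q = Q and L = L and z = \<alpha>])
       (use Q L L(2)[of _ 0] h_zero[of 0] u v t in auto)
  then show False using ut by simp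
qed

text \<open>For the symbol \<open>0\<close> go from the dead end of the curve to the first parameter whose solution reaches
  \<open>r\<close>: it can do so only at time \<open>\<alpha> + T\<close>. For the symbol \<open>1\<close> start behind the last parameter whose
  solution stays below \<open>r\<close> on \<open>[\<alpha>, \<beta>]\<close>; that solution exceeds \<open>r\<close> on \<open>[\<beta>, \<alpha> + T]\<close>, whereas the solution at
  the other end of the curve is dead by then, so the height \<open>r\<close> at time \<open>\<alpha> + T\<close> and death are met in between.\<close>

lemma stretching:
  fixes U V :: "real \<Rightarrow> real \<Rightarrow> real" and b :: bool
  assumes cont: "continuous_on ({\<alpha>..\<alpha> + T} \<times> {0..1}) (\<lambda>z. U (fst z) (snd z))"
    and so: "\<And>s. s \<in> {0..1} \<Longrightarrow> sol c W h \<alpha> (\<alpha> + T) (\<lambda>t. U t s) (\<lambda>t. V t s)"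
    and U0: "\<And>s. s \<in> {0..1} \<Longrightarrow> 0 \<le> U \<alpha> s \<and> U \<alpha> s \<le> r"
    and Ur: "\<And>s. s \<in> {0..1} \<Longrightarrow> U \<alpha> s = r \<Longrightarrow> V \<alpha> s \<ge> K"
    and left: "U \<alpha> 0 = 0" "V \<alpha> 0 \<le> 0" and right: "U \<alpha> 1 = r"
  shows "\<exists>\<phi>::real \<Rightarrow> real. continuous_on {0..1} \<phi> \<and> (\<forall>s\<in>{0..1}. \<phi> s \<in> {0..1} \<and>
      (\<forall>t\<in>{\<alpha>..\<alpha> + T}. 0 \<le> U t (\<phi> s)) \<and> (\<forall>t\<in>{\<beta>..\<alpha> + T}. U t (\<phi> s) \<le> r) \<and>
      (if b then \<exists>t\<in>{\<alpha>..\<beta>}. U t (\<phi> s) \<ge> r else \<forall>t\<in>{\<alpha>..\<beta>}. U t (\<phi> s) \<le> r)) \<and>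
    U (\<alpha> + T) (\<phi> 0) = 0 \<and> U (\<alpha> + T) (\<phi> 1) = r"
proof -
  have csub: "continuous_on ({x..y} \<times> {l..m}) (\<lambda>z. U (fst z) (snd z))"
    if "{x..y} \<subseteq> {\<alpha>..\<alpha> + T}" "{l..m} \<subseteq> {0..1}" for x y l m
    by (rule continuous_on_subset[OF cont]) (use that in auto)
  have cs: "continuous_on {0..1} (U t)" if "t \<in> {\<alpha>..\<alpha> + T}" for t
  proof -
    have "continuous_on {0..1} (\<lambda>s. (\<lambda>z. U (fst z) (snd z)) (t, s))"
      by (rule continuous_on_compose2[OF cont]) (use that in \<open>auto intro!: continuous_intros\<close>)
    then show ?thesis by simp
  qed
  have start: "U \<alpha> s = r \<Longrightarrow> V \<alpha> s > 0" if "s \<in> {0..1}" for s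
    using Ur[OF that] K by simp
  have alive: "0 \<le> U t s" if "U (\<alpha> + T) s \<ge> 0" "s \<in> {0..1}" "t \<in> {\<alpha>..\<alpha> + T}" for s t
    by (rule sol_nonneg_before[OF so[OF that(2)] h_zero, of "\<alpha> + T"]) (use that U0 in auto)
  have ends: "\<alpha> + T \<in> {\<alpha>..\<alpha> + T}" using T_pos by simp
  show ?thesis
  proof (cases b)
    case False
    define S where "S = {s \<in> {0..1}. \<exists>t\<in>{\<alpha>..\<alpha> + T}. U t s \<ge> r}"
    have "compact S" unfolding S_def by (rule compact_exists_ge) (rule cont)
    moreover have "1 \<in> S" using right T_pos by (force simp: S_def)
    ultimately obtain s1 where s1: "s1 \<in> S" "\<And>s. s \<in> S \<Longrightarrow> s1 \<le> s"
      using compact_attains_inf[of S] by auto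
    have s1': "s1 \<in> {0..1}" using s1 by (simp add: S_def)
    have "0 \<notin> S" using stays_nonpos[OF so[of 0]] left r by (force simp: S_def)
    then have s1pos: "s1 > 0" using s1 s1' by (metis atLeastAtMost_iff order.not_eq_order_implies_strict)
    have lt: "U t s < r" if "s \<in> {0..<s1}" "t \<in> {\<alpha>..\<alpha> + T}" for s t
      using s1(2)[of s] that s1' by (force simp: S_def)
    \<comment> \<open>Before \<open>s1\<close> the height \<open>r\<close> is not reached;
      continuity in the parameter extends this weakly to \<open>s1\<close>, whose solution therefore
      touches \<open>r\<close> from below.\<close>
    have le: "U t s \<le> r" if s: "s \<in> {0..s1}" and t: "t \<in> {\<alpha>..\<alpha> + T}" for s t
    proof -
      have "closure {0..<s1} = {0..s1}" using s1pos by (simp add: closure_atLeastLessThan)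
      then show ?thesis
        using continuous_le_on_closure[of "{0..<s1}" "U t" s r] lt[OF _ t] s s1'
          continuous_on_subset[OF cs[OF t]] by (auto simp: less_imp_le)
    qed
    obtain t where t: "t \<in> {\<alpha>..\<alpha> + T}" "U t s1 \<ge> r" using s1 by (auto simp: S_def)
    have "U z s1 < r" if "z \<in> {\<alpha>..\<beta>}" for z
      by (rule below_r_on_bump[OF so[OF s1']]) (use U0 le start that s1' in auto)
    then have "t \<in> {\<beta>..\<alpha> + T}" using t by (force simp: not_less)
    then have end1: "U (\<alpha> + T) s1 = r"
      by (intro touch_at_end[OF so[OF s1']]) (use U0 le s1' t ab in auto)
    have "U (\<alpha> + T) 0 \<le> 0" using stays_nonpos[OF so[of 0]] left ends by simp
    then obtain \<phi> :: "real \<Rightarrow> real" where \<phi>: "continuous_on {0..1} \<phi>"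
      "\<And>s. s \<in> {0..1} \<Longrightarrow> \<phi> s \<in> closed_segment 0 s1 \<and> U (\<alpha> + T) (\<phi> s) \<ge> 0"
      "U (\<alpha> + T) (\<phi> 0) = 0" "\<phi> 1 = s1"
      using crossing_path[OF cs[OF ends], of 0 s1] s1' end1 r by (auto simp: Ball_def)
    have rng: "\<phi> s \<in> {0..s1}" if "s \<in> {0..1}" for s
      using \<phi>(2)[OF that] s1' by (auto simp: closed_segment_eq_real_ivl)
    show ?thesis
    proof (intro exI[of _ \<phi>] conjI ballI)
      fix s :: real assume s: "s \<in> {0..1}"
      show "\<phi> s \<in> {0..1}" using rng[OF s] s1' by auto
      then show "0 \<le> U t (\<phi> s)" if "t \<in> {\<alpha>..\<alpha> + T}" for t using alive \<phi>(2)[OF s] that by auto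
      show "U t (\<phi> s) \<le> r" if "t \<in> {\<beta>..\<alpha> + T}" for t using le[OF rng[OF s], of t] that ab by auto
      show "if b then \<exists>t\<in>{\<alpha>..\<beta>}. U t (\<phi> s) \<ge> r else \<forall>t\<in>{\<alpha>..\<beta>}. U t (\<phi> s) \<le> r"
        using False le[OF rng[OF s]] ab by auto
    qed (use \<phi> end1 in auto)
  next
    case True
    have csI: "continuous_on ({\<alpha>..\<beta>} \<times> {l..m}) (\<lambda>z. U (fst z) (snd z))" if "{l..m} \<subseteq> {0..1}" for l m
      by (rule csub) (use that ab in auto)
    have csJ: "continuous_on ({\<beta>..\<alpha> + T} \<times> {l..m}) (\<lambda>z. U (fst z) (snd z))" if "{l..m} \<subseteq> {0..1}" for l m
      by (rule csub) (use that ab in auto)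
    define S where "S = {0..1} \<inter> (\<Inter>t\<in>{\<alpha>..\<beta>}. {s \<in> {0..1}. U t s \<le> r})"
    have "closed {s \<in> {0..1}. U t s \<le> r}" if "t \<in> {\<alpha>..\<beta>}" for t
      by (intro continuous_on_closed_Collect_le cs continuous_intros) (use that ab in auto)
    then have "compact S" unfolding S_def by (intro compact_Int_closed closed_INT) auto
    moreover have "0 \<in> S"
      using nonpos_on_bump[OF so[of 0]] left r ab by (force simp: S_def)
    ultimately obtain s2 where s2: "s2 \<in> S" "\<And>s. s \<in> S \<Longrightarrow> s \<le> s2"
      using compact_attains_sup[of S] by auto
    have s2': "s2 \<in> {0..1}" and s2le: "\<And>t. t \<in> {\<alpha>..\<beta>} \<Longrightarrow> U t s2 \<le> r" using s2 by (auto simp: S_def)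
    \<comment> \<open>At parameter 1 the height is \<open>r\<close>, so the slope is at least
      \<open>K\<close>, whereas \<open>fast\<close> gives survivors of the bump a slope below
      \<open>K\<close>.\<close>
    have dead1: "U t 1 < 0" if t: "t \<in> {\<beta>..\<alpha> + T}" for t
    proof (rule ccontr)
      assume "\<not> U t 1 < 0"
      then have ut: "U t 1 \<ge> 0" by simp
      have "U s 1 \<ge> 0" if "s \<in> {\<alpha>..\<beta>}" for s
        by (rule sol_nonneg_before[OF so[of 1] h_zero, of t]) (use that t ut U0[of 1] ab in auto)
      moreover have "sol c W h \<alpha> \<beta> (\<lambda>t. U t 1) (\<lambda>t. V t 1)"
        by (rule sol_subset[OF so]) (use ab in auto)
      ultimately have "V \<alpha> 1 < K" using fast right by blast
      then show False using Ur[of 1] right by simp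
    qed
    have s21: "s2 < 1"
    proof -
      have "1 \<notin> S"
      proof
        assume "1 \<in> S"
        then have "V \<alpha> 1 \<le> 0"
          by (intro sol_max_slope_nonpos[OF sol_subset[OF so[of 1], of \<alpha> \<beta>]])
             (use ab right in \<open>auto simp: S_def\<close>)
        then show False using start[of 1] right by simp
      qed
      then have "s2 \<noteq> 1" using s2 by auto
      then show ?thesis using s2' by simp
    qed
    have gt: "\<exists>t\<in>{\<alpha>..\<beta>}. U t s > r" if "s \<in> {s2<..1}" for s
      using s2(2)[of s] that s2' by (force simp: S_def not_le)
    \<comment> \<open>Every parameter beyond \<open>s2\<close> reaches \<open>r\<close> on the bump;
      as \<open>S'\<close> is closed, so does \<open>s2\<close> itself.\<close>
    define S' where "S' = {s \<in> {0..1}. \<exists>t\<in>{\<alpha>..\<beta>}. U t s \<ge> r}"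
    have "compact S'" unfolding S'_def by (rule compact_exists_ge) (rule csI, simp)
    moreover have "{s2<..1} \<subseteq> S'" using gt s2' by (force simp: S'_def)
    ultimately have "closure {s2<..1} \<subseteq> S'" by (intro closure_minimal compact_imp_closed)
    then have "s2 \<in> S'" using s21 by (simp add: closure_greaterThanAtMost subset_iff)
    then obtain t0 where t0: "t0 \<in> {\<alpha>..\<beta>}" "U t0 s2 \<ge> r" by (auto simp: S'_def)
    \<comment> \<open>Otherwise the solution at \<open>s2\<close> would stay at or below
      \<open>r\<close> during the whole period while touching \<open>r\<close> on the bump, which
      \<open>below_r_on_bump\<close> forbids.\<close>
    have "\<exists>t\<in>{\<beta>..\<alpha> + T}. U t s2 > r"
    proof (rule ccontr)
      assume no: "\<not> (\<exists>t\<in>{\<beta>..\<alpha> + T}. U t s2 > r)"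
      have "U t s2 \<le> r" if "t \<in> {\<alpha>..\<alpha> + T}" for t
      proof (cases "t \<le> \<beta>")
        case True
        then show ?thesis using s2le that by simp
      next
        case False
        then show ?thesis using no that by (force simp: not_less)
      qed
      then have "U t0 s2 < r"
        by (intro below_r_on_bump[OF so[OF s2']]) (use U0 start s2' t0 in auto)
      then show False using t0 by simp
    qed
    then obtain t2 where t2: "t2 \<in> {\<beta>..\<alpha> + T}" "U t2 s2 > r" by blast
    define B where "B = {s \<in> {s2..1}. \<exists>t\<in>{\<beta>..\<alpha> + T}. U t s \<ge> r}"
    have "compact B" unfolding B_def by (rule compact_exists_ge) (rule csJ, use s2' in auto)
    moreover have "s2 \<in> B" using t2 s21 by (force simp: B_def)
    ultimately obtain s3 where s3: "s3 \<in> B" "\<And>s. s \<in> B \<Longrightarrow> s \<le> s3"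
      using compact_attains_sup[of B] by auto
    have s3': "s2 \<le> s3" "s3 \<le> 1" using s3 by (auto simp: B_def)
    have "1 \<notin> B" using dead1 r by (force simp: B_def)
    then have s31: "s3 < 1" using s3 s3' by (metis order.not_eq_order_implies_strict)
    have lt: "U t s < r" if "s \<in> {s3<..1}" "t \<in> {\<beta>..\<alpha> + T}" for s t
      using s3(2)[of s] that s3' by (force simp: B_def)
    have le: "U t s \<le> r" if s: "s \<in> {s3..1}" and t: "t \<in> {\<beta>..\<alpha> + T}" for s t
    proof -
      have "closure {s3<..1} = {s3..1}" using s31 by (simp add: closure_greaterThanAtMost)
      moreover have "continuous_on {s3..1} (U t)"
        by (rule continuous_on_subset[OF cs]) (use s2' s3' t ab in auto)
      ultimately show ?thesis
        using continuous_le_on_closure[of "{s3<..1}" "U t" s r] lt[OF _ t] s by (auto simp: less_imp_le)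
    qed
    have s3in: "s3 \<in> {0..1}" using s3' s2' by auto
    \<comment> \<open>The strict inequality \<open>s2 < s3\<close> matters: all parameters of the
      new path, which runs from the side of 1 down to \<open>s3\<close>, then lie beyond
      \<open>s2\<close> and so exceed \<open>r\<close> on the bump.\<close>
    have "s3 \<noteq> s2" using le[of s2 t2] t2 s3' s21 by (metis atLeastAtMost_iff leD order_refl s31 less_imp_le)
    then have s23: "s2 < s3" using s3' by simp
    obtain t3 where "t3 \<in> {\<beta>..\<alpha> + T}" "U t3 s3 \<ge> r" using s3 by (auto simp: B_def)
    then have end3: "U (\<alpha> + T) s3 = r"
      by (intro touch_at_end[OF so[OF s3in]]) (use U0 le s3in in auto)
    have "U (\<alpha> + T) 1 \<le> 0" using dead1[of "\<alpha> + T"] ab by simp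
    then obtain \<phi> :: "real \<Rightarrow> real" where \<phi>: "continuous_on {0..1} \<phi>"
      "\<And>s. s \<in> {0..1} \<Longrightarrow> \<phi> s \<in> closed_segment 1 s3 \<and> U (\<alpha> + T) (\<phi> s) \<ge> 0"
      "U (\<alpha> + T) (\<phi> 0) = 0" "\<phi> 1 = s3"
      using crossing_path[OF cs[OF ends], of 1 s3] s3in end3 r by (auto simp: Ball_def)
    have rng: "\<phi> s \<in> {s3..1}" if "s \<in> {0..1}" for s
      using \<phi>(2)[OF that] s3in by (auto simp: closed_segment_eq_real_ivl split: if_splits)
    show ?thesis
    proof (intro exI[of _ \<phi>] conjI ballI)
      fix s :: real assume s: "s \<in> {0..1}"
      show "\<phi> s \<in> {0..1}" using rng[OF s] s3in by auto
      then show "0 \<le> U t (\<phi> s)" if "t \<in> {\<alpha>..\<alpha> + T}" for t using alive \<phi>(2)[OF s] that by auto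
      show "U t (\<phi> s) \<le> r" if "t \<in> {\<beta>..\<alpha> + T}" for t using le[OF rng[OF s], of t] that by auto
      show "if b then \<exists>t\<in>{\<alpha>..\<beta>}. U t (\<phi> s) \<ge> r else \<forall>t\<in>{\<alpha>..\<beta>}. U t (\<phi> s) \<le> r"
        using True gt[of "\<phi> s"] rng[OF s] s23 by (auto intro: less_imp_le)
    qed (use \<phi> end3 in auto)
  qed
qed

end

section \<open>Finite itineraries for Lipschitz nonlinearities\<close>

text \<open>Measured against the weight \<open>exp (2 * L * (t - x))\<close>, the Picard map
  contracts by 1/2 on the whole interval, so a global Lipschitz constant gives a solution up to
  \<open>y\<close> without any continuation argument.\<close>

lemma picard_lindelof_global:
  fixes f :: "real \<Rightarrow> 'a::euclidean_space \<Rightarrow> 'a" and p0 :: 'a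
  assumes cont: "continuous_on ({x..y} \<times> UNIV) (\<lambda>z. f (fst z) (snd z))"
    and Lip: "\<And>t p q. t \<in> {x..y} \<Longrightarrow> norm (f t p - f t q) \<le> L * norm (p - q)" and L: "L > 0"
  shows "\<exists>X. X x = p0 \<and> (\<forall>t\<in>{x..y}. (X has_vector_derivative f t (X t)) (at t within {x..y}))"
proof -
  have fc: "continuous_on {x..y} (\<lambda>s. f s (g s))" if "continuous_on {x..y} g" for g
  proof -
    have "continuous_on {x..y} (\<lambda>s. (\<lambda>z. f (fst z) (snd z)) (s, g s))"
      by (rule continuous_on_compose2[OF cont]) (use that in \<open>auto intro!: continuous_intros\<close>)
    then show ?thesis by simp
  qed
  have fi: "(\<lambda>s. f s (g s)) integrable_on {x..t}" if "continuous_on {x..y} g" "t \<le> y" for g t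
    by (rule integrable_continuous_real) (rule continuous_on_subset[OF fc[OF that(1)]], use that in auto)
  define X where "X = rec_nat (\<lambda>t. p0) (\<lambda>n X t. p0 + integral {x..t} (\<lambda>s. f s (X s)))"
  have X0: "X 0 t = p0" for t by (simp add: X_def)
  have XS: "X (Suc n) t = p0 + integral {x..t} (\<lambda>s. f s (X n s))" for n t by (simp add: X_def)
  have Xc: "continuous_on {x..y} (X n)" for n
  proof (induction n)
    case 0
    then show ?case by (simp add: X0)
  next
    case (Suc n)
    have "continuous_on {x..y} (\<lambda>t. p0 + integral {x..t} (\<lambda>s. f s (X n s)))"
      by (intro continuous_intros indefinite_integral_continuous_1 fi Suc) auto
    then show ?case by (simp add: XS)
  qed
  have "bounded ((\<lambda>s. f s p0) ` {x..y})"
    by (intro compact_imp_bounded compact_continuous_image fc continuous_intros) auto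
  then obtain M where M: "M > 0" "\<And>s. s \<in> {x..y} \<Longrightarrow> norm (f s p0) \<le> M"
    unfolding bounded_pos by auto
  \<comment> \<open>Bound for the first Picard increment in the weighted norm; integrating
    \<open>M\<close> times the weight would even allow \<open>M / (2 * L)\<close>.\<close>
  define D where "D = M / L"
  have D: "D > 0" "M = L * D" using M L by (auto simp: D_def)
  have expint: "((\<lambda>s. k * exp (2 * L * (s - x))) has_integral
      k / (2 * L) * exp (2 * L * (t - x)) - k / (2 * L)) {x..t}" if "x \<le> t" for t k
  proof -
    have "((\<lambda>s. k * exp (2 * L * (s - x))) has_integral
      k / (2 * L) * exp (2 * L * (t - x)) - k / (2 * L) * exp (2 * L * (x - x))) {x..t}"
    proof (rule fundamental_theorem_of_calculus[OF that])
      fix s assume "s \<in> {x..t}"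
      have "((\<lambda>s. k / (2 * L) * exp (2 * L * (s - x))) has_real_derivative k * exp (2 * L * (s - x)))
         (at s within {x..t})"
        by (rule derivative_eq_intros refl | use L in simp)+
      then show "((\<lambda>s. k / (2 * L) * exp (2 * L * (s - x))) has_vector_derivative k * exp (2 * L * (s - x)))
         (at s within {x..t})"
        by (simp add: has_real_derivative_iff_has_vector_derivative)
    qed
    then show ?thesis by simp
  qed
  have diff: "norm (X (Suc n) t - X n t) \<le> D * (1 / 2) ^ n * exp (2 * L * (t - x))"
    if "t \<in> {x..y}" for n t
    using that
  proof (induction n arbitrary: t)
    case 0
    have t: "x \<le> t" "t \<le> y" using 0 by auto
    have "norm (integral {x..t} (\<lambda>s. f s (X 0 s))) \<le> integral {x..t} (\<lambda>s. M * exp (2 * L * (s - x)))"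
    proof (rule integral_norm_bound_integral)
      show "(\<lambda>s. M * exp (2 * L * (s - x))) integrable_on {x..t}" using expint[OF t(1)] by blast
      fix s assume s: "s \<in> {x..t}"
      then have "exp (2 * L * (s - x)) \<ge> 1" using L by simp
      then have "M * exp (2 * L * (s - x)) \<ge> M * 1" using M by (intro mult_left_mono) auto
      then show "norm (f s (X 0 s)) \<le> M * exp (2 * L * (s - x))"
        using M(2)[of s] s t by (simp add: X0)
    qed (rule fi[OF Xc t(2)])
    also have "\<dots> = M / (2 * L) * exp (2 * L * (t - x)) - M / (2 * L)"
      by (rule integral_unique[OF expint[OF t(1)]])
    also have "\<dots> \<le> M / (2 * L) * exp (2 * L * (t - x))" using M L by simp
    also have "\<dots> \<le> D * exp (2 * L * (t - x))"
      using M L by (intro mult_right_mono) (auto simp: D_def field_simps)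
    finally show ?case by (simp add: XS X0)
  next
    case (Suc n)
    have t: "x \<le> t" "t \<le> y" using Suc.prems by auto
    define k where "k = L * (D * (1 / 2) ^ n)"
    have k: "k \<ge> 0" using L D by (simp add: k_def)
    have "norm (integral {x..t} (\<lambda>s. f s (X (Suc n) s) - f s (X n s)))
        \<le> integral {x..t} (\<lambda>s. k * exp (2 * L * (s - x)))"
    proof (rule integral_norm_bound_integral)
      show "(\<lambda>s. k * exp (2 * L * (s - x))) integrable_on {x..t}" using expint[OF t(1)] by blast
      show "(\<lambda>s. f s (X (Suc n) s) - f s (X n s)) integrable_on {x..t}"
        by (intro integrable_diff fi Xc t)
      fix s assume s: "s \<in> {x..t}"
      have "norm (f s (X (Suc n) s) - f s (X n s)) \<le> L * norm (X (Suc n) s - X n s)"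
        using Lip s t by auto
      also have "\<dots> \<le> L * (D * (1 / 2) ^ n * exp (2 * L * (s - x)))"
        using Suc.IH[of s] s t L by (intro mult_left_mono) auto
      finally show "norm (f s (X (Suc n) s) - f s (X n s)) \<le> k * exp (2 * L * (s - x))"
        by (simp add: k_def)
    qed
    also have "\<dots> = k / (2 * L) * exp (2 * L * (t - x)) - k / (2 * L)"
      by (rule integral_unique[OF expint[OF t(1)]])
    also have "\<dots> \<le> k / (2 * L) * exp (2 * L * (t - x))" using k L by simp
    also have "k / (2 * L) = D * (1 / 2) ^ Suc n" using L by (simp add: k_def)
    also have "integral {x..t} (\<lambda>s. f s (X (Suc n) s) - f s (X n s)) = X (Suc (Suc n)) t - X (Suc n) t"
      unfolding XS[of "Suc n"] XS[of n t] by (subst integral_diff) (auto intro!: fi Xc t)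
    finally show ?case .
  qed
  define Y where "Y = (\<lambda>t. p0 + (\<Sum>i. X (Suc i) t - X i t))"
  have "uniform_limit {x..y} (\<lambda>n t. \<Sum>i<n. X (Suc i) t - X i t) (\<lambda>t. \<Sum>i. X (Suc i) t - X i t) sequentially"
  proof (rule Weierstrass_m_test)
    show "summable (\<lambda>n. (D * exp (2 * L * (y - x))) * (1 / 2) ^ n)"
      by (intro summable_mult summable_geometric) auto
    fix n t assume t: "t \<in> {x..y}"
    have "D * (1 / 2) ^ n * exp (2 * L * (t - x)) \<le> D * (1 / 2) ^ n * exp (2 * L * (y - x))"
      using t L D by (intro mult_left_mono) auto
    then show "norm (X (Suc n) t - X n t) \<le> (D * exp (2 * L * (y - x))) * (1 / 2) ^ n"
      using diff[OF t, of n] by (simp add: mult_ac)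
  qed
  then have "uniform_limit {x..y} (\<lambda>n t. p0 + (\<Sum>i<n. X (Suc i) t - X i t)) Y sequentially"
    unfolding Y_def by (intro uniform_limit_add uniform_limit_const)
  moreover have "(\<lambda>n t. p0 + (\<Sum>i<n. X (Suc i) t - X i t)) = X"
    using sum_lessThan_telescope[of "\<lambda>i. X i _"] by (intro ext) (simp add: X0)
  ultimately have ul: "uniform_limit {x..y} X Y sequentially" by simp
  have Yc: "continuous_on {x..y} Y"
    by (rule uniform_limit_theorem[OF _ ul]) (simp_all add: Xc)
  have Yint: "Y t = p0 + integral {x..t} (\<lambda>s. f s (Y s))" if t: "t \<in> {x..y}" for t
  proof -
    have u: "uniform_limit {x..t} (\<lambda>n s. f s (X n s)) (\<lambda>s. f s (Y s)) sequentially"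
      unfolding uniform_limit_iff
    proof (intro allI impI)
      fix e :: real assume e: "e > 0"
      then have "\<forall>\<^sub>F n in sequentially. \<forall>s\<in>{x..y}. dist (X n s) (Y s) < e / L"
        using ul L unfolding uniform_limit_iff by simp
      then show "\<forall>\<^sub>F n in sequentially. \<forall>s\<in>{x..t}. dist (f s (X n s)) (f s (Y s)) < e"
      proof eventually_elim
        case (elim n)
        show ?case
        proof
          fix s assume s: "s \<in> {x..t}"
          have "dist (f s (X n s)) (f s (Y s)) \<le> L * dist (X n s) (Y s)"
            using Lip[of s "X n s" "Y s"] s t by (simp add: dist_norm)
          also have "\<dots> < L * (e / L)" using elim s t L by (intro mult_strict_left_mono) auto
          finally show "dist (f s (X n s)) (f s (Y s)) < e" using L by simp
        qed
      qed
    qed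
    have cn: "continuous_on {x..t} (\<lambda>s. f s (X n s))" for n
      by (rule continuous_on_subset[OF fc[OF Xc]]) (use t in auto)
    obtain I J where IJ: "\<And>n. ((\<lambda>s. f s (X n s)) has_integral I n) {x..t}"
      "((\<lambda>s. f s (Y s)) has_integral J) {x..t}" "I \<longlonglongrightarrow> J"
      using uniform_limit_integral[OF u cn sequentially_bot] by blast
    have "(\<lambda>n. X (Suc n) t) = (\<lambda>n. p0 + I n)" by (simp add: XS integral_unique[OF IJ(1)])
    then have "(\<lambda>n. X (Suc n) t) \<longlonglongrightarrow> p0 + J" using IJ(3) by (auto intro!: tendsto_intros)
    moreover have "(\<lambda>n. X (Suc n) t) \<longlonglongrightarrow> Y t"
      by (rule LIMSEQ_Suc) (rule tendsto_uniform_limitI[OF ul t])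
    ultimately show ?thesis using IJ(2) LIMSEQ_unique by (auto dest!: integral_unique)
  qed
  show ?thesis
  proof (cases "x \<le> y")
    case True
    show ?thesis
    proof (intro exI[of _ Y] conjI ballI)
      show "Y x = p0" using Yint[of x] True by simp
      fix t assume t: "t \<in> {x..y}"
      have "((\<lambda>u. p0 + integral {x..u} (\<lambda>s. f s (Y s))) has_vector_derivative 0 + f t (Y t)) (at t within {x..y})"
        by (intro has_vector_derivative_add has_vector_derivative_const
            integral_has_vector_derivative[OF fc[OF Yc] t])
      then show "(Y has_vector_derivative f t (Y t)) (at t within {x..y})"
        using has_vector_derivative_transform[OF t, of Y "\<lambda>u. p0 + integral {x..u} (\<lambda>s. f s (Y s))"] Yint
        by auto
    qed
  qed (auto intro: exI[of _ "\<lambda>_. p0"])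
qed

context lipschitz_shooting
begin

lemma sol_exists:
  "\<exists>u v. sol c W h x y u v \<and> u x = u0 \<and> v x = v0"
proof -
  obtain Q where Q: "Q \<ge> 0" "\<forall>t\<in>{x..y}. \<bar>W t\<bar> \<le> Q" using W_bounded by blast
  define f where "f = (\<lambda>t (p :: real \<times> real). (snd p, - c * snd p - W t * h (fst p)))"
  have hc: "continuous_on UNIV h"
  proof -
    have "L-lipschitz_on UNIV h"
      by (rule lipschitz_onI) (use L in \<open>auto simp: dist_real_def\<close>)
    then show ?thesis by (rule lipschitz_on_continuous_on)
  qed
  have "continuous_on ({x..y} \<times> UNIV) (\<lambda>z. f (fst z) (snd z))"
    unfolding f_def
    by (intro continuous_intros continuous_on_compose2[OF hc] continuous_on_compose2[OF W_cont]) auto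
  moreover have "norm (f t p - f t p') \<le> (1 + \<bar>c\<bar> + Q * L) * norm (p - p')" if t: "t \<in> {x..y}" for t p p'
  proof -
    have n1: "\<bar>fst p - fst p'\<bar> \<le> norm (p - p')"
      by (metis fst_diff norm_fst_le prod.collapse real_norm_def)
    have n2: "\<bar>snd p - snd p'\<bar> \<le> norm (p - p')"
      by (metis snd_diff norm_snd_le prod.collapse real_norm_def)
    have "f t p - f t p' = (snd p - snd p', - c * (snd p - snd p') - W t * (h (fst p) - h (fst p')))"
      by (simp add: f_def algebra_simps)
    also have "norm \<dots> \<le> \<bar>snd p - snd p'\<bar> + \<bar>- c * (snd p - snd p') - W t * (h (fst p) - h (fst p'))\<bar>"
      using norm_Pair_le[of "snd p - snd p'" "- c * (snd p - snd p') - W t * (h (fst p) - h (fst p'))"]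
      unfolding real_norm_def .
    also have "\<bar>- c * (snd p - snd p') - W t * (h (fst p) - h (fst p'))\<bar> \<le>
        \<bar>c\<bar> * \<bar>snd p - snd p'\<bar> + \<bar>W t\<bar> * \<bar>h (fst p) - h (fst p')\<bar>"
      using abs_triangle_ineq4[of "- c * (snd p - snd p')" "W t * (h (fst p) - h (fst p'))"]
      by (simp add: abs_mult)
    also have "\<bar>c\<bar> * \<bar>snd p - snd p'\<bar> \<le> \<bar>c\<bar> * norm (p - p')" using n2 by (intro mult_left_mono) auto
    also have "\<bar>W t\<bar> * \<bar>h (fst p) - h (fst p')\<bar> \<le> Q * (L * norm (p - p'))"
    proof (rule mult_mono)
      have "\<bar>h (fst p) - h (fst p')\<bar> \<le> L * \<bar>fst p - fst p'\<bar>" by (rule L)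
      also have "\<dots> \<le> L * norm (p - p')" using n1 L by (intro mult_left_mono) auto
      finally show "\<bar>h (fst p) - h (fst p')\<bar> \<le> L * norm (p - p')" .
    qed (use Q t in auto)
    also note n2
    finally show ?thesis by (simp add: algebra_simps)
  qed
  moreover have "1 + \<bar>c\<bar> + Q * L > 0" using Q L by (simp add: add_pos_nonneg)
  ultimately obtain X where X: "X x = (u0, v0)"
    "\<And>t. t \<in> {x..y} \<Longrightarrow> (X has_vector_derivative f t (X t)) (at t within {x..y})"
    using picard_lindelof_global[of x y f "1 + \<bar>c\<bar> + Q * L" "(u0, v0)"] by blast
  have "sol c W h x y (\<lambda>t. fst (X t)) (\<lambda>t. snd (X t))"
    unfolding sol_def
  proof
    fix t assume "t \<in> {x..y}"
    then have d: "(X has_vector_derivative f t (X t)) (at t within {x..y})" by (rule X)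
    show "((\<lambda>t. fst (X t)) has_real_derivative snd (X t)) (at t within {x..y}) \<and>
      ((\<lambda>t. snd (X t)) has_real_derivative - c * snd (X t) - W t * h (fst (X t))) (at t within {x..y})"
      using bounded_linear.has_vector_derivative[OF bounded_linear_fst d]
        bounded_linear.has_vector_derivative[OF bounded_linear_snd d]
      by (simp add: has_real_derivative_iff_has_vector_derivative f_def)
  qed
  then show ?thesis
    using X(1) by (intro exI[of _ "\<lambda>t. fst (X t)"] exI[of _ "\<lambda>t. snd (X t)"] conjI) auto
qed

text \<open>The data run along the segment from \<open>(0, 0)\<close> to \<open>(r, K)\<close>,
  which satisfies the invariant of the stretching step. Joint continuity combines continuity in time
  with a Lipschitz bound in the parameter that is uniform in time, obtained from the energy of the
  difference of two solutions.\<close>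

lemma continuous_family:
  assumes xy: "x \<le> y"
  shows "\<exists>U V. continuous_on ({x..y} \<times> {0..1}) (\<lambda>z. U (fst z) (snd z)) \<and>
    (\<forall>s. sol c W h x y (\<lambda>t. U t s) (\<lambda>t. V t s) \<and> U x s = s * r \<and> V x s = s * K)"
proof -
  have "\<forall>s. \<exists>p. sol c W h x y (fst p) (snd p) \<and> fst p x = s * r \<and> snd p x = s * K"
    using sol_exists by auto
  then obtain P where P: "\<And>s. sol c W h x y (fst (P s)) (snd (P s))"
    "\<And>s. fst (P s) x = s * r" "\<And>s. snd (P s) x = s * K"
    by metis
  define U where "U = (\<lambda>t s. fst (P s) t)"
  define V where "V = (\<lambda>t s. snd (P s) t)"
  have so: "sol c W h x y (\<lambda>t. U t s) (\<lambda>t. V t s)" for s using P(1) by (simp add: U_def V_def)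
  have U0: "U x s = s * r" and V0: "V x s = s * K" for s using P by (auto simp: U_def V_def)
  obtain Q where Q: "Q \<ge> 0" "\<forall>t\<in>{x..y}. \<bar>W t\<bar> \<le> Q" using W_bounded by blast
  define B where "B = \<bar>c\<bar> + Q * L"
  \<comment> \<open>Square root of the energy growth factor times the squared length of the data
    segment.\<close>
  define C where "C = sqrt ((r\<^sup>2 + K\<^sup>2) * exp ((1 + 3 * B) * (y - x)))"
  have B: "B \<ge> 0" using Q L by (simp add: B_def)
  have lip: "\<bar>U t s - U t s'\<bar> \<le> C * \<bar>s - s'\<bar>" if t: "t \<in> {x..y}" for t s s'
  proof -
    have "(U t s - U t s')\<^sup>2 + (V t s - V t s')\<^sup>2 \<le>
      ((U x s - U x s')\<^sup>2 + (V x s - V x s')\<^sup>2) * exp ((1 + 3 * B) * (t - x))"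
    proof (rule energy_growth[where f = "\<lambda>t. U t s - U t s'" and f' = "\<lambda>t. V t s - V t s'"
          and g' = "\<lambda>t. (- c * V t s - W t * h (U t s)) - (- c * V t s' - W t * h (U t s'))", OF _ _ _ B t])
      fix z assume z: "z \<in> {x..y}"
      show "((\<lambda>t. U t s - U t s') has_real_derivative V z s - V z s') (at z within {x..y})"
        "((\<lambda>t. V t s - V t s') has_real_derivative
          (- c * V z s - W z * h (U z s)) - (- c * V z s' - W z * h (U z s'))) (at z within {x..y})"
        using so[of s] so[of s'] z unfolding sol_def by (auto intro!: DERIV_diff)
      have "(- c * V z s - W z * h (U z s)) - (- c * V z s' - W z * h (U z s')) =
        - c * (V z s - V z s') - W z * (h (U z s) - h (U z s'))" by (simp add: algebra_simps)
      also have "\<bar>\<dots>\<bar> \<le> \<bar>c\<bar> * \<bar>V z s - V z s'\<bar> + \<bar>W z\<bar> * \<bar>h (U z s) - h (U z s')\<bar>"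
        using abs_triangle_ineq4[of "- c * (V z s - V z s')" "W z * (h (U z s) - h (U z s'))"]
        by (simp add: abs_mult)
      also have "\<bar>W z\<bar> * \<bar>h (U z s) - h (U z s')\<bar> \<le> Q * (L * \<bar>U z s - U z s'\<bar>)"
        using Q z L by (intro mult_mono) auto
      also have "\<bar>c\<bar> * \<bar>V z s - V z s'\<bar> + Q * (L * \<bar>U z s - U z s'\<bar>) \<le>
          B * (\<bar>U z s - U z s'\<bar> + \<bar>V z s - V z s'\<bar>)"
        using Q L by (simp add: B_def algebra_simps)
      finally show "\<bar>(- c * V z s - W z * h (U z s)) - (- c * V z s' - W z * h (U z s'))\<bar> \<le>
        B * (\<bar>U z s - U z s'\<bar> + \<bar>V z s - V z s'\<bar>)" by simp
    qed
    also have "\<dots> \<le> ((U x s - U x s')\<^sup>2 + (V x s - V x s')\<^sup>2) * exp ((1 + 3 * B) * (y - x))"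
      using t B by (intro mult_left_mono) (auto intro!: mult_left_mono)
    also have "U x s - U x s' = (s - s') * r" by (simp add: U0 left_diff_distrib)
    also have "V x s - V x s' = (s - s') * K" by (simp add: V0 left_diff_distrib)
    also have "(((s - s') * r)\<^sup>2 + ((s - s') * K)\<^sup>2) * exp ((1 + 3 * B) * (y - x)) =
        (s - s')\<^sup>2 * ((r\<^sup>2 + K\<^sup>2) * exp ((1 + 3 * B) * (y - x)))"
      by (simp only: power_mult_distrib distrib_left[symmetric] mult.assoc)
    finally have "(U t s - U t s')\<^sup>2 \<le> (s - s')\<^sup>2 * ((r\<^sup>2 + K\<^sup>2) * exp ((1 + 3 * B) * (y - x)))"
      by (smt (verit) zero_le_power2)
    then have "sqrt ((U t s - U t s')\<^sup>2) \<le> sqrt ((s - s')\<^sup>2 * ((r\<^sup>2 + K\<^sup>2) * exp ((1 + 3 * B) * (y - x))))"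
      by (rule real_sqrt_le_mono)
    then show ?thesis unfolding real_sqrt_mult[of "(s - s')\<^sup>2"] C_def by (simp add: mult.commute)
  qed
  have "continuous_on ({x..y} \<times> {0..1}) (\<lambda>z. U (fst z) (snd z))"
    unfolding continuous_on_def
  proof
    fix z0 assume z0: "z0 \<in> {x..y} \<times> {0..1::real}"
    let ?F = "at z0 within {x..y} \<times> {0..1}"
    have cu: "continuous_on {x..y} (\<lambda>t. U t (snd z0))" by (rule sol_continuous(1)[OF so])
    have cu': "continuous_on ({x..y} \<times> {0..1}) (\<lambda>z :: real \<times> real. U (fst z) (snd z0))"
      by (rule continuous_on_compose2[OF cu]) (auto intro!: continuous_intros)
    have l1: "((\<lambda>z. U (fst z) (snd z0)) \<longlongrightarrow> U (fst z0) (snd z0)) ?F"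
      using cu' z0 unfolding continuous_on_def by blast
    have l2: "((\<lambda>z. C * \<bar>snd z - snd z0\<bar>) \<longlongrightarrow> C * \<bar>snd z0 - snd z0\<bar>) ?F"
      by (intro tendsto_intros)
    have "((\<lambda>z. U (fst z) (snd z) - U (fst z) (snd z0)) \<longlongrightarrow> 0) ?F"
    proof (rule Lim_null_comparison)
      show "((\<lambda>z. C * \<bar>snd z - snd z0\<bar>) \<longlongrightarrow> 0) ?F" using l2 by simp
      show "\<forall>\<^sub>F z in ?F. norm (U (fst z) (snd z) - U (fst z) (snd z0)) \<le> C * \<bar>snd z - snd z0\<bar>"
        unfolding eventually_at_filter by (rule always_eventually) (auto intro!: lip)
    qed
    from tendsto_add[OF this l1] show "((\<lambda>z. U (fst z) (snd z)) \<longlongrightarrow> U (fst z0) (snd z0)) ?F" by simp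
  qed
  then show ?thesis using so U0 V0 by blast
qed

text \<open>Each stretching step reparametrises a part of the current curve, so later curves keep
  the stages already achieved. Induction on the number of completed periods.\<close>

lemma finite_itinerary:
  fixes \<sigma> :: "nat \<Rightarrow> bool"
  shows "\<exists>u v. sol c W h \<alpha> (\<alpha> + of_nat M * T) u v \<and> (\<forall>j<M. stage \<alpha> \<beta> T r (\<sigma> j) (\<lambda>t. u (t + of_nat j * T)))"
proof -
  have M0: "\<alpha> \<le> \<alpha> + of_nat M * T" using T_pos by simp
  obtain U V :: "real \<Rightarrow> real \<Rightarrow> real" where UV: "continuous_on ({\<alpha>..\<alpha> + of_nat M * T} \<times> {0..1}) (\<lambda>z. U (fst z) (snd z))"
    "\<And>s. sol c W h \<alpha> (\<alpha> + of_nat M * T) (\<lambda>t. U t s) (\<lambda>t. V t s)"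
    "\<And>s. U \<alpha> s = s * r" "\<And>s. V \<alpha> s = s * K"
    using continuous_family[OF M0] by blast
  \<comment> \<open>\<phi> selects parameters of the original family. Beyond the stages, the claim
    records what \<open>stretching\<close> requires at the start of the next period, including the
    slope conditions at heights 0 and \<open>r\<close>.\<close>
  have "\<exists>\<phi>::real \<Rightarrow> real. continuous_on {0..1} \<phi> \<and> (\<forall>s\<in>{0..1}. \<phi> s \<in> {0..1} \<and>
      (\<forall>j<n. stage \<alpha> \<beta> T r (\<sigma> j) (\<lambda>t. U (t + of_nat j * T) (\<phi> s))) \<and>
      0 \<le> U (\<alpha> + of_nat n * T) (\<phi> s) \<and> U (\<alpha> + of_nat n * T) (\<phi> s) \<le> r \<and>
      (U (\<alpha> + of_nat n * T) (\<phi> s) = r \<longrightarrow> V (\<alpha> + of_nat n * T) (\<phi> s) \<ge> K)) \<and>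
      U (\<alpha> + of_nat n * T) (\<phi> 0) = 0 \<and> V (\<alpha> + of_nat n * T) (\<phi> 0) \<le> 0 \<and>
      U (\<alpha> + of_nat n * T) (\<phi> 1) = r" if "n \<le> M" for n
    using that
  proof (induction n)
    case 0
    have "s * r \<le> 1 * r" if "s \<le> 1" for s using that r by (intro mult_right_mono) auto
    then show ?case
      by (intro exI[of _ "\<lambda>s. s"]) (use r in \<open>auto simp: UV\<close>)
  next
    case (Suc n)
    let ?d = "of_nat n * T"
    have "of_nat (Suc n) * T \<le> of_nat M * T" using Suc.prems T_pos by (intro mult_right_mono) auto
    then have d: "T + ?d \<le> of_nat M * T" "?d \<ge> 0" using T_pos by (auto simp: algebra_simps)
    then have range: "{\<alpha> + ?d..\<alpha> + T + ?d} \<subseteq> {\<alpha>..\<alpha> + of_nat M * T}" by auto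
    from Suc obtain \<phi> :: "real \<Rightarrow> real" where \<phi>c: "continuous_on {0..1} \<phi>"
      and \<phi>: "\<And>s. s \<in> {0..1} \<Longrightarrow> \<phi> s \<in> {0..1} \<and>
        (\<forall>j<n. stage \<alpha> \<beta> T r (\<sigma> j) (\<lambda>t. U (t + of_nat j * T) (\<phi> s))) \<and>
        0 \<le> U (\<alpha> + ?d) (\<phi> s) \<and> U (\<alpha> + ?d) (\<phi> s) \<le> r \<and>
        (U (\<alpha> + ?d) (\<phi> s) = r \<longrightarrow> V (\<alpha> + ?d) (\<phi> s) \<ge> K)"
      and ends: "U (\<alpha> + ?d) (\<phi> 0) = 0" "V (\<alpha> + ?d) (\<phi> 0) \<le> 0" "U (\<alpha> + ?d) (\<phi> 1) = r"
      by auto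
    have inr: "\<alpha> \<le> t + ?d \<and> t + ?d \<le> \<alpha> + of_nat M * T" if "\<alpha> \<le> t \<and> t \<le> \<alpha> + T" for t
      using d that by linarith
    have sh: "sol c W h \<alpha> (\<alpha> + T) (\<lambda>t. U (t + ?d) p) (\<lambda>t. V (t + ?d) p)" for p
      by (rule sol_shift[OF sol_subset[OF UV(2) range]]) (use W_periodic[of _ "int n"] in simp)
    have "continuous_on ({\<alpha>..\<alpha> + T} \<times> {0..1})
        (\<lambda>z. (\<lambda>z. U (fst z) (snd z)) (fst z + ?d, \<phi> (snd z)))"
      by (rule continuous_on_compose2[OF UV(1)])
         (use inr \<phi> in \<open>auto intro!: continuous_intros continuous_on_compose2[OF \<phi>c]\<close>)
    then have "continuous_on ({\<alpha>..\<alpha> + T} \<times> {0..1}) (\<lambda>z. (\<lambda>t s. U (t + ?d) (\<phi> s)) (fst z) (snd z))"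
      by simp
    from stretching[OF this, of "\<lambda>t s. V (t + ?d) (\<phi> s)" "\<sigma> n"] sh \<phi> ends
    obtain \<psi> :: "real \<Rightarrow> real" where \<psi>c: "continuous_on {0..1} \<psi>"
      and \<psi>: "\<And>s. s \<in> {0..1} \<Longrightarrow> \<psi> s \<in> {0..1} \<and> stage \<alpha> \<beta> T r (\<sigma> n) (\<lambda>t. U (t + ?d) (\<phi> (\<psi> s)))"
      and e: "U (\<alpha> + T + ?d) (\<phi> (\<psi> 0)) = 0" "U (\<alpha> + T + ?d) (\<phi> (\<psi> 1)) = r"
      unfolding stage_def by auto
    have eq: "\<alpha> + of_nat (Suc n) * T = \<alpha> + T + ?d" by (simp add: algebra_simps)
    show ?case
      unfolding eq
    proof (intro exI[of _ "\<lambda>s. \<phi> (\<psi> s)"] conjI ballI)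
      show "continuous_on {0..1} (\<lambda>s. \<phi> (\<psi> s))"
        by (rule continuous_on_compose2[OF \<phi>c \<psi>c]) (use \<psi> in auto)
      show "U (\<alpha> + T + ?d) (\<phi> (\<psi> 0)) = 0" "U (\<alpha> + T + ?d) (\<phi> (\<psi> 1)) = r" by fact+
      \<comment> \<open>The value 0 at the end of a period on which the solution is nonnegative is a
        minimum, so the slope there is at most 0.\<close>
      show "V (\<alpha> + T + ?d) (\<phi> (\<psi> 0)) \<le> 0"
        by (rule sol_min_slope_nonpos[OF sh]) (use e \<psi>[of 0] ab in \<open>auto simp: stage_def\<close>)
      fix s :: real assume s: "s \<in> {0..1}"
      have st: "stage \<alpha> \<beta> T r (\<sigma> n) (\<lambda>t. U (t + ?d) (\<phi> (\<psi> s)))" using \<psi>[OF s] by simp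
      show "\<phi> (\<psi> s) \<in> {0..1}" using \<phi> \<psi>[OF s] by simp
      show "\<forall>j<Suc n. stage \<alpha> \<beta> T r (\<sigma> j) (\<lambda>t. U (t + of_nat j * T) (\<phi> (\<psi> s)))"
        using \<phi> \<psi>[OF s] st by (auto simp: less_Suc_eq)
      show "0 \<le> U (\<alpha> + T + ?d) (\<phi> (\<psi> s))" "U (\<alpha> + T + ?d) (\<phi> (\<psi> s)) \<le> r"
        using st ab by (auto simp: stage_def)
      show "U (\<alpha> + T + ?d) (\<phi> (\<psi> s)) = r \<longrightarrow> V (\<alpha> + T + ?d) (\<phi> (\<psi> s)) \<ge> K"
      proof
        assume eqr: "U (\<alpha> + T + ?d) (\<phi> (\<psi> s)) = r"
        have sb: "sol c W h \<beta> (\<alpha> + T) (\<lambda>t. U (t + ?d) (\<phi> (\<psi> s))) (\<lambda>t. V (t + ?d) (\<phi> (\<psi> s)))"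
          by (rule sol_subset[OF sh]) (use ab in auto)
        show "V (\<alpha> + T + ?d) (\<phi> (\<psi> s)) \<ge> K"
          by (rule entry[OF sb]) (use st eqr in \<open>auto simp: stage_def\<close>)
      qed
    qed
  qed
  \<comment> \<open>Any parameter of the final curve will do; 0 is taken.\<close>
  from this[of M] obtain \<phi> :: "real \<Rightarrow> real" where
    "\<forall>s\<in>{0..1}. \<forall>j<M. stage \<alpha> \<beta> T r (\<sigma> j) (\<lambda>t. U (t + of_nat j * T) (\<phi> s))" by auto
  then have "\<forall>j<M. stage \<alpha> \<beta> T r (\<sigma> j) (\<lambda>t. U (t + of_nat j * T) (\<phi> 0))" by simp
  then show ?thesis using UV(2)[of "\<phi> 0"] by (intro exI conjI)
qed

end

section \<open>Recovery of strict inequalities on the whole line\<close>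

lemma period_window:
  fixes T t \<alpha> :: real
  assumes "T > 0"
  obtains i :: int where "\<alpha> \<le> t - of_int i * T" "t - of_int i * T < \<alpha> + T"
proof -
  define i where "i = \<lfloor>(t - \<alpha>) / T\<rfloor>"
  have "of_int i \<le> (t - \<alpha>) / T" "(t - \<alpha>) / T < of_int i + 1" unfolding i_def by linarith+
  then have "of_int i * T \<le> t - \<alpha>" "t - \<alpha> < (of_int i + 1) * T"
    using assms by (simp_all add: pos_le_divide_eq pos_divide_less_eq)
  then show thesis using that[of i] by (simp add: algebra_simps)
qed

context shooting
begin

text \<open>The closed stage conditions on all periods already imply the strict ones, since a
  solution that touches \<open>r\<close> from below contradicts the estimates. It uses no Lipschitz
  condition and therefore applies to the limit solution.\<close>

lemma strict_itinerary:
  fixes \<sigma> :: "int \<Rightarrow> bool"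
  assumes u: "\<And>t. (u has_real_derivative v t) (at t)"
    and v: "\<And>t. (v has_real_derivative - c * v t - W t * h (u t)) (at t)"
    and st: "\<And>i. stage \<alpha> \<beta> T r (\<sigma> i) (\<lambda>t. u (t + of_int i * T))"
  shows "\<And>i t. t \<in> {\<beta>..\<alpha> + T} \<Longrightarrow> u (t + of_int i * T) < r"
    "\<And>i t. \<not> \<sigma> i \<Longrightarrow> t \<in> {\<alpha>..\<beta>} \<Longrightarrow> u (t + of_int i * T) < r"
    "\<And>i. \<sigma> i \<Longrightarrow> \<exists>t\<in>{\<alpha>..\<beta>}. r < u (t + of_int i * T)"
    "\<And>t. 0 \<le> u t" "\<And>t. u t \<le> max r R"
proof -
  have so: "sol c W h \<alpha> (\<alpha> + T) (\<lambda>t. u (t + of_int i * T)) (\<lambda>t. v (t + of_int i * T))" for i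
  proof (rule sol_shift[where q = W])
    show "sol c W h (\<alpha> + of_int i * T) (\<alpha> + T + of_int i * T) u v"
      unfolding sol_def using u v by (auto intro: has_field_derivative_at_within)
  qed (rule W_periodic)
  have so1: "sol c W h \<alpha> \<beta> (\<lambda>t. u (t + of_int i * T)) (\<lambda>t. v (t + of_int i * T))" for i
    by (rule sol_subset[OF so]) (use ab in auto)
  have so2: "sol c W h \<beta> (\<alpha> + T) (\<lambda>t. u (t + of_int i * T)) (\<lambda>t. v (t + of_int i * T))" for i
    by (rule sol_subset[OF so]) (use ab in auto)
  have nn: "0 \<le> u (t + of_int i * T)" if "t \<in> {\<alpha>..\<alpha> + T}" for i t
    using st[of i] that by (auto simp: stage_def)
  have le: "u (t + of_int i * T) \<le> r" if "t \<in> {\<beta>..\<alpha> + T}" for i t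
    using st[of i] that by (auto simp: stage_def)
  \<comment> \<open>At height \<open>r\<close>, \<open>entry\<close> for the preceding period would
    give slope at least \<open>K\<close>, and \<open>fast\<close> for the present one slope below
    \<open>K\<close>.\<close>
  have start: "u (\<alpha> + of_int i * T) < r" for i
  proof (rule ccontr)
    assume n: "\<not> u (\<alpha> + of_int i * T) < r"
    have eq: "\<alpha> + T + of_int (i - 1) * T = \<alpha> + of_int i * T" by (simp add: algebra_simps)
    have ur: "u (\<alpha> + of_int i * T) = r" using le[of "\<alpha> + T" "i - 1"] n ab unfolding eq by simp
    have "v (\<alpha> + T + of_int (i - 1) * T) \<ge> K"
      by (rule entry[OF so2[of "i - 1"]]) (use le[of _ "i - 1"] ur in \<open>simp_all only: eq\<close>)
    moreover have "v (\<alpha> + of_int i * T) < K"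
      by (rule fast[OF so1[of i]]) (use nn[of _ i] ur ab in auto)
    ultimately show False unfolding eq by simp
  qed
  show 1: "u (t + of_int i * T) < r" if t: "t \<in> {\<beta>..\<alpha> + T}" for i t
  proof (rule ccontr)
    assume "\<not> u (t + of_int i * T) < r"
    then have "u (\<alpha> + T + of_int i * T) = r"
      by (intro touch_at_end[OF so[of i] _ _ t]) (use nn[of \<alpha> i] le[of _ i] ab in auto)
    moreover have "\<alpha> + T + of_int i * T = \<alpha> + of_int (i + 1) * T" by (simp add: algebra_simps)
    ultimately show False using start[of "i + 1"] by simp
  qed
  have below: "u (t + of_int i * T) < r"
    if small: "\<And>t. t \<in> {\<alpha>..\<beta>} \<Longrightarrow> u (t + of_int i * T) \<le> r" and t: "t \<in> {\<alpha>..\<beta>}" for i t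
  proof (rule below_r_on_bump[OF so[of i] _ _ _ t])
    show "0 \<le> u (\<alpha> + of_int i * T)" using nn[of \<alpha> i] ab by simp
    show "u (z + of_int i * T) \<le> r" if "z \<in> {\<alpha>..\<alpha> + T}" for z
      using that small[of z] le[of z i] by (cases "z \<le> \<beta>") auto
    show "0 < v (\<alpha> + of_int i * T)" if "u (\<alpha> + of_int i * T) = r" using that start[of i] by simp
  qed
  show "u (t + of_int i * T) < r" if "\<not> \<sigma> i" "t \<in> {\<alpha>..\<beta>}" for i t
    by (rule below) (use st[of i] that in \<open>auto simp: stage_def\<close>)
  show "\<exists>t\<in>{\<alpha>..\<beta>}. r < u (t + of_int i * T)" if \<sigma>: "\<sigma> i" for i
  proof (rule ccontr)
    assume n: "\<not> (\<exists>t\<in>{\<alpha>..\<beta>}. r < u (t + of_int i * T))"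
    obtain t where t: "t \<in> {\<alpha>..\<beta>}" "u (t + of_int i * T) \<ge> r" using st[of i] \<sigma> by (auto simp: stage_def)
    then show False using below[of i t] n by force
  qed
  show "0 \<le> u t" for t
  proof -
    obtain i where "\<alpha> \<le> t - of_int i * T" "t - of_int i * T < \<alpha> + T" using period_window[OF T_pos] .
    then show ?thesis using nn[of "t - of_int i * T" i] by simp
  qed
  show "u t \<le> max r R" for t
  proof -
    obtain i where i: "\<alpha> \<le> t - of_int i * T" "t - of_int i * T < \<alpha> + T" using period_window[OF T_pos] .
    show ?thesis
    proof (cases "t - of_int i * T \<le> \<beta>")
      case True
      have "u (t - of_int i * T + of_int i * T) \<le> R"
        by (rule bounded[OF so1[of i]]) (use nn[of _ i] ab i True in auto)
      then show ?thesis by simp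
    next
      case False
      then show ?thesis using le[of "t - of_int i * T" i] i by simp
    qed
  qed
qed

end

section \<open>Lipschitz approximation from below\<close>

text \<open>The Pasch-Hausdorff envelope: for nonnegative \<open>g\<close> and \<open>n\<close>, the
  largest \<open>n\<close>-Lipschitz minorant of \<open>g\<close> on the half-line. The
  \<open>max s 0\<close> extends it to negative arguments by its value at 0.\<close>

definition infconv :: "(real \<Rightarrow> real) \<Rightarrow> real \<Rightarrow> real \<Rightarrow> real" where
  "infconv g n s = (INF t\<in>{0..}. g t + n * \<bar>max s 0 - t\<bar>)"

context
  fixes g :: "real \<Rightarrow> real" and n :: real
  assumes g: "\<And>t. t \<ge> 0 \<Longrightarrow> g t \<ge> 0" and g0: "g 0 = 0" and n: "n \<ge> 0"
begin

lemma infconv_le: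
  assumes "t \<ge> 0"
  shows "infconv g n s \<le> g t + n * \<bar>max s 0 - t\<bar>"
  unfolding infconv_def
proof (rule cINF_lower)
  show "bdd_below ((\<lambda>t. g t + n * \<bar>max s 0 - t\<bar>) ` {0..})"
    by (rule bdd_belowI2[of _ 0]) (simp add: g n)
qed (use assms in simp)

lemma infconv_ge:
  assumes "\<And>t. t \<ge> 0 \<Longrightarrow> B \<le> g t + n * \<bar>max s 0 - t\<bar>"
  shows "B \<le> infconv g n s"
  unfolding infconv_def by (rule cINF_greatest) (use assms in auto)

lemma infconv_le_self: "infconv g n s \<le> g (max s 0)"
  using infconv_le[of "max s 0" s] by simp

lemma infconv_nonneg: "infconv g n s \<ge> 0"
  by (rule infconv_ge) (use g n in auto)

lemma infconv_zero: "s \<le> 0 \<Longrightarrow> infconv g n s = 0"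
  using infconv_le_self[of s] infconv_nonneg[of s] g0 by (simp add: max.absorb2)

lemma infconv_lipschitz: "\<bar>infconv g n s - infconv g n s'\<bar> \<le> n * \<bar>s - s'\<bar>"
proof -
  have *: "infconv g n s - n * \<bar>s - s'\<bar> \<le> infconv g n s'" for s s'
  proof (rule infconv_ge)
    fix t :: real assume t: "t \<ge> 0"
    have "\<bar>max s 0 - t\<bar> \<le> \<bar>max s' 0 - t\<bar> + \<bar>s - s'\<bar>" by (auto simp: max_def)
    then have "n * \<bar>max s 0 - t\<bar> \<le> n * (\<bar>max s' 0 - t\<bar> + \<bar>s - s'\<bar>)" using n by (rule mult_left_mono)
    then show "infconv g n s - n * \<bar>s - s'\<bar> \<le> g t + n * \<bar>max s' 0 - t\<bar>"
      using infconv_le[OF t, of s] by (simp add: distrib_left)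
  qed
  show ?thesis using *[of s s'] *[of s' s] by (simp add: abs_le_iff abs_minus_commute)
qed

end

text \<open>The arguments \<open>s k\<close> move, because the limit is taken inside the
  differential equation. The upper bound is \<open>g\<close> itself; from below, points
  \<open>t\<close> near the limit have nearly the right value of \<open>g\<close>, while distant
  ones are penalised by a slope tending to infinity.\<close>

lemma infconv_tendsto:
  assumes g: "\<And>t. t \<ge> 0 \<Longrightarrow> g t \<ge> 0" "g 0 = 0" and gc: "continuous_on {0..} g"
    and nk: "filterlim n at_top sequentially" "\<And>k. n k \<ge> 0" and s: "s \<longlonglongrightarrow> l"
  shows "(\<lambda>k. infconv g (n k) (s k)) \<longlonglongrightarrow> g (max l 0)"
proof (rule LIMSEQ_I)
  fix e :: real assume e: "e > 0"
  let ?l = "max l 0"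
  have gc': "continuous_on UNIV (\<lambda>x. g (max x 0))"
    by (rule continuous_on_compose2[OF gc]) (auto intro!: continuous_intros)
  then have up: "(\<lambda>k. g (max (s k) 0)) \<longlonglongrightarrow> g (max l 0)"
    by (rule continuous_on_tendsto_compose[OF _ s]) auto
  from gc e obtain d where d: "d > 0" "\<And>t. t \<ge> 0 \<Longrightarrow> \<bar>t - ?l\<bar> < d \<Longrightarrow> \<bar>g t - g ?l\<bar> < e / 2"
    unfolding continuous_on_iff dist_real_def
    by (metis atLeast_iff half_gt_zero max.cobounded2)
  have sm: "(\<lambda>k. max (s k) 0) \<longlonglongrightarrow> ?l" by (intro tendsto_intros s)
  have ev1: "\<forall>\<^sub>F k in sequentially. \<bar>max (s k) 0 - ?l\<bar> < d / 2"
    using tendstoD[OF sm, of "d / 2"] d by (simp add: dist_real_def)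
  have ev2: "\<forall>\<^sub>F k in sequentially. n k \<ge> 2 * g ?l / d"
    using nk(1) unfolding filterlim_at_top by blast
  have ev3: "\<forall>\<^sub>F k in sequentially. \<bar>g (max (s k) 0) - g ?l\<bar> < e"
    using tendstoD[OF up, of e] e by (simp add: dist_real_def)
  from ev1 ev2 ev3 have "\<forall>\<^sub>F k in sequentially. norm (infconv g (n k) (s k) - g ?l) < e"
  proof eventually_elim
    case (elim k)
    have "infconv g (n k) (s k) \<le> g (max (s k) 0)" by (rule infconv_le_self[where g = g, OF g nk(2)])
    moreover have "g ?l - e / 2 \<le> infconv g (n k) (s k)"
    proof (rule infconv_ge[where g = g, OF g nk(2)])
      fix t :: real assume t: "t \<ge> 0"
      show "g ?l - e / 2 \<le> g t + n k * \<bar>max (s k) 0 - t\<bar>"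
      proof (cases "\<bar>t - ?l\<bar> < d")
        case True
        have "n k * \<bar>max (s k) 0 - t\<bar> \<ge> 0" using nk(2) by simp
        then show ?thesis using d(2)[OF t True] by linarith
      next
        case False
        then have "\<bar>max (s k) 0 - t\<bar> \<ge> d / 2" using elim(1) by linarith
        then have "(2 * g ?l / d) * (d / 2) \<le> n k * \<bar>max (s k) 0 - t\<bar>"
          using elim(2) nk(2) d(1) by (intro mult_mono) auto
        then show ?thesis using g(1)[OF t] d(1) e by simp
      qed
    qed
    ultimately show ?case using elim(3) e by (simp add: abs_less_iff)
  qed
  then show "\<exists>no. \<forall>k\<ge>no. norm (infconv g (n k) (s k) - g ?l) < e"
    by (simp add: eventually_sequentially)
qed

section \<open>Choice of the constants\<close>

text \<open>The order of the quantifiers is the point: \<open>h\<close> comes last and enters only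
  through inequalities, so that the extended \<open>g\<close> and all its approximations share
  \<open>K\<close> and the threshold for \<mu>.\<close>

lemma shooting_constants:
  fixes c T \<alpha> \<beta> :: real and a :: "real \<Rightarrow> real"
  assumes ab: "\<alpha> < \<beta>" "\<beta> < \<alpha> + T"
    and ac: "continuous_on UNIV a" and ap: "\<And>t. a (t + T) = a t"
    and apos: "\<forall>t\<in>{\<alpha><..<\<beta>}. a t > 0" and aneg: "\<forall>t\<in>{\<beta><..<\<alpha> + T}. a t < 0"
  shows "\<exists>\<epsilon>>0. \<exists>\<Lambda>>0. \<exists>\<kappa>>0. \<forall>r>0. \<forall>\<rho>>0. \<forall>G>0. \<forall>\<gamma>>0. \<exists>K. \<exists>\<mu>\<^sub>0>0. \<forall>\<mu>>\<mu>\<^sub>0. \<forall>h.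
    (\<forall>s. h s \<ge> 0) \<and> (\<forall>s\<le>0. h s = 0) \<and> (\<forall>s\<le>r. h s \<le> \<epsilon> * r) \<and> (\<forall>s\<ge>\<rho>. h s \<ge> \<Lambda> * s) \<and>
    (\<forall>s\<le>\<rho> / \<kappa>. h s \<le> G) \<and> (\<forall>s\<in>{r/4..r}. h s \<ge> \<gamma>) \<longrightarrow> shooting c T \<alpha> \<beta> \<mu> r (\<rho> / \<kappa>) K a h"
proof -
  have acs: "continuous_on S a" for S by (rule continuous_on_subset[OF ac]) auto
  have pos: "a t > 0" if "t \<in> {\<alpha><..<\<beta>}" for t using apos that by blast
  have neg: "a t < 0" if "t \<in> {\<beta><..<\<alpha> + T}" for t using aneg that by blast
  have apos: "a t \<ge> 0" if "t \<in> {\<alpha>..\<beta>}" for t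
    using continuous_ge_on_closure[of "{\<alpha><..<\<beta>}" a t 0] acs pos that ab
    by (auto simp: less_imp_le)
  have aneg: "a t \<le> 0" if "t \<in> {\<beta>..\<alpha> + T}" for t
    using continuous_le_on_closure[of "{\<beta><..<\<alpha> + T}" a t 0] acs neg that ab
    by (auto simp: less_imp_le)
  have "bounded (a ` {\<alpha>..\<beta>})" by (intro compact_imp_bounded compact_continuous_image acs) auto
  then obtain A where A: "A > 0" "\<And>t. t \<in> {\<alpha>..\<beta>} \<Longrightarrow> \<bar>a t\<bar> \<le> A" unfolding bounded_pos by auto
  define l where "l = \<beta> - \<alpha>"
  define E where "E = exp (\<bar>c\<bar> * l)"
  have l: "l > 0" using ab by (simp add: l_def)
  have E: "E > 0" by (simp add: E_def)
  \<comment> \<open>Makes the smallness condition of \<open>almost_linear_descent\<close> on the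
    bump an equality.\<close>
  define \<epsilon> where "\<epsilon> = 1 / (2 * (E\<^sup>2 * A * l\<^sup>2))"
  have pE: "E\<^sup>2 * A * l\<^sup>2 > 0" using E A l by simp
  then have \<epsilon>: "\<epsilon> > 0" by (simp add: \<epsilon>_def)
  have \<epsilon>small: "E\<^sup>2 * A * \<epsilon> * l\<^sup>2 \<le> 1 / 2"
  proof -
    have "E\<^sup>2 * A * \<epsilon> * l\<^sup>2 = (E\<^sup>2 * A * l\<^sup>2) * \<epsilon>" by (simp add: mult_ac)
    also have "\<dots> = 1 / 2" using pE E A l by (simp add: \<epsilon>_def)
    finally show ?thesis by simp
  qed
  obtain \<Lambda> \<kappa> where \<Lambda>: "\<Lambda> > 0" and \<kappa>: "\<kappa> > 0"
    and apriori: "\<And>h u v \<rho> t. sol c a h \<alpha> \<beta> u v \<Longrightarrow> (\<forall>x. h x \<ge> 0) \<Longrightarrow> (\<forall>x\<ge>\<rho>. h x \<ge> \<Lambda> * x) \<Longrightarrow>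
      (\<forall>t\<in>{\<alpha>..\<beta>}. u t \<ge> 0) \<Longrightarrow> 0 < \<rho> \<Longrightarrow> t \<in> {\<alpha>..\<beta>} \<Longrightarrow> \<kappa> * u t < \<rho>"
    using superlinear_bound[OF ab(1) acs pos, of c] by metis
  show ?thesis
  proof (rule exI[of _ \<epsilon>], rule conjI[OF \<epsilon>], rule exI[of _ \<Lambda>], rule conjI[OF \<Lambda>],
      rule exI[of _ \<kappa>], rule conjI[OF \<kappa>], intro allI impI)
    fix r \<rho> G \<gamma> :: real assume r: "r > 0" and \<rho>: "\<rho> > 0" and G: "G > 0" and \<gamma>: "\<gamma> > 0"
    define R where "R = \<rho> / \<kappa>"
    have R: "R > 0" using \<rho> \<kappa> by (simp add: R_def)
    \<comment> \<open>The bound of \<open>slope_bound\<close> on the bump for survivors, which have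
      height at most \<open>R\<close> and forcing at most \<open>A * G\<close>.\<close>
    define C where "C = E * (R / l + A * G * l)"
    have C: "C > 0" using E R l A G by (auto simp: C_def intro!: mult_pos_pos add_pos_pos)
    define K where "K = C + 1"
    have K: "K > 0" using C by (simp add: K_def)
    \<comment> \<open>Used for \<open>exits\<close>: leaving the bump at height \<open>r / 2\<close>
      or more and staying below \<open>r\<close> would need a slope below \<open>- K\<close>, but
      survivors have slopes of size at most \<open>C < K\<close>.\<close>
    have "\<exists>\<mu>\<^sub>1>0. \<forall>\<mu>>\<mu>\<^sub>1. \<forall>h u v. sol c (\<lambda>t. - \<mu> * - a t) h \<beta> (\<alpha> + T) u v \<and> (\<forall>x. h x \<ge> 0) \<and>
        (\<forall>x\<in>{r/4..r}. h x \<ge> \<gamma>) \<and> u \<beta> \<ge> r / 2 \<and> (\<forall>t\<in>{\<beta>..\<alpha> + T}. u t \<le> r) \<longrightarrow> v \<beta> < - K"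
      by (rule convex_push[OF ab(2) _ _ r K \<gamma>]) (use neg in \<open>auto intro!: continuous_intros acs\<close>)
    then obtain \<mu>1 where \<mu>1: "\<mu>1 > 0" and push1: "\<forall>\<mu>>\<mu>1. \<forall>h u v.
        sol c (\<lambda>t. - \<mu> * - a t) h \<beta> (\<alpha> + T) u v \<and> (\<forall>x. h x \<ge> 0) \<and> (\<forall>x\<in>{r/4..r}. h x \<ge> \<gamma>) \<and>
        u \<beta> \<ge> r / 2 \<and> (\<forall>t\<in>{\<beta>..\<alpha> + T}. u t \<le> r) \<longrightarrow> v \<beta> < - K"
      by (elim exE conjE)
    \<comment> \<open>The mirror image, used for \<open>entry\<close>: reflected in time, a solution
      ending at height \<open>r\<close> starts with slope below \<open>- K\<close>, so it originally
      arrived with slope above \<open>K\<close>.\<close>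
    have "continuous_on {- (\<alpha> + T)..- \<beta>} (\<lambda>t. - a (- t))"
      by (intro continuous_intros continuous_on_compose2[OF ac]) auto
    then have "\<exists>\<mu>\<^sub>1>0. \<forall>\<mu>>\<mu>\<^sub>1. \<forall>h u v. sol (- c) (\<lambda>t. - \<mu> * - a (- t)) h (- (\<alpha> + T)) (- \<beta>) u v \<and>
        (\<forall>x. h x \<ge> 0) \<and> (\<forall>x\<in>{r/4..r}. h x \<ge> \<gamma>) \<and> u (- (\<alpha> + T)) \<ge> r / 2 \<and>
        (\<forall>t\<in>{- (\<alpha> + T)..- \<beta>}. u t \<le> r) \<longrightarrow> v (- (\<alpha> + T)) < - K"
      by (intro convex_push[OF _ _ _ r K \<gamma>]) (use neg ab in auto)
    then obtain \<mu>2 where \<mu>2: "\<mu>2 > 0" and push2: "\<forall>\<mu>>\<mu>2. \<forall>h u v.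
        sol (- c) (\<lambda>t. - \<mu> * - a (- t)) h (- (\<alpha> + T)) (- \<beta>) u v \<and> (\<forall>x. h x \<ge> 0) \<and>
        (\<forall>x\<in>{r/4..r}. h x \<ge> \<gamma>) \<and>
        u (- (\<alpha> + T)) \<ge> r / 2 \<and> (\<forall>t\<in>{- (\<alpha> + T)..- \<beta>}. u t \<le> r) \<longrightarrow> v (- (\<alpha> + T)) < - K"
      by (elim exE conjE)
    show "\<exists>K. \<exists>\<mu>\<^sub>0>0. \<forall>\<mu>>\<mu>\<^sub>0. \<forall>h.
      (\<forall>s. h s \<ge> 0) \<and> (\<forall>s\<le>0. h s = 0) \<and> (\<forall>s\<le>r. h s \<le> \<epsilon> * r) \<and> (\<forall>s\<ge>\<rho>. h s \<ge> \<Lambda> * s) \<and>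
      (\<forall>s\<le>\<rho> / \<kappa>. h s \<le> G) \<and> (\<forall>s\<in>{r/4..r}. h s \<ge> \<gamma>) \<longrightarrow> shooting c T \<alpha> \<beta> \<mu> r (\<rho> / \<kappa>) K a h"
    proof (rule exI[of _ K], rule exI[of _ "max \<mu>1 \<mu>2"], rule conjI, goal_cases)
      case 1
      show "0 < max \<mu>1 \<mu>2" using \<mu>1 by simp
    next
      case 2
      show ?case
      proof (intro allI impI, elim conjE)
      fix \<mu> and h :: "real \<Rightarrow> real"
      assume "max \<mu>1 \<mu>2 < \<mu>" and h0: "\<forall>s. h s \<ge> 0" and hz: "\<forall>s\<le>0. h s = 0"
        and h\<epsilon>: "\<forall>s\<le>r. h s \<le> \<epsilon> * r" and h\<Lambda>: "\<forall>s\<ge>\<rho>. h s \<ge> \<Lambda> * s"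
        and hG: "\<forall>s\<le>\<rho> / \<kappa>. h s \<le> G" and h\<gamma>: "\<forall>s\<in>{r/4..r}. h s \<ge> \<gamma>"
      then have \<mu>: "\<mu> > \<mu>1" "\<mu> > \<mu>2" by auto
      have Wp: "weight a \<mu> t = a t" if "t \<in> {\<alpha>..\<beta>}" for t
        using apos[OF that] by (simp add: weight_def plus_part_def minus_part_def)
      have Wn: "weight a \<mu> t = - \<mu> * - a t" if "t \<in> {\<beta>..\<alpha> + T}" for t
        using aneg[OF that] by (simp add: weight_def plus_part_def minus_part_def)
      have bnd: "u t \<le> R \<and> \<bar>v t\<bar> \<le> C"
        if so: "sol c (weight a \<mu>) h \<alpha> \<beta> u v" and un: "\<And>t. t \<in> {\<alpha>..\<beta>} \<Longrightarrow> u t \<ge> 0"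
        and t: "t \<in> {\<alpha>..\<beta>}" for u v t
      proof -
        have so': "sol c a h \<alpha> \<beta> u v" by (rule sol_cong[OF so]) (rule Wp)
        have uR: "u z \<le> R" if "z \<in> {\<alpha>..\<beta>}" for z
          using apriori[OF so' h0 h\<Lambda> _ \<rho> that] un \<kappa> by (auto simp: R_def pos_le_divide_eq mult.commute)
        have "\<bar>v t\<bar> \<le> exp (\<bar>c\<bar> * (\<beta> - \<alpha>)) * (R / (\<beta> - \<alpha>) + (A * G) * (\<beta> - \<alpha>))"
        proof (rule slope_bound[OF so' ab(1) _ _ t])
          fix z assume z: "z \<in> {\<alpha>..\<beta>}"
          show "0 \<le> u z \<and> u z \<le> R" using un uR z by blast
          have "\<bar>h (u z)\<bar> \<le> G" using h0 hG uR[OF z] by (simp add: R_def)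
          then show "\<bar>a z * h (u z)\<bar> \<le> A * G"
            unfolding abs_mult using A z by (intro mult_mono) auto
        qed
        then show ?thesis using uR[OF t] by (simp add: C_def E_def l_def)
      qed
      show "shooting c T \<alpha> \<beta> \<mu> r (\<rho> / \<kappa>) K a h"
      proof (rule shooting.intro)
        show "\<alpha> < \<beta>" "\<beta> < \<alpha> + T" "continuous_on UNIV a" "0 < r" "0 < K" by fact+
        show "a (t + T) = a t" for t by (rule ap)
        show "0 < \<mu>" using \<mu> \<mu>1 by simp
        show "0 \<le> h s" for s using h0 by blast
        show "h s = 0" if "s \<le> 0" for s using hz that by blast
        show "0 \<le> a t" if "t \<in> {\<alpha>..\<beta>}" for t by (rule apos[OF that])
        show "a t \<le> 0" if "t \<in> {\<beta>..\<alpha> + T}" for t by (rule aneg[OF that])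
        fix u v :: "real \<Rightarrow> real"
        show "v \<alpha> < K" if "sol c (weight a \<mu>) h \<alpha> \<beta> u v" "\<And>t. t \<in> {\<alpha>..\<beta>} \<Longrightarrow> 0 \<le> u t" "u \<alpha> = r"
        proof -
          have "\<bar>v \<alpha>\<bar> \<le> C" using bnd[OF that(1,2)] ab by simp
          then show ?thesis unfolding K_def by linarith
        qed
        show "u t \<le> \<rho> / \<kappa>"
          if "sol c (weight a \<mu>) h \<alpha> \<beta> u v" "\<And>t. t \<in> {\<alpha>..\<beta>} \<Longrightarrow> 0 \<le> u t" "t \<in> {\<alpha>..\<beta>}" for t
          using bnd[OF that] by (simp add: R_def)
        show "u \<beta> < r / 2" if so: "sol c (weight a \<mu>) h \<alpha> (\<alpha> + T) u v"
          and un: "\<And>t. t \<in> {\<alpha>..\<beta>} \<Longrightarrow> 0 \<le> u t" and ur: "\<And>t. t \<in> {\<beta>..\<alpha> + T} \<Longrightarrow> u t \<le> r"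
        proof (rule ccontr)
          assume n: "\<not> u \<beta> < r / 2"
          have "sol c (weight a \<mu>) h \<beta> (\<alpha> + T) u v" by (rule sol_subset[OF so]) (use ab in auto)
          then have "sol c (\<lambda>t. - \<mu> * - a t) h \<beta> (\<alpha> + T) u v" by (rule sol_cong) (rule Wn)
          then have "v \<beta> < - K" using push1[rule_format, OF \<mu>(1), of h u v] h0 h\<gamma> n ur by auto
          moreover have "sol c (weight a \<mu>) h \<alpha> \<beta> u v" by (rule sol_subset[OF so]) (use ab in auto)
          then have "\<bar>v \<beta>\<bar> \<le> C" using bnd[of u v \<beta>] un ab by auto
          ultimately show False unfolding K_def by linarith
        qed
        show "r / 2 \<le> u \<beta>" if so: "sol c (weight a \<mu>) h \<alpha> \<beta> u v" and t: "t \<in> {\<alpha>..\<beta>}"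
          and ut: "u t = r" "v t = 0" and ur: "\<And>z. z \<in> {t..\<beta>} \<Longrightarrow> u z \<le> r" for t
        proof -
          have so': "sol c a h \<alpha> \<beta> u v" by (rule sol_cong[OF so]) (rule Wp)
          show ?thesis
          proof (rule almost_linear_descent[OF so' ab(1) t ut ur])
          show "0 \<le> a z \<and> a z \<le> A" if "z \<in> {\<alpha>..\<beta>}" for z using apos A that by (metis abs_le_D1)
          show "0 \<le> h s \<and> h s \<le> \<epsilon> * r" if "s \<le> r" for s using h0 h\<epsilon> that by blast
          show "(exp (\<bar>c\<bar> * (\<beta> - \<alpha>)))\<^sup>2 * A * \<epsilon> * (\<beta> - \<alpha>)\<^sup>2 \<le> 1 / 2"
            using \<epsilon>small by (simp add: E_def l_def)
          qed (use r in auto)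
        qed
        show "K \<le> v (\<alpha> + T)" if so: "sol c (weight a \<mu>) h \<beta> (\<alpha> + T) u v"
          and ur: "\<And>t. t \<in> {\<beta>..\<alpha> + T} \<Longrightarrow> u t \<le> r" and e: "u (\<alpha> + T) = r"
        proof -
          have "sol c (\<lambda>t. - \<mu> * - a t) h \<beta> (\<alpha> + T) u v" by (rule sol_cong[OF so]) (rule Wn)
          from sol_reflect[OF this]
          have "sol (- c) (\<lambda>t. - \<mu> * - a (- t)) h (- (\<alpha> + T)) (- \<beta>) (\<lambda>t. u (- t)) (\<lambda>t. - v (- t))" .
          then have "- v (- (- (\<alpha> + T))) < - K"
            by (intro push2[rule_format, OF \<mu>(2), of h "\<lambda>t. u (- t)"] conjI h0 h\<gamma> ballI)
               (use ur e r in \<open>auto simp: add.commute\<close>)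
          then show ?thesis unfolding minus_minus by linarith
        qed
      qed
      qed
    qed
  qed
qed

section \<open>Passage to the limit\<close>

text \<open>The diagonal argument gives convergence on the rationals, and the common Lipschitz
  constant transfers the Cauchy property to every real point.\<close>

lemma equilipschitz_subsequence:
  fixes F :: "nat \<Rightarrow> real \<Rightarrow> 'a::{banach,heine_borel}"
  assumes M: "\<And>n t. norm (F n t) \<le> M" and B: "\<And>n s t. norm (F n s - F n t) \<le> B * \<bar>s - t\<bar>"
  obtains k where "strict_mono (k :: nat \<Rightarrow> nat)" "\<And>t. convergent (\<lambda>n. F (k n) t)"
proof -
  have B0: "B \<ge> 0" using order_trans[OF norm_ge_zero B[of 0 1 0]] by simp
  obtain k where k: "strict_mono (k :: nat \<Rightarrow> nat)" "\<And>w. w \<in> \<rat> \<Longrightarrow> \<exists>l. (\<lambda>n. F (k n) w) \<longlonglongrightarrow> l"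
    using function_convergent_subsequence[of "\<rat> :: real set" F M] countable_rat M by metis
  have "convergent (\<lambda>n. F (k n) t)" for t
  proof (rule Cauchy_convergent, rule CauchyI)
    fix e :: real assume e: "e > 0"
    define d where "d = e / (3 * (B + 1))"
    have d: "d > 0" using e B0 by (simp add: d_def)
    have Bd: "B * d \<le> e / 3"
    proof -
      have "B * d \<le> (B + 1) * d" using d by (intro mult_right_mono) auto
      also have "\<dots> = e / 3" using B0 by (simp add: d_def field_simps)
      finally show ?thesis .
    qed
    obtain w where w: "w \<in> \<rat>" "t < w" "w < t + d" using Rats_dense_in_real[of t "t + d"] d by auto
    have Cw: "Cauchy (\<lambda>n. F (k n) w)" using k(2)[OF w(1)] by (auto intro: LIMSEQ_imp_Cauchy)
    obtain N where N: "\<And>m n. m \<ge> N \<Longrightarrow> n \<ge> N \<Longrightarrow> norm (F (k m) w - F (k n) w) < e / 3"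
      using CauchyD[OF Cw, of "e / 3"] e by auto
    have near: "norm (F n t - F n w) \<le> e / 3" "norm (F n w - F n t) \<le> e / 3" for n
    proof -
      have "B * \<bar>t - w\<bar> \<le> B * d" using w B0 by (intro mult_left_mono) auto
      then show "norm (F n t - F n w) \<le> e / 3" using B[of n t w] Bd by linarith
      then show "norm (F n w - F n t) \<le> e / 3" by (simp add: norm_minus_commute)
    qed
    show "\<exists>N. \<forall>m\<ge>N. \<forall>n\<ge>N. norm (F (k m) t - F (k n) t) < e"
    proof (intro exI[of _ N] allI impI)
      fix m n assume mn: "m \<ge> N" "n \<ge> N"
      have "F (k m) t - F (k n) t =
        (F (k m) t - F (k m) w) + (F (k m) w - F (k n) w) + (F (k n) w - F (k n) t)" by simp
      also have "norm \<dots> \<le> norm (F (k m) t - F (k m) w) + norm (F (k m) w - F (k n) w)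
          + norm (F (k n) w - F (k n) t)"
        by (intro norm_triangle_mono order_refl)
      finally show "norm (F (k m) t - F (k n) t) < e"
        using near(1)[of "k m"] near(2)[of "k n"] N[OF mn] by linarith
    qed
  qed
  then show thesis using that k(1) by blast
qed

text \<open>The equation passes to the limit in integrated form by dominated convergence, so
  pointwise convergence of the derivatives suffices. The hypothesis \<open>der\<close> is only
  eventual because the domains grow to cover \<open>[s, t]\<close>.\<close>

lemma limit_increment:
  fixes f f' :: "nat \<Rightarrow> real \<Rightarrow> real"
  assumes st: "s \<le> t"
    and der: "\<forall>\<^sub>F k in sequentially. \<forall>z\<in>{s..t}. (f k has_real_derivative f' k z) (at z within {s..t})"
    and cont: "\<And>k. continuous_on {s..t} (f' k)" and M: "\<And>k z. z \<in> {s..t} \<Longrightarrow> \<bar>f' k z\<bar> \<le> M"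
    and lim: "\<And>z. z \<in> {s..t} \<Longrightarrow> (\<lambda>k. f' k z) \<longlonglongrightarrow> F' z"
    and ends: "(\<lambda>k. f k s) \<longlonglongrightarrow> F s" "(\<lambda>k. f k t) \<longlonglongrightarrow> F t"
  shows "F t - F s = integral {s..t} F'"
proof -
  have "(\<lambda>k. integral {s..t} (f' k)) \<longlonglongrightarrow> integral {s..t} F'"
    by (rule dominated_convergence(2)[where h = "\<lambda>_. M"])
       (use cont M lim in \<open>auto intro: integrable_continuous_real\<close>)
  moreover have "\<forall>\<^sub>F k in sequentially. f k t - f k s = integral {s..t} (f' k)"
    using der
  proof eventually_elim
    case (elim k)
    then have "(f' k has_integral f k t - f k s) {s..t}"
      by (intro fundamental_theorem_of_calculus st)
         (simp add: has_real_derivative_iff_has_vector_derivative)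
    then show ?case by (simp add: integral_unique)
  qed
  ultimately have "(\<lambda>k. f k t - f k s) \<longlonglongrightarrow> integral {s..t} F'"
    by (simp add: tendsto_cong)
  moreover have "(\<lambda>k. f k t - f k s) \<longlonglongrightarrow> F t - F s" by (intro tendsto_diff ends)
  ultimately show ?thesis by (rule LIMSEQ_unique[symmetric])
qed

lemma derivative_of_increments:
  fixes F F' :: "real \<Rightarrow> real"
  assumes inc: "\<And>s t. s \<le> t \<Longrightarrow> F t - F s = integral {s..t} F'" and cont: "continuous_on UNIV F'"
  shows "(F has_real_derivative F' t) (at t)"
proof -
  have "((\<lambda>z. integral {t - 1..z} F') has_real_derivative F' t) (at t within {t - 1..t + 1})"
    by (rule integral_has_real_derivative) (auto intro: continuous_on_subset[OF cont])
  then have "((\<lambda>z. F (t - 1) + integral {t - 1..z} F') has_real_derivative 0 + F' t) (at t within {t - 1..t + 1})"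
    by (intro DERIV_add DERIV_const)
  then have "(F has_real_derivative 0 + F' t) (at t within {t - 1..t + 1})"
  proof (rule has_field_derivative_transform_within[where d = 1])
    fix z assume "z \<in> {t - 1..t + 1}"
    then show "F (t - 1) + integral {t - 1..z} F' = F z" using inc[of "t - 1" z] by simp
  qed auto
  then show ?thesis by (simp add: at_within_Icc_at)
qed

lemma sol_lipschitz:
  assumes so: "sol c q h x y u v" and A: "\<And>t. t \<in> {x..y} \<Longrightarrow> \<bar>v t\<bar> \<le> A" and st: "s \<in> {x..y}" "t \<in> {x..y}"
  shows "\<bar>u s - u t\<bar> \<le> A * \<bar>s - t\<bar>"
proof -
  have "norm (u s - u t) \<le> A * norm (s - t)"
    by (rule field_differentiable_bound[of "{x..y}" u v]) (use so A st in \<open>auto simp: sol_def\<close>)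
  then show ?thesis by simp
qed

text \<open>Heights and slopes are bounded and equi-Lipschitz, the latter through the equation. The
  limits of both satisfy the integrated system, and continuity of its right-hand side gives
  classical derivatives.\<close>

lemma limit_solution:
  fixes u v h :: "nat \<Rightarrow> real \<Rightarrow> real"
  assumes so: "\<And>k. sol c q (h k) (x k) (y k) (u k) (v k)" and xy: "\<And>k. x k \<le> y k"
    and lims: "filterlim x at_bot sequentially" "filterlim y at_top sequentially"
    and A: "\<And>k t. t \<in> {x k..y k} \<Longrightarrow> \<bar>u k t\<bar> \<le> A \<and> \<bar>v k t\<bar> \<le> A \<and> \<bar>h k (u k t)\<bar> \<le> A"
    and qc: "continuous_on UNIV q" and Q: "\<And>t. \<bar>q t\<bar> \<le> Q"
    and hc: "\<And>k. continuous_on UNIV (h k)" and gc: "continuous_on UNIV g"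
    and conv: "\<And>\<phi> s l. strict_mono \<phi> \<Longrightarrow> s \<longlonglongrightarrow> l \<Longrightarrow> (\<lambda>k. h (\<phi> k) (s k)) \<longlonglongrightarrow> g l"
  shows "\<exists>\<phi> U V. strict_mono (\<phi> :: nat \<Rightarrow> nat) \<and> (\<forall>t. (\<lambda>k. u (\<phi> k) t) \<longlonglongrightarrow> U t) \<and>
    (\<forall>t. (U has_real_derivative V t) (at t)) \<and>
    (\<forall>t. (V has_real_derivative - c * V t - q t * g (U t)) (at t))"
proof -
  \<comment> \<open>Clamping time to the domain of the \<open>k\<close>-th solution yields functions
    on the whole line with the same bounds; at a fixed time the clamp is eventually the
    identity.\<close>
  define cl where "cl k t = max (x k) (min (y k) t)" for k t
  have cl_in: "cl k t \<in> {x k..y k}" for k t using xy[of k] by (auto simp: cl_def)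
  have cl_lip: "\<bar>cl k s - cl k t\<bar> \<le> \<bar>s - t\<bar>" for k s t by (auto simp: cl_def max_def min_def)
  have cl_cont: "continuous_on S (cl k)" for S k unfolding cl_def by (intro continuous_intros)
  have ev: "\<forall>\<^sub>F k in sequentially. x k \<le> s \<and> t \<le> y k" for s t
    using lims unfolding filterlim_at_bot filterlim_at_top by (auto intro: eventually_conj)
  have A0: "A \<ge> 0" using A[of "x 0" 0] xy[of 0] by force
  have Q0: "Q \<ge> 0" using Q[of 0] by linarith
  define B where "B = \<bar>c\<bar> * A + Q * A"
  have B0: "B \<ge> 0" using A0 Q0 by (simp add: B_def)
  have rhs: "\<bar>- c * v k (cl k t) - q s * h k (u k (cl k t))\<bar> \<le> B" for k s t
  proof -
    have "\<bar>- c * v k (cl k t) - q s * h k (u k (cl k t))\<bar> \<le>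
        \<bar>c\<bar> * \<bar>v k (cl k t)\<bar> + \<bar>q s\<bar> * \<bar>h k (u k (cl k t))\<bar>"
      using abs_triangle_ineq4[of "- c * v k (cl k t)" "q s * h k (u k (cl k t))"] by (simp add: abs_mult)
    also have "\<dots> \<le> \<bar>c\<bar> * A + Q * A"
      using A[OF cl_in] Q Q0 by (intro add_mono mult_mono) auto
    finally show ?thesis by (simp add: B_def)
  qed
  have ulip: "\<bar>u k s - u k t\<bar> \<le> A * \<bar>s - t\<bar>" if "s \<in> {x k..y k}" "t \<in> {x k..y k}" for k s t
    by (rule sol_lipschitz[OF so[of k] _ that]) (use A in blast)
  have vlip: "\<bar>v k s - v k t\<bar> \<le> B * \<bar>s - t\<bar>" if st: "s \<in> {x k..y k}" "t \<in> {x k..y k}" for k s t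
  proof -
    have "norm (v k s - v k t) \<le> B * norm (s - t)"
    proof (rule field_differentiable_bound[of "{x k..y k}"])
      fix z assume z: "z \<in> {x k..y k}"
      show "(v k has_real_derivative - c * v k z - q z * h k (u k z)) (at z within {x k..y k})"
        using so[of k] z by (simp add: sol_def)
      have "cl k z = z" using z by (auto simp: cl_def)
      then show "norm (- c * v k z - q z * h k (u k z)) \<le> B" using rhs[of k z z] by simp
    qed (use st in auto)
    then show ?thesis by simp
  qed
  \<comment> \<open>The pair ensures that heights and slopes converge along the same
    subsequence.\<close>
  define F where "F k t = (u k (cl k t), v k (cl k t))" for k t
  have "norm (F k t) \<le> A + A" for k t
    using norm_Pair_le[of "u k (cl k t)" "v k (cl k t)"] A[OF cl_in, of k t] by (simp add: F_def)
  moreover have Flip: "norm (F k s - F k t) \<le> (A + B) * \<bar>s - t\<bar>" for k s t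
  proof -
    have "norm (F k s - F k t) \<le> \<bar>u k (cl k s) - u k (cl k t)\<bar> + \<bar>v k (cl k s) - v k (cl k t)\<bar>"
      using norm_Pair_le[of "u k (cl k s) - u k (cl k t)" "v k (cl k s) - v k (cl k t)"]
      by (simp add: F_def)
    also have "\<dots> \<le> A * \<bar>cl k s - cl k t\<bar> + B * \<bar>cl k s - cl k t\<bar>"
      by (intro add_mono ulip vlip cl_in)
    also have "\<dots> \<le> A * \<bar>s - t\<bar> + B * \<bar>s - t\<bar>"
      using A0 B0 cl_lip by (intro add_mono mult_left_mono) auto
    finally show ?thesis by (simp add: distrib_right)
  qed
  ultimately obtain \<phi> where \<phi>: "strict_mono (\<phi> :: nat \<Rightarrow> nat)" "\<And>t. convergent (\<lambda>n. F (\<phi> n) t)"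
    using equilipschitz_subsequence[of F "A + A" "A + B"] by blast
  define L where "L t = lim (\<lambda>n. F (\<phi> n) t)" for t
  have L: "(\<lambda>n. F (\<phi> n) t) \<longlonglongrightarrow> L t" for t
    unfolding L_def using \<phi>(2) by (simp add: convergent_LIMSEQ_iff)
  define U where "U t = fst (L t)" for t
  define V where "V t = snd (L t)" for t
  have Ulim: "(\<lambda>n. u (\<phi> n) (cl (\<phi> n) t)) \<longlonglongrightarrow> U t" for t
    using tendsto_fst[OF L[of t]] by (simp add: F_def U_def)
  have Vlim: "(\<lambda>n. v (\<phi> n) (cl (\<phi> n) t)) \<longlonglongrightarrow> V t" for t
    using tendsto_snd[OF L[of t]] by (simp add: F_def V_def)
  have "norm (L s - L t) \<le> (A + B) * \<bar>s - t\<bar>" for s t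
    by (rule LIMSEQ_le_const2[OF tendsto_norm[OF tendsto_diff[OF L L]]]) (use Flip in blast)
  then have "(A + B)-lipschitz_on UNIV L"
    by (intro lipschitz_onI) (use A0 B0 in \<open>auto simp: dist_norm\<close>)
  then have Lc: "continuous_on UNIV L" by (rule lipschitz_on_continuous_on)
  have Uc: "continuous_on UNIV U" and Vc: "continuous_on UNIV V"
    unfolding U_def V_def by (intro continuous_intros Lc)+
  have uc: "continuous_on S (\<lambda>z. u k (cl k z))" and vc: "continuous_on S (\<lambda>z. v k (cl k z))" for S k
    by (intro continuous_on_compose2[OF sol_continuous(1)[OF so]] cl_cont image_subsetI cl_in
        continuous_on_compose2[OF sol_continuous(2)[OF so]])+
  have ev\<phi>: "\<forall>\<^sub>F k in sequentially. x (\<phi> k) \<le> s \<and> t \<le> y (\<phi> k)" for s t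
    using filterlim_subseq[OF \<phi>(1)] ev[of s t] by (auto simp: filterlim_iff)
  have der: "(u k has_real_derivative v k (cl k z)) (at z within {s..t}) \<and>
      (v k has_real_derivative - c * v k (cl k z) - q z * h k (u k (cl k z))) (at z within {s..t})"
    if "x k \<le> s \<and> t \<le> y k" "z \<in> {s..t}" for k s t z
  proof -
    have "cl k z = z" using that by (auto simp: cl_def)
    moreover have "sol c q (h k) s t (u k) (v k)" by (rule sol_subset[OF so]) (use that in auto)
    ultimately show ?thesis using that by (simp add: sol_def)
  qed
  have Ulim': "(\<lambda>n. u (\<phi> n) t) \<longlonglongrightarrow> U t" for t
  proof (rule Lim_transform_eventually[OF Ulim])
    show "\<forall>\<^sub>F n in sequentially. u (\<phi> n) (cl (\<phi> n) t) = u (\<phi> n) t"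
      using ev\<phi>[of t t] by eventually_elim (auto simp: cl_def)
  qed
  have Vlim': "(\<lambda>n. v (\<phi> n) t) \<longlonglongrightarrow> V t" for t
  proof (rule Lim_transform_eventually[OF Vlim])
    show "\<forall>\<^sub>F n in sequentially. v (\<phi> n) (cl (\<phi> n) t) = v (\<phi> n) t"
      using ev\<phi>[of t t] by eventually_elim (auto simp: cl_def)
  qed
  have incU: "U t - U s = integral {s..t} V" if "s \<le> t" for s t
  proof (rule limit_increment[OF that, where f = "\<lambda>k. u (\<phi> k)" and f' = "\<lambda>k z. v (\<phi> k) (cl (\<phi> k) z)" and M = A])
    show "\<forall>\<^sub>F k in sequentially. \<forall>z\<in>{s..t}.
        (u (\<phi> k) has_real_derivative v (\<phi> k) (cl (\<phi> k) z)) (at z within {s..t})"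
      using ev\<phi>[of s t] by eventually_elim (use der in blast)
  qed (use vc A[OF cl_in] Vlim Ulim' in auto)
  have dU: "(U has_real_derivative V t) (at t)" for t
    by (rule derivative_of_increments[of U V, OF incU Vc])
  have incV: "V t - V s = integral {s..t} (\<lambda>z. - c * V z - q z * g (U z))" if "s \<le> t" for s t
  proof (rule limit_increment[OF that, where f = "\<lambda>k. v (\<phi> k)" and M = B and
        f' = "\<lambda>k z. - c * v (\<phi> k) (cl (\<phi> k) z) - q z * h (\<phi> k) (u (\<phi> k) (cl (\<phi> k) z))"])
    show "\<forall>\<^sub>F k in sequentially. \<forall>z\<in>{s..t}. (v (\<phi> k) has_real_derivative
        - c * v (\<phi> k) (cl (\<phi> k) z) - q z * h (\<phi> k) (u (\<phi> k) (cl (\<phi> k) z))) (at z within {s..t})"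
      using ev\<phi>[of s t] by eventually_elim (use der in blast)
    show "continuous_on {s..t} (\<lambda>z. - c * v (\<phi> k) (cl (\<phi> k) z) - q z * h (\<phi> k) (u (\<phi> k) (cl (\<phi> k) z)))" for k
      by (intro continuous_intros vc continuous_on_subset[OF qc] continuous_on_compose2[OF hc uc]) auto
    show "(\<lambda>k. - c * v (\<phi> k) (cl (\<phi> k) z) - q z * h (\<phi> k) (u (\<phi> k) (cl (\<phi> k) z)))
        \<longlonglongrightarrow> - c * V z - q z * g (U z)" for z
      by (intro tendsto_intros Vlim conv[OF \<phi>(1)] Ulim)
  qed (use rhs Vlim' in auto)
  have rc: "continuous_on UNIV (\<lambda>z. - c * V z - q z * g (U z))"
    by (intro continuous_intros Vc qc continuous_on_compose2[OF gc Uc]) auto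
  have dV: "(V has_real_derivative - c * V t - q t * g (U t)) (at t)" for t
    by (rule derivative_of_increments[of V "\<lambda>z. - c * V z - q z * g (U z)", OF incV rc])
  show ?thesis using \<phi>(1) Ulim' dU dV by blast
qed

text \<open>Only the existential clause needs more than pointwise convergence: the times of reaching
  \<open>r\<close> accumulate at some \<open>l\<close>, and the common Lipschitz constant transfers
  the inequality to \<open>l\<close>.\<close>

lemma stage_limit:
  fixes w :: "nat \<Rightarrow> real \<Rightarrow> real"
  assumes st: "\<forall>\<^sub>F k in sequentially. stage \<alpha> \<beta> T r b (w k) \<and> (\<forall>s\<in>{\<alpha>..\<beta>}. \<forall>t\<in>{\<alpha>..\<beta>}. \<bar>w k s - w k t\<bar> \<le> B * \<bar>s - t\<bar>)"
    and lim: "\<And>t. (\<lambda>k. w k t) \<longlonglongrightarrow> W t"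
  shows "stage \<alpha> \<beta> T r b W"
proof -
  have nn: "0 \<le> W t" if "t \<in> {\<alpha>..\<alpha> + T}" for t
    by (rule tendsto_lowerbound[OF lim])
       (use st that in \<open>auto elim!: eventually_mono simp: stage_def\<close>)
  have le: "W t \<le> r" if "t \<in> {\<beta>..\<alpha> + T}" for t
    by (rule tendsto_upperbound[OF lim])
       (use st that in \<open>auto elim!: eventually_mono simp: stage_def\<close>)
  have low: "W t \<le> r" if "\<not> b" "t \<in> {\<alpha>..\<beta>}" for t
    by (rule tendsto_upperbound[OF lim])
       (use st that in \<open>auto elim!: eventually_mono simp: stage_def\<close>)
  have "\<exists>t\<in>{\<alpha>..\<beta>}. r \<le> W t" if b
  proof -
    obtain N where N: "\<And>k. k \<ge> N \<Longrightarrow> \<exists>t\<in>{\<alpha>..\<beta>}. r \<le> w k t"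
      "\<And>k s t. k \<ge> N \<Longrightarrow> s \<in> {\<alpha>..\<beta>} \<Longrightarrow> t \<in> {\<alpha>..\<beta>} \<Longrightarrow> \<bar>w k s - w k t\<bar> \<le> B * \<bar>s - t\<bar>"
      using st \<open>b\<close> unfolding eventually_sequentially stage_def by (metis (no_types, lifting))
    then have "\<forall>k. \<exists>t. t \<in> {\<alpha>..\<beta>} \<and> r \<le> w (k + N) t" by (meson le_add2)
    then obtain \<tau> where \<tau>: "\<And>k. \<tau> k \<in> {\<alpha>..\<beta>}" "\<And>k. r \<le> w (k + N) (\<tau> k)" by metis
    obtain \<psi> l where \<psi>: "l \<in> {\<alpha>..\<beta>}" "strict_mono \<psi>" "(\<tau> \<circ> \<psi>) \<longlonglongrightarrow> l"
      using compact_Icc[of \<alpha> \<beta>] \<tau>(1) unfolding compact_def by metis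
    have "r - B * \<bar>\<tau> (\<psi> k) - l\<bar> \<le> w (\<psi> k + N) l" for k
      using \<tau>(2)[of "\<psi> k"] N(2)[of "\<psi> k + N" "\<tau> (\<psi> k)" l] \<tau>(1) \<psi>(1) by (simp add: abs_le_iff)
    moreover have "(\<lambda>k. r - B * \<bar>\<tau> (\<psi> k) - l\<bar>) \<longlonglongrightarrow> r - B * \<bar>l - l\<bar>"
      using \<psi>(3) by (intro tendsto_intros) (simp add: o_def)
    moreover have "(\<lambda>k. w (\<psi> k + N) l) \<longlonglongrightarrow> W l"
      using LIMSEQ_subseq_LIMSEQ[OF LIMSEQ_ignore_initial_segment[OF lim, of N] \<psi>(2)] by (simp add: o_def)
    ultimately have "r \<le> W l" by (intro LIMSEQ_le[of _ "r - B * \<bar>l - l\<bar>", simplified]) auto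
    then show ?thesis using \<psi>(1) by blast
  qed
  then show ?thesis using nn le low by (auto simp: stage_def)
qed

section \<open>Itineraries on windows growing in both directions\<close>

lemma period_shift_bounds:
  fixes \<alpha> T :: real
  assumes "- int m \<le> i \<and> i < int m" "T > 0"
  shows "\<alpha> - of_nat m * T \<le> \<alpha> + of_int i * T" "\<alpha> + T + of_int i * T \<le> \<alpha> + of_nat m * T"
proof -
  have "- real m \<le> of_int i" "of_int i + 1 \<le> real m" using assms(1) by linarith+
  then have "- real m * T \<le> of_int i * T" "(of_int i + 1) * T \<le> real m * T"
    using assms(2) by (intro mult_right_mono; simp)+
  then show "\<alpha> - of_nat m * T \<le> \<alpha> + of_int i * T" "\<alpha> + T + of_int i * T \<le> \<alpha> + of_nat m * T"
    by (simp_all add: distrib_right)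
qed

context lipschitz_shooting
begin

lemma W_bounded_global: "\<exists>Q\<ge>0. \<forall>t. \<bar>W t\<bar> \<le> Q"
proof -
  obtain Q where Q: "Q \<ge> 0" "\<forall>t\<in>{\<alpha>..\<alpha> + T}. \<bar>W t\<bar> \<le> Q" using W_bounded by blast
  have "\<bar>W t\<bar> \<le> Q" for t
  proof -
    obtain i where "\<alpha> \<le> t - of_int i * T" "t - of_int i * T < \<alpha> + T" using period_window[OF T_pos] .
    then have "\<bar>W (t - of_int i * T)\<bar> \<le> Q" using Q by auto
    then show ?thesis using W_periodic[of "t - of_int i * T" i] by simp
  qed
  then show ?thesis using Q by blast
qed

text \<open>A one-sided itinerary of \<open>2 * m\<close> periods, translated by \<open>m\<close>
  periods. Estimating the slope over one period at a time makes all bounds independent of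
  \<open>m\<close>.\<close>

lemma centered_itinerary:
  fixes \<sigma> :: "int \<Rightarrow> bool"
  assumes G: "\<And>s. s \<le> max r R \<Longrightarrow> h s \<le> G" and Q: "\<And>t. \<bar>W t\<bar> \<le> Q" and m: "m \<ge> 1"
  shows "\<exists>u v. sol c W h (\<alpha> - of_nat m * T) (\<alpha> + of_nat m * T) u v \<and>
    (\<forall>i. - int m \<le> i \<and> i < int m \<longrightarrow> stage \<alpha> \<beta> T r (\<sigma> i) (\<lambda>t. u (t + of_int i * T))) \<and>
    (\<forall>t\<in>{\<alpha> - of_nat m * T..\<alpha> + of_nat m * T}. 0 \<le> u t \<and> u t \<le> max r R \<and>
      \<bar>v t\<bar> \<le> exp (\<bar>c\<bar> * T) * (max r R / T + Q * G * T))"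
proof -
  let ?m = "of_nat m * T"
  obtain u0 v0 where s0: "sol c W h \<alpha> (\<alpha> + of_nat (2 * m) * T) u0 v0"
    and st0: "\<forall>j<2 * m. stage \<alpha> \<beta> T r (\<sigma> (int j - int m)) (\<lambda>t. u0 (t + of_nat j * T))"
    using finite_itinerary[of "2 * m" "\<lambda>j. \<sigma> (int j - int m)"] by blast
  define u where "u t = u0 (t + ?m)" for t
  define v where "v t = v0 (t + ?m)" for t
  have so: "sol c W h (\<alpha> - ?m) (\<alpha> + ?m) u v"
    unfolding u_def v_def
  proof (rule sol_shift[where q = W])
    have "\<alpha> - ?m + ?m = \<alpha>" "\<alpha> + ?m + ?m = \<alpha> + of_nat (2 * m) * T" by (simp_all add: algebra_simps)
    then show "sol c W h (\<alpha> - ?m + ?m) (\<alpha> + ?m + ?m) u0 v0" using s0 by (simp only:)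
    show "W (t + ?m) = W t" for t using W_periodic[of t "int m"] by simp
  qed
  have st: "stage \<alpha> \<beta> T r (\<sigma> i) (\<lambda>t. u (t + of_int i * T))" if "- int m \<le> i \<and> i < int m" for i
  proof -
    define j where "j = nat (i + int m)"
    have j: "j < 2 * m" "int j = i + int m" using that by (auto simp: j_def)
    have "of_nat j = (of_int (int j) :: real)" by simp
    then have "t + of_nat j * T = t + of_int i * T + ?m" for t unfolding j(2) by (simp add: algebra_simps)
    then show ?thesis using st0[rule_format, OF j(1)] j(2) by (simp add: u_def add.assoc)
  qed
  have "0 \<le> u t \<and> u t \<le> max r R \<and> \<bar>v t\<bar> \<le> exp (\<bar>c\<bar> * T) * (max r R / T + Q * G * T)"
    if t: "t \<in> {\<alpha> - ?m..\<alpha> + ?m}" for t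
  proof -
    \<comment> \<open>The window consists of the periods \<open>- m\<close> to \<open>m - 1\<close>.
      Its right end would get index \<open>m\<close> from \<open>period_window\<close>, so it is
      assigned to the last period by hand.\<close>
    obtain i :: int where i: "- int m \<le> i \<and> i < int m" and ti: "t - of_int i * T \<in> {\<alpha>..\<alpha> + T}"
    proof (cases "t = \<alpha> + ?m")
      case True
      have "t - of_int (int m - 1) * T = \<alpha> + T" unfolding True by (simp add: algebra_simps)
      then show thesis using that[of "int m - 1"] m T_pos by simp
    next
      case False
      obtain i where i: "\<alpha> \<le> t - of_int i * T" "t - of_int i * T < \<alpha> + T" using period_window[OF T_pos] .
      have "t < \<alpha> + ?m" "\<alpha> - ?m \<le> t" using t False by auto
      then have "of_int i * T < real m * T" "- (real m * T) < of_int i * T + T" using i by linarith+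
      then have "of_int i * T < real m * T" "- real m * T < (of_int i + 1) * T"
        by (simp_all only: distrib_right mult_minus_left mult_1_left)
      then have "real_of_int i < real m" "- real m < of_int i + 1"
        using T_pos mult_less_cancel_right_pos by blast+
      then have "- int m < i + 1" "i < int m" by linarith+
      then show thesis using that[of i] i by auto
    qed
    let ?u = "\<lambda>z. u (z + of_int i * T)" and ?v = "\<lambda>z. v (z + of_int i * T)"
    have si: "sol c W h \<alpha> (\<alpha> + T) ?u ?v"
    proof (rule sol_shift[where q = W])
      show "sol c W h (\<alpha> + of_int i * T) (\<alpha> + T + of_int i * T) u v"
        by (rule sol_subset[OF so]) (use period_shift_bounds[OF i T_pos, of \<alpha>] in auto)
    qed (rule W_periodic)
    have b: "0 \<le> ?u z \<and> ?u z \<le> max r R" if z: "z \<in> {\<alpha>..\<alpha> + T}" for z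
    proof (cases "z \<le> \<beta>")
      case True
      have s1: "sol c W h \<alpha> \<beta> ?u ?v" by (rule sol_subset[OF si]) (use ab in auto)
      have "?u z \<le> R"
        by (rule bounded[OF s1]) (use st[OF i] z True ab in \<open>auto simp: stage_def\<close>)
      then show ?thesis using st[OF i] z by (auto simp: stage_def)
    next
      case False
      then have "?u z \<le> r" using st[OF i] z by (auto simp: stage_def)
      then show ?thesis using st[OF i] z by (auto simp: stage_def)
    qed
    have "\<bar>?v (t - of_int i * T)\<bar> \<le> exp (\<bar>c\<bar> * (\<alpha> + T - \<alpha>)) * (max r R / (\<alpha> + T - \<alpha>) + Q * G * (\<alpha> + T - \<alpha>))"
    proof (rule slope_bound[OF si _ b _ ti])
      show "\<bar>W z * h (?u z)\<bar> \<le> Q * G" if "z \<in> {\<alpha>..\<alpha> + T}" for z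
        unfolding abs_mult
      proof (rule mult_mono)
        show "\<bar>h (u (z + of_int i * T))\<bar> \<le> G" using b[OF that] G h_nonneg by auto
        show "0 \<le> Q" using Q[of 0] by linarith
      qed (use Q in auto)
    qed (use T_pos in auto)
    then show ?thesis using b[OF ti] by simp
  qed
  then show ?thesis using so st by blast
qed

end

section \<open>Growth conditions of \<open>g\<close>, their inheritance by the approximations, and
  the theorem\<close>

lemma ratio_small_near_zero:
  assumes "Limsup (at_right 0) (\<lambda>s. ereal (g s / s)) = 0" "\<epsilon> > 0"
  obtains r where "r > 0" "\<And>s. 0 < s \<Longrightarrow> s \<le> r \<Longrightarrow> g s \<le> \<epsilon> * s"
proof -
  have "Limsup (at_right 0) (\<lambda>s. ereal (g s / s)) < ereal \<epsilon>" using assms by simp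
  then have "\<forall>\<^sub>F s in at_right 0. ereal (g s / s) < ereal \<epsilon>" by (rule Limsup_lessD)
  then obtain b where b: "b > 0" "\<And>s. 0 < s \<Longrightarrow> s < b \<Longrightarrow> g s / s < \<epsilon>"
    unfolding eventually_at_right_field by auto
  show thesis
  proof (rule that[of "b / 2"])
    show "g s \<le> \<epsilon> * s" if "0 < s" "s \<le> b / 2" for s
      using b(2)[of s] b(1) that by (simp add: pos_divide_less_eq)
  qed (use b in simp)
qed

lemma ratio_large_at_infinity:
  assumes "Liminf at_top (\<lambda>s. ereal (g s / s)) = \<infinity>"
  obtains \<rho> where "\<rho> > 0" "\<And>s. s \<ge> \<rho> \<Longrightarrow> g s \<ge> \<Lambda> * s"
proof -
  have "ereal \<Lambda> < Liminf at_top (\<lambda>s. ereal (g s / s))" using assms by simp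
  then have "\<forall>\<^sub>F s in at_top. ereal \<Lambda> < ereal (g s / s)" by (rule less_LiminfD)
  then obtain b where b: "\<And>s. s \<ge> b \<Longrightarrow> \<Lambda> < g s / s" unfolding eventually_at_top_linorder by auto
  show thesis
  proof (rule that[of "max b 1"])
    show "g s \<ge> \<Lambda> * s" if "s \<ge> max b 1" for s
      using b[of s] that by (simp add: pos_less_divide_eq)
  qed simp
qed

text \<open>For \<open>t \<ge> \<rho>\<close> the penalty of slope at least \<Lambda> makes up for
  \<open>t < s\<close>. For \<open>t < \<rho>\<close> the distance to \<open>s\<close> is at least
  \<open>s / 2\<close>, so the penalty suffices alone; this is why \<rho> and \<Lambda> are
  doubled.\<close>

lemma infconv_superlinear:
  assumes g: "\<And>t. t \<ge> 0 \<Longrightarrow> g t \<ge> 0" "g 0 = 0" and \<rho>: "\<rho> > 0" "\<And>t. t \<ge> \<rho> \<Longrightarrow> g t \<ge> \<Lambda> * t"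
    and \<Lambda>: "\<Lambda> > 0" and n: "n \<ge> 2 * \<Lambda>" and s: "s \<ge> 2 * \<rho>"
  shows "\<Lambda> * s \<le> infconv g n s"
proof (rule infconv_ge[where g = g, OF g])
  show "n \<ge> 0" using n \<Lambda> by simp
  fix t :: real assume t: "t \<ge> 0"
  have ms: "max s 0 = s" using s \<rho> by simp
  show "\<Lambda> * s \<le> g t + n * \<bar>max s 0 - t\<bar>"
  proof (cases "t \<ge> \<rho>")
    case True
    have "\<Lambda> * \<bar>s - t\<bar> \<le> n * \<bar>s - t\<bar>" using n \<Lambda> by (intro mult_right_mono) auto
    moreover have "\<Lambda> * (s - t) \<le> \<Lambda> * \<bar>s - t\<bar>" using \<Lambda> by (intro mult_left_mono) auto
    moreover have "\<Lambda> * (s - t) = \<Lambda> * s - \<Lambda> * t" by (rule right_diff_distrib)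
    ultimately show ?thesis using \<rho>(2)[OF True] ms by simp
  next
    case False
    then have "s / 2 \<le> \<bar>s - t\<bar>" using s by linarith
    then have "(2 * \<Lambda>) * (s / 2) \<le> n * \<bar>s - t\<bar>" using n \<Lambda> s \<rho> by (intro mult_mono) auto
    then show ?thesis using g(1)[OF t] ms by simp
  qed
qed

text \<open>Competitors outside \<open>[r/8, 2*r]\<close> are at distance at least
  \<open>r / 8\<close> from \<open>s\<close> and pay at least \<gamma> in penalty.\<close>

lemma infconv_bounded_below:
  assumes g: "\<And>t. t \<ge> 0 \<Longrightarrow> g t \<ge> 0" "g 0 = 0" and r: "r > 0" and \<gamma>: "\<gamma> > 0" "\<And>t. t \<in> {r/8..2*r} \<Longrightarrow> g t \<ge> \<gamma>"
    and n: "n \<ge> 8 * \<gamma> / r" and s: "s \<in> {r/4..r}"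
  shows "\<gamma> \<le> infconv g n s"
proof (rule infconv_ge[where g = g, OF g])
  have "8 * \<gamma> / r > 0" using \<gamma> r by simp
  with n show n0: "n \<ge> 0" by linarith
  fix t :: real assume t: "t \<ge> 0"
  have ms: "max s 0 = s" using s r by simp
  show "\<gamma> \<le> g t + n * \<bar>max s 0 - t\<bar>"
  proof (cases "t \<in> {r/8..2*r}")
    case True
    have "n * \<bar>max s 0 - t\<bar> \<ge> 0" using n0 by simp
    then show ?thesis using \<gamma>(2)[OF True] by linarith
  next
    case False
    then have "r / 8 \<le> \<bar>s - t\<bar>" using s r by auto
    then have "(8 * \<gamma> / r) * (r / 8) \<le> n * \<bar>s - t\<bar>" using n n0 r by (intro mult_mono) auto
    then show ?thesis using g(1)[OF t] ms r by simp
  qed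
qed

theorem theorem6p5:
  fixes c T \<alpha> \<beta> :: real and a g :: "real \<Rightarrow> real"
  assumes "T > 0"
    and "continuous_on UNIV a"
    and "minimal_period a T"
    and "\<alpha> < \<beta>" and "\<beta> < \<alpha> + T"
    and "a \<alpha> = 0" and "a \<beta> = 0"
    and "\<forall>t\<in>{\<alpha><..<\<beta>}. a t > 0"
    and "\<forall>t\<in>{\<beta><..<\<alpha> + T}. a t < 0"
    and "continuous_on {0..} g"
    and "\<forall>s\<ge>0. g s \<ge> 0"
    and "g 0 = 0"
    and "\<forall>s>0. g s > 0"
    and "Limsup (at_right 0) (\<lambda>s. ereal (g s / s)) = 0"
    and "Liminf at_top (\<lambda>s. ereal (g s / s)) = \<infinity>"
  shows "\<exists>r R \<mu>\<^sub>0. 0 < r \<and> r < R \<and> 0 < \<mu>\<^sub>0 \<and>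
    (\<forall>\<mu>>\<mu>\<^sub>0. \<forall>s :: int \<Rightarrow> nat. (\<forall>i. s i \<in> {0, 1}) \<and> (\<exists>i. s i \<noteq> 0) \<longrightarrow>
      (\<exists>u. positive_solution c a \<mu> g u \<and> sup_norm u < ereal R \<and>
        (\<forall>i. s i = 0 \<longrightarrow>
          (\<forall>t\<in>{\<alpha> + of_int i * T..\<beta> + of_int i * T}. 0 < u t \<and> u t < r)) \<and>
        (\<forall>i. s i = 1 \<longrightarrow>
          (\<exists>t\<in>{\<alpha> + of_int i * T..\<beta> + of_int i * T}. r < u t \<and> u t < R)) \<and>
        (\<forall>i::int. \<forall>t\<in>{\<beta> + of_int i * T..\<alpha> + (of_int i + 1) * T}. 0 < u t \<and> u t < r)))"
proof -
  note ac = assms(2) and gc = assms(10) and g0 = assms(12)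
  have ap: "a (t + T) = a t" for t using assms(3) by (simp add: minimal_period_def periodic_def)
  have gnn: "g t \<ge> 0" if "t \<ge> 0" for t using assms(11) that by blast
  have gcs: "continuous_on S g" if "S \<subseteq> {0..}" for S by (rule continuous_on_subset[OF gc that])
  have gxc: "continuous_on UNIV (\<lambda>s. g (max s 0))"
    by (rule continuous_on_compose2[OF gc]) (auto intro!: continuous_intros)
  obtain \<epsilon> \<Lambda> \<kappa> where pos: "\<epsilon> > 0" "\<Lambda> > 0" "\<kappa> > 0" and
    admissible: "\<forall>r>0. \<forall>\<rho>>0. \<forall>G>0. \<forall>\<gamma>>0. \<exists>K. \<exists>\<mu>\<^sub>0>0. \<forall>\<mu>>\<mu>\<^sub>0. \<forall>h.
      (\<forall>s. h s \<ge> 0) \<and> (\<forall>s\<le>0. h s = 0) \<and> (\<forall>s\<le>r. h s \<le> \<epsilon> * r) \<and> (\<forall>s\<ge>\<rho>. h s \<ge> \<Lambda> * s) \<and>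
      (\<forall>s\<le>\<rho> / \<kappa>. h s \<le> G) \<and> (\<forall>s\<in>{r/4..r}. h s \<ge> \<gamma>) \<longrightarrow> shooting c T \<alpha> \<beta> \<mu> r (\<rho> / \<kappa>) K a h"
    using shooting_constants[OF assms(4,5) ac ap assms(8,9), of c] by (elim exE conjE)
  obtain r where r: "r > 0" "\<And>s. 0 < s \<Longrightarrow> s \<le> r \<Longrightarrow> g s \<le> \<epsilon> * s"
    using ratio_small_near_zero[OF assms(14) pos(1)] by blast
  obtain \<rho> where \<rho>: "\<rho> > 0" "\<And>s. s \<ge> \<rho> \<Longrightarrow> g s \<ge> \<Lambda> * s"
    using ratio_large_at_infinity[OF assms(15)] by blast
  \<comment> \<open>The approximations inherit the linear lower bound only from
    \<open>2 * \<rho>\<close> on, so the a priori bound is taken with this threshold.\<close>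
  define R where "R = 2 * \<rho> / \<kappa>"
  \<comment> \<open>\<open>r\<close> and \<open>R\<close> have not been compared; the maximum bounds
    the solutions on both parts of a period.\<close>
  define Rm where "Rm = max r R"
  have Rm: "Rm > 0" "r \<le> Rm" "R \<le> Rm" using r by (auto simp: Rm_def)
  have "bounded (g ` {0..Rm})"
    by (intro compact_imp_bounded compact_continuous_image gcs) auto
  then obtain G where G: "G > 0" "\<And>s. s \<in> {0..Rm} \<Longrightarrow> g s \<le> G"
    unfolding bounded_pos by (metis abs_le_D1 imageI real_norm_def)
  have "continuous_on {r/8..2*r} g" by (rule gcs) (use r in auto)
  then obtain z where z: "z \<in> {r/8..2*r}" "\<forall>t\<in>{r/8..2*r}. g z \<le> g t"
    using continuous_attains_inf[of "{r/8..2*r}" g] r by auto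
  define \<gamma> where "\<gamma> = g z"
  have \<gamma>: "\<gamma> > 0" "\<And>t. t \<in> {r/8..2*r} \<Longrightarrow> g t \<ge> \<gamma>" using z r assms(13) by (auto simp: \<gamma>_def)
  have \<rho>2: "2 * \<rho> > 0" using \<rho>(1) by simp
  obtain K \<mu>0 where \<mu>0: "\<mu>0 > 0" and shoot: "\<forall>\<mu>>\<mu>0. \<forall>h.
      (\<forall>s. h s \<ge> 0) \<and> (\<forall>s\<le>0. h s = 0) \<and> (\<forall>s\<le>r. h s \<le> \<epsilon> * r) \<and> (\<forall>s\<ge>2 * \<rho>. h s \<ge> \<Lambda> * s) \<and>
      (\<forall>s\<le>R. h s \<le> G) \<and> (\<forall>s\<in>{r/4..r}. h s \<ge> \<gamma>) \<longrightarrow> shooting c T \<alpha> \<beta> \<mu> r R K a h"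
    using admissible[rule_format, OF r(1) \<rho>2 G(1) \<gamma>(1)] unfolding R_def by (elim exE conjE)
  have g\<epsilon>: "g (max s 0) \<le> \<epsilon> * r" if "s \<le> r" for s
  proof (cases "s \<le> 0")
    case True
    then show ?thesis using g0 pos r by (simp add: max.absorb2)
  next
    case False
    then have "g s \<le> \<epsilon> * s" using r(2) that by simp
    also have "\<dots> \<le> \<epsilon> * r" using that pos by (intro mult_left_mono) auto
    finally show ?thesis using False by simp
  qed
  have gG: "g (max s 0) \<le> G" if "s \<le> Rm" for s using G(2)[of "max s 0"] that Rm by auto
  \<comment> \<open>The maximum meets the demands of both inheritance lemmas already at
    \<open>k = 0\<close>; the summand \<open>real k\<close> drives the convergence to
    \<open>g\<close>.\<close>
  define n where "n k = max (2 * \<Lambda>) (8 * \<gamma> / r) + real k" for k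
  have n: "n k \<ge> 0" "n k \<ge> 2 * \<Lambda>" "n k \<ge> 8 * \<gamma> / r" for k using pos by (auto simp: n_def max_def)
  have nlim: "filterlim n at_top sequentially"
    unfolding n_def by (intro filterlim_tendsto_add_at_top[OF tendsto_const] filterlim_real_sequentially)
  define h where "h k = infconv g (n k)" for k
  have hle: "h k s \<le> g (max s 0)" for k s
    unfolding h_def by (rule infconv_le_self[where g = g, OF gnn g0 n(1)])
  have hnn: "h k s \<ge> 0" for k s
    unfolding h_def by (rule infconv_nonneg[where g = g, OF gnn g0 n(1)])
  have hlip: "\<bar>h k x - h k y\<bar> \<le> n k * \<bar>x - y\<bar>" for k x y
    unfolding h_def by (rule infconv_lipschitz[where g = g, OF gnn g0 n(1)])
  have hcont: "continuous_on UNIV (h k)" for k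
  proof -
    have "(n k)-lipschitz_on UNIV (h k)"
      by (rule lipschitz_onI) (use hlip n in \<open>auto simp: dist_real_def\<close>)
    then show ?thesis by (rule lipschitz_on_continuous_on)
  qed
  show ?thesis
  \<comment> \<open>The supremum is only known to be at most \<open>Rm\<close>; adding 1 makes the
    norm bound strict.\<close>
  proof (rule exI[of _ r], rule exI[of _ "Rm + 1"], rule exI[of _ \<mu>0], intro conjI allI impI)
    show "0 < r" "r < Rm + 1" "0 < \<mu>0" using r Rm \<mu>0 by auto
    fix \<mu> and s :: "int \<Rightarrow> nat"
    assume \<mu>: "\<mu>0 < \<mu>" and s: "(\<forall>i. s i \<in> {0, 1}) \<and> (\<exists>i. s i \<noteq> 0)"
    define \<sigma> where "\<sigma> i \<longleftrightarrow> s i = 1" for i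
    \<comment> \<open>The extended \<open>g\<close> satisfies the same inequalities as its
      approximations, so the strictness argument is available for the limit with the same
      \<open>K\<close>.\<close>
    interpret S: shooting c T \<alpha> \<beta> \<mu> r R K a "\<lambda>s. g (max s 0)"
      by (rule shoot[rule_format, OF \<mu>])
         (use gnn g0 g\<epsilon> gG Rm \<rho> \<gamma>(2) r(1) in \<open>auto simp: max.absorb1 max.absorb2\<close>)
    have LS: "lipschitz_shooting c T \<alpha> \<beta> \<mu> r R K a (h k) (n k)" for k
    proof -
      have "shooting c T \<alpha> \<beta> \<mu> r R K a (h k)"
      proof (rule shoot[rule_format, OF \<mu>], intro conjI allI impI ballI)
        show "0 \<le> h k s" for s by (rule hnn)
        show "h k s = 0" if "s \<le> 0" for s
          unfolding h_def by (rule infconv_zero[where g = g, OF gnn g0 n(1) that])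
        show "h k s \<le> \<epsilon> * r" if "s \<le> r" for s using hle[of k s] g\<epsilon>[OF that] by linarith
        show "h k s \<ge> \<Lambda> * s" if "s \<ge> 2 * \<rho>" for s
          unfolding h_def
          by (rule infconv_superlinear[where g = g, OF gnn g0 \<rho> pos(2) n(2) that])
        show "h k s \<le> G" if "s \<le> R" for s using hle[of k s] gG[of s] that Rm by linarith
        show "h k s \<ge> \<gamma>" if "s \<in> {r/4..r}" for s
          unfolding h_def
          by (rule infconv_bounded_below[where g = g, OF gnn g0 r(1) \<gamma> n(3) that])
      qed
      then show ?thesis
        by (rule lipschitz_shooting.intro) (unfold_locales, use n hlip in auto)
    qed
    obtain Q where Q: "\<And>t. \<bar>S.W t\<bar> \<le> Q"
      using lipschitz_shooting.W_bounded_global[OF LS[of 0]] by blast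
    define A where "A = exp (\<bar>c\<bar> * T) * (max r R / T + Q * G * T)"
    \<comment> \<open>Window and Lipschitz constant grow together with \<open>k\<close>, while the
      bounds \<open>max r R\<close> and \<open>A\<close> are fixed. \<open>Suc k\<close> ensures at
      least one period on each side.\<close>
    have "\<exists>u v. sol c S.W (h k) (\<alpha> - of_nat (Suc k) * T) (\<alpha> + of_nat (Suc k) * T) u v \<and>
      (\<forall>i. - int (Suc k) \<le> i \<and> i < int (Suc k) \<longrightarrow> stage \<alpha> \<beta> T r (\<sigma> i) (\<lambda>t. u (t + of_int i * T))) \<and>
      (\<forall>t\<in>{\<alpha> - of_nat (Suc k) * T..\<alpha> + of_nat (Suc k) * T}. 0 \<le> u t \<and> u t \<le> max r R \<and> \<bar>v t\<bar> \<le> A)" for k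
      unfolding A_def
    proof (rule lipschitz_shooting.centered_itinerary[OF LS _ Q])
      show "h k s \<le> G" if "s \<le> max r R" for s using hle[of k s] gG[of s] that unfolding Rm_def by linarith
    qed simp
    then obtain u v where so: "\<And>k. sol c S.W (h k) (\<alpha> - of_nat (Suc k) * T) (\<alpha> + of_nat (Suc k) * T) (u k) (v k)"
      and st: "\<And>k i. - int (Suc k) \<le> i \<and> i < int (Suc k) \<Longrightarrow> stage \<alpha> \<beta> T r (\<sigma> i) (\<lambda>t. u k (t + of_int i * T))"
      and bd: "\<And>k t. t \<in> {\<alpha> - of_nat (Suc k) * T..\<alpha> + of_nat (Suc k) * T} \<Longrightarrow>
        0 \<le> u k t \<and> u k t \<le> max r R \<and> \<bar>v k t\<bar> \<le> A"
      by metis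
    define A' where "A' = max (max Rm A) G"
    have lin: "filterlim (\<lambda>k. real (Suc k) * T) at_top sequentially"
    proof -
      have "filterlim (\<lambda>k. real (Suc k)) at_top sequentially"
        by (rule filterlim_compose[OF filterlim_real_sequentially filterlim_Suc])
      then show ?thesis
        using assms(1) by (intro filterlim_at_top_mult_tendsto_pos[OF tendsto_const]) auto
    qed
    have "\<exists>\<phi> U V. strict_mono (\<phi> :: nat \<Rightarrow> nat) \<and> (\<forall>t. (\<lambda>k. u (\<phi> k) t) \<longlonglongrightarrow> U t) \<and>
      (\<forall>t. (U has_real_derivative V t) (at t)) \<and>
      (\<forall>t. (V has_real_derivative - c * V t - S.W t * g (max (U t) 0)) (at t))"
    proof (rule limit_solution[OF so])
      show "\<alpha> - of_nat (Suc k) * T \<le> \<alpha> + of_nat (Suc k) * T" for k using assms(1) by simp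
      show "filterlim (\<lambda>k. \<alpha> + of_nat (Suc k) * T) at_top sequentially"
        by (rule filterlim_tendsto_add_at_top[OF tendsto_const lin])
      have "filterlim (\<lambda>k. - \<alpha> + of_nat (Suc k) * T) at_top sequentially"
        by (rule filterlim_tendsto_add_at_top[OF tendsto_const lin])
      then show "filterlim (\<lambda>k. \<alpha> - of_nat (Suc k) * T) at_bot sequentially"
        by (simp add: filterlim_uminus_at_bot)
      show "\<bar>u k t\<bar> \<le> A' \<and> \<bar>v k t\<bar> \<le> A' \<and> \<bar>h k (u k t)\<bar> \<le> A'"
        if "t \<in> {\<alpha> - of_nat (Suc k) * T..\<alpha> + of_nat (Suc k) * T}" for k t
      proof -
        have "h k (u k t) \<le> G" using hle[of k "u k t"] gG[of "u k t"] bd[OF that] unfolding Rm_def by linarith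
        then show ?thesis using bd[OF that] hnn[of k "u k t"] unfolding A'_def Rm_def by auto
      qed
      show "continuous_on UNIV S.W" by (rule S.W_cont)
      show "\<bar>S.W t\<bar> \<le> Q" for t by (rule Q)
      show "continuous_on UNIV (h k)" for k by (rule hcont)
      show "continuous_on UNIV (\<lambda>s. g (max s 0))" by (rule gxc)
      show "(\<lambda>k. h (\<phi> k) (x k)) \<longlonglongrightarrow> g (max l 0)" if "strict_mono \<phi>" "x \<longlonglongrightarrow> l" for \<phi> x l
      proof -
        have "filterlim (\<lambda>k. n (\<phi> k)) at_top sequentially"
          by (rule filterlim_compose[OF nlim filterlim_subseq[OF that(1)]])
        then show ?thesis
          unfolding h_def by (intro infconv_tendsto gnn g0 gc n(1) that(2))
      qed
    qed
    then obtain \<phi> U V where \<phi>: "strict_mono (\<phi> :: nat \<Rightarrow> nat)" and Ulim: "\<And>t. (\<lambda>k. u (\<phi> k) t) \<longlonglongrightarrow> U t"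
      and dU: "\<And>t. (U has_real_derivative V t) (at t)"
      and dV: "\<And>t. (V has_real_derivative - c * V t - S.W t * g (max (U t) 0)) (at t)"
      by blast
    have stU: "stage \<alpha> \<beta> T r (\<sigma> i) (\<lambda>t. U (t + of_int i * T))" for i
    proof (rule stage_limit[where w = "\<lambda>k t. u (\<phi> k) (t + of_int i * T)" and B = A])
      show "\<forall>\<^sub>F k in sequentially. stage \<alpha> \<beta> T r (\<sigma> i) (\<lambda>t. u (\<phi> k) (t + of_int i * T)) \<and>
        (\<forall>s\<in>{\<alpha>..\<beta>}. \<forall>t\<in>{\<alpha>..\<beta>}. \<bar>u (\<phi> k) (s + of_int i * T) - u (\<phi> k) (t + of_int i * T)\<bar> \<le> A * \<bar>s - t\<bar>)"
        using eventually_ge_at_top[of "nat \<bar>i\<bar>"]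
      proof eventually_elim
        case (elim k)
        have "k \<le> \<phi> k" by (rule seq_suble[OF \<phi>])
        then have i: "- int (Suc (\<phi> k)) \<le> i \<and> i < int (Suc (\<phi> k))" using elim by linarith
        have win: "t + of_int i * T \<in> {\<alpha> - of_nat (Suc (\<phi> k)) * T..\<alpha> + of_nat (Suc (\<phi> k)) * T}"
          if "t \<in> {\<alpha>..\<beta>}" for t
          using that assms(4,5) period_shift_bounds[OF i assms(1), of \<alpha>] unfolding atLeastAtMost_iff
          by linarith
        have "\<bar>u (\<phi> k) (s + of_int i * T) - u (\<phi> k) (t + of_int i * T)\<bar> \<le>
            A * \<bar>(s + of_int i * T) - (t + of_int i * T)\<bar>" if "s \<in> {\<alpha>..\<beta>}" "t \<in> {\<alpha>..\<beta>}" for s t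
          by (rule sol_lipschitz[OF so _ win[OF that(1)] win[OF that(2)]]) (use bd in blast)
        then show ?case using st[OF i] by simp
      qed
      show "(\<lambda>k. u (\<phi> k) (t + of_int i * T)) \<longlonglongrightarrow> U (t + of_int i * T)" for t by (rule Ulim)
    qed
    note strict = S.strict_itinerary[OF dU dV stU]
    have soU: "sol c S.W (\<lambda>s. g (max s 0)) x y U V" for x y
      unfolding sol_def using dU dV by (auto intro: has_field_derivative_at_within)
    \<comment> \<open>A zero of the nonnegative \<open>U\<close> is a minimum, so the slope vanishes
      as well, and \<open>sol_zero\<close> would force \<open>U\<close> to vanish also where a
      symbol 1 makes it exceed \<open>r\<close>.\<close>
    have Upos: "U t > 0" for t
    proof (rule ccontr)
      assume "\<not> U t > 0"
      then have Ut: "U t = 0" using strict(4)[of t] by simp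
      have Vt: "V t = 0"
        by (rule DERIV_local_min[OF dU, of 1]) (use Ut strict(4) in auto)
      obtain i where "\<sigma> i" using s unfolding \<sigma>_def by (metis insertE singletonD)
      then obtain t' where t': "r < U (t' + of_int i * T)" using strict(3) by blast
      let ?y = "t' + of_int i * T"
      \<comment> \<open>A linear bound on the range of \<open>U\<close>: \<epsilon> works up to
        \<open>r\<close> by the choice of \<open>r\<close>, and \<open>G / r\<close> beyond, where
        \<open>g\<close> is at most \<open>G\<close>.\<close>
      define L where "L = max \<epsilon> (G / r)"
      have L: "L \<ge> 0" using pos(1) by (simp add: L_def)
      have gL: "\<bar>g (max (U z) 0)\<bar> \<le> L * \<bar>U z\<bar>" for z
      proof -
        have Uz: "0 \<le> U z" "U z \<le> Rm" using strict(4,5) by (auto simp: Rm_def)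
        consider "U z = 0" | "0 < U z" "U z \<le> r" | "r < U z" using Uz by linarith
        then have "g (U z) \<le> L * U z"
        proof cases
          case 1
          then show ?thesis using g0 by simp
        next
          case 2
          then have "g (U z) \<le> \<epsilon> * U z" using r(2) by simp
          also have "\<dots> \<le> L * U z" using Uz by (intro mult_right_mono) (auto simp: L_def)
          finally show ?thesis .
        next
          case 3
          have "g (U z) \<le> G" using G(2) Uz by simp
          also have "G = (G / r) * r" using r by simp
          also have "\<dots> \<le> L * U z" using 3 r(1) L by (intro mult_mono) (auto simp: L_def)
          finally show ?thesis .
        qed
        then show ?thesis using Uz gnn by simp
      qed
      have "U ?y = 0"
        by (rule sol_zero[OF soU[of "min t ?y" "max t ?y"], where Q = Q and L = L and z = t])
           (use Q gL Ut Vt L in auto)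
      then show False using t' r by simp
    qed
    have psol: "positive_solution c a \<mu> g U"
      unfolding positive_solution_def
    proof (intro conjI allI Upos, rule exI[of _ V],
        rule exI[of _ "\<lambda>t. - c * V t - S.W t * g (max (U t) 0)"], intro conjI allI dU dV)
      show "- c * V t - S.W t * g (max (U t) 0) + c * V t +
        (plus_part (a t) - \<mu> * minus_part (a t)) * g (U t) = 0" for t
        using Upos[of t] by (simp add: weight_def max.absorb1)
    qed
    have Ule: "\<bar>U t\<bar> \<le> Rm" for t using strict(5)[of t] Upos[of t] by (simp add: Rm_def)
    have "sup_norm U \<le> ereal Rm" unfolding sup_norm_def by (rule SUP_least) (use Ule in simp)
    then have sn: "sup_norm U < ereal (Rm + 1)" by (rule le_less_trans) simp
    have UR: "U t < Rm + 1" for t using Ule[of t] by simp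
    show "\<exists>u. positive_solution c a \<mu> g u \<and> sup_norm u < ereal (Rm + 1) \<and>
        (\<forall>i. s i = 0 \<longrightarrow>
          (\<forall>t\<in>{\<alpha> + of_int i * T..\<beta> + of_int i * T}. 0 < u t \<and> u t < r)) \<and>
        (\<forall>i. s i = 1 \<longrightarrow>
          (\<exists>t\<in>{\<alpha> + of_int i * T..\<beta> + of_int i * T}. r < u t \<and> u t < Rm + 1)) \<and>
        (\<forall>i::int. \<forall>t\<in>{\<beta> + of_int i * T..\<alpha> + (of_int i + 1) * T}. 0 < u t \<and> u t < r)"
    proof (intro exI[of _ U] conjI allI impI ballI psol sn Upos)
      fix i t assume "s i = 0" and t: "t \<in> {\<alpha> + of_int i * T..\<beta> + of_int i * T}"
      then have "U (t - of_int i * T + of_int i * T) < r"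
        by (intro strict(2)) (auto simp: \<sigma>_def)
      then show "U t < r" by simp
    next
      fix i assume "s i = 1"
      then obtain t where t: "t \<in> {\<alpha>..\<beta>}" "r < U (t + of_int i * T)"
        using strict(3)[of i] by (auto simp: \<sigma>_def)
      then show "\<exists>t\<in>{\<alpha> + of_int i * T..\<beta> + of_int i * T}. r < U t \<and> U t < Rm + 1"
        by (intro bexI[of _ "t + of_int i * T"]) (auto simp: UR)
    next
      fix i :: int and t assume "t \<in> {\<beta> + of_int i * T..\<alpha> + (of_int i + 1) * T}"
      then have "U (t - of_int i * T + of_int i * T) < r"
        by (intro strict(1)) (auto simp: algebra_simps)
      then show "U t < r" by simp
    qed
  qed
qed

end
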